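(* Let $\mathbb{S}$ and $\mathbb{S}_*$ be Riemann surfaces of hyperbolic type, and let $D\subset\mathbb{S}$ and $D_*\subset\mathbb{S}_*$ be domains whose closures $\overline{D}$ and $\overline{D_*}$ are compact. Let $f$ be a continuous mapping of $D$ onto $D_*$ which is differentiable almost everywhere, belongs to the class $ACP^{-1}$, and has both the Luzin $N$-property and the Luzin $N^{-1}$-property. Then for every family $\Gamma$ of (locally rectifiable) curves in $D$ and every $\rho\in\mathrm{adm}\,\Gamma$, $$M(f(\Gamma))\le\int_{D}K_f(p)\,\rho^2(p)\,d\widetilde{h}(p),$$ where $f(\Gamma)=\{f\circ\gamma:\gamma\in\Gamma\}$.
   Context: Surfaces. $\mathbb{D}=\{z\in\mathbb{C}:|z|<1\}$. A Riemann surface is a two-dimensional manifold with countable base whose transition maps are conformal. It is of hyperbolic type if it is conformally equivalent to a quotient $\mathbb{D}/G$, where $G$ is a group of linear-fractional automorphisms of $\mathbb{D}$ without fixed points and acting discontinuously in $\mathbb{D}$; we take $\mathbb{S}=\mathbb{D}/G$ and $\mathbb{S}_*=\mathbb{D}/G_*$. Points of $\mathbb{D}/G$ are orbits; $\pi:\mathbb{D}\to\mathbb{D}/G$ is the natural projection. Metric and measure. On $\mathbb{D}$ use the hyperbolic metric $h(z_1,z_2)=\log\frac{1+t}{1-t}$, $t=\frac{|z_1-z_2|}{|1-z_1\overline{z_2}|}$, and the hyperbolic area $h(S)=\int_S\frac{4\,dm(z)}{(1-|z|^2)^2}$, $m$ being planar Lebesgue measure. The metric on $\mathbb{S}$ is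 $\widetilde{h}(p_1,p_2)=\inf_{g_1,g_2\in G}h(g_1(z_1),g_2(z_2))$, where $p_i$ is the orbit of $z_i$. A fundamental set $F\subset\mathbb{D}$ contains exactly one point of each orbit, and is taken with $D_0\subset F\subset\overline{D_0}$ for a fundamental domain $D_0$ (a domain in $\mathbb{D}$) with $h(\partial D_0)=0$. The measure on $\mathbb{S}$ is $\widetilde{h}(E)=h(\pi^{-1}(E)\cap F)$ for measurable $E$. Arc length of curves on $\mathbb{S}$ is taken with respect to the metric $\widetilde{h}$, with length element $ds_{\widetilde{h}}$. The corresponding objects on $\mathbb{S}_*$ are denoted $\widetilde{h_*}$, $ds_{\widetilde{h_*}}$, $d\widetilde{h_*}$. Curves and modulus. A curve is a continuous map of a finite closed, open or half-open interval of the real line into the surface. For a family $\Gamma$ of curves in $\mathbb{S}$, a Borel function $\rho:\mathbb{S}\to[0,\infty]$ is admissible, $\rho\in\mathrm{adm}\,\Gamma$, if $\int_\gamma\rho\,ds_{\widetilde{h}}\ge1$ for every (locally rectifiable) $\gamma\in\Gamma$. The modulus is $M(\Gamma)=\inf_{\rho\in\mathrm{adm}\,\Gamma}\int_{\mathbb{S}}\rho^2\,d\widetilde{h}$; likewise on $\mathbb{S}_*$. A property holds for almost all curves if the family of curves for which it fails has modulus zero. Dilatation. In local coordinates $z=x+iy$, put $f_{\overline z}=(f_x+if_y)/2$, $f_z=(f_x-if_y)/2$, $\|f'(z)\|=|f_z|+|f_{\overline z}|$, $J_f(z)=|f_z|^2-|f_{\overline z}|^2$. Define $K_f(z)=\frac{|f_z|+|f_{\overline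 z}|}{\big||f_z|-|f_{\overline z}|\big|}$ if $J_f(z)\ne0$, $K_f(z)=1$ if $\|f'(z)\|=0$, and $K_f(z)=\infty$ otherwise. This does not depend on the local coordinates. Class $ACP^{-1}$. For a locally rectifiable curve $\gamma:\Delta\to\mathbb{S}$ on an open interval $\Delta$ and a fixed $t_0\in\Delta$, let $l_\gamma:\Delta\to\Delta_\gamma\subset\mathbb{R}$ be the non-decreasing length function: $l_\gamma(t_0)=0$, $l_\gamma(t)$ is the length of $\gamma|_{[t_0,t]}$ for $t>t_0$ and minus the length of $\gamma|_{[t,t_0]}$ for $t<t_0$. If $\gamma$ is given on $[a,b]$ or $[a,b)$, take $t_0=a$. If $\widetilde\gamma=f\circ\gamma$ is also locally rectifiable, $L_{\gamma,f}:\Delta_\gamma\to\Delta_{\widetilde\gamma}$ is the unique non-decreasing function with $L_{\gamma,f}(l_\gamma(t))=l_{\widetilde\gamma}(t)$ for all $t\in\Delta$. A curve $\gamma$ in $D$ is a lift of $\widetilde\gamma$ under $f$ if $\widetilde\gamma=f\circ\gamma$. Then $f\in ACP^{-1}$ means: $f$ maps no (nonconstant) curve in $D$ to a point (so that $L_{\gamma,f}^{-1}$ is defined), and for almost all curves $\widetilde\gamma$ in $f(D)$ every lift $\gamma$ of $\widetilde\gamma$ under $f$ is locally rectifiable and $L_{\gamma,f}^{-1}$ is absolutely continuous on every closed interval contained in $\Delta_{\widetilde\gamma}$. Luzin properties. $f:D\to D_*$ has the $N$-property if $\widetilde{h_*}(f(E))=0$ for every $E\subset D$ with $\widetilde{h}(E)=0$,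 and the $N^{-1}$-property if $\widetilde{h}(f^{-1}(E_* ))=0$ for every $E_*\subset D_*$ with $\widetilde{h_*}(E_* )=0$. *)

theory Defs
  imports "HOL-Analysis.Analysis" "HOL-Algebra.Bij"
begin

section \<open>Surfaces of hyperbolic type\<close>

abbreviation unit_disc :: "complex set" where
  "unit_disc \<equiv> ball 0 1"

text \<open>Elements of \<open>BijGroup unit_disc\<close> are extensional, so a group element is a function that is
  fixed (to \<open>undefined\<close>) outside the disc. A Moebius map with a pole in the disc never
  restricts to a bijection of the disc, so no separate condition on the denominator is needed.\<close>

definition disc_group :: "(complex \<Rightarrow> complex) set \<Rightarrow> bool" where
  "disc_group G \<longleftrightarrow>
     subgroup G (BijGroup unit_disc) \<and>
     (\<forall>g\<in>G. \<exists>a b c d. a * d - b * c \<noteq> 0 \<and> g = restrict (moebius a b c d) unit_disc) \<and>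
     (\<forall>g\<in>G. (\<exists>z\<in>unit_disc. g z = z) \<longrightarrow> (\<forall>z\<in>unit_disc. g z = z)) \<and>
     (\<forall>z\<in>unit_disc. \<exists>U. open U \<and> z \<in> U \<and> U \<subseteq> unit_disc \<and> finite {g \<in> G. g ` U \<inter> U \<noteq> {}})"

definition orbit :: "(complex \<Rightarrow> complex) set \<Rightarrow> complex \<Rightarrow> complex set" where
  "orbit G z = (\<lambda>g. g z) ` G"

definition surf :: "(complex \<Rightarrow> complex) set \<Rightarrow> complex set set" where
  "surf G = orbit G ` unit_disc"

definition preim :: "(complex \<Rightarrow> complex) set \<Rightarrow> complex set set \<Rightarrow> complex set" where
  "preim G E = {z \<in> unit_disc. orbit G z \<in> E}"

definition surf_topology :: "(complex \<Rightarrow> complex) set \<Rightarrow> complex set topology" where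
  "surf_topology G = topology (\<lambda>U. U \<subseteq> surf G \<and> open (preim G U))"

lemma openin_surf_topology:
  "openin (surf_topology G) U \<longleftrightarrow> U \<subseteq> surf G \<and> open (preim G U)"
proof -
  have "istopology (\<lambda>U. U \<subseteq> surf G \<and> open (preim G U))"
    unfolding istopology_def
  proof (intro conjI allI impI)
    fix S T assume "S \<subseteq> surf G \<and> open (preim G S)" "T \<subseteq> surf G \<and> open (preim G T)"
    moreover have "preim G (S \<inter> T) = preim G S \<inter> preim G T"
      by (auto simp: preim_def)
    ultimately show "S \<inter> T \<subseteq> surf G" "open (preim G (S \<inter> T))"
      by auto
  next
    fix \<K> assume "\<forall>K\<in>\<K>. K \<subseteq> surf G \<and> open (preim G K)"
    moreover have "preim G (\<Union>\<K>) = (\<Union>K\<in>\<K>. preim G K)"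
      by (auto simp: preim_def)
    ultimately show "\<Union>\<K> \<subseteq> surf G" "open (preim G (\<Union>\<K>))"
      by auto
  qed
  then show ?thesis
    by (simp add: surf_topology_def topology_inverse')
qed

lemma topspace_surf_topology: "topspace (surf_topology G) = surf G"
proof -
  have "preim G (surf G) = unit_disc"
    by (auto simp: preim_def surf_def)
  then have "openin (surf_topology G) (surf G)"
    by (simp add: openin_surf_topology)
  then show ?thesis
    by (metis openin_subset openin_surf_topology openin_topspace subset_antisym)
qed

definition surf_domain :: "(complex \<Rightarrow> complex) set \<Rightarrow> complex set set \<Rightarrow> bool" where
  "surf_domain G D \<longleftrightarrow>
     D \<noteq> {} \<and> openin (surf_topology G) D \<and> connectedin (surf_topology G) D"


section \<open>Hyperbolic metric and area\<close>

definition hyp_dist :: "complex \<Rightarrow> complex \<Rightarrow> real" where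
  "hyp_dist z w =
     (let t = cmod (z - w) / cmod (1 - z * cnj w) in ln ((1 + t) / (1 - t)))"

definition hyp_area :: "complex measure" where
  "hyp_area = density (restrict_space lebesgue unit_disc)
                (\<lambda>z. ennreal (4 / (1 - (cmod z)\<^sup>2)\<^sup>2))"

definition surf_dist :: "complex set \<Rightarrow> complex set \<Rightarrow> real" where
  "surf_dist p q = Inf {hyp_dist z w | z w. z \<in> p \<and> w \<in> q}"

text \<open>Boundary and closure of \<open>D\<^sub>0\<close> are taken relative to the disc.\<close>

definition fundamental_set :: "(complex \<Rightarrow> complex) set \<Rightarrow> complex set \<Rightarrow> bool" where
  "fundamental_set G F \<longleftrightarrow>
     F \<subseteq> unit_disc \<and> (\<forall>p\<in>surf G. \<exists>!z. z \<in> p \<and> z \<in> F) \<and>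
     (\<exists>D\<^sub>0. D\<^sub>0 \<noteq> {} \<and> open D\<^sub>0 \<and> connected D\<^sub>0 \<and> D\<^sub>0 \<subseteq> F \<and> F \<subseteq> closure D\<^sub>0 \<and>
           emeasure hyp_area (frontier D\<^sub>0 \<inter> unit_disc) = 0)"

definition surf_measure ::
    "(complex \<Rightarrow> complex) set \<Rightarrow> complex set \<Rightarrow> complex set measure" where
  "surf_measure G F =
     measure_of (surf G) {E. E \<subseteq> surf G \<and> preim G E \<in> sets hyp_area}
       (\<lambda>E. emeasure hyp_area (preim G E \<inter> F))"

lemma space_hyp_area: "space hyp_area = unit_disc"
  by (simp add: hyp_area_def space_restrict_space)

lemma sets_hyp_area: "A \<in> sets hyp_area \<longleftrightarrow> A \<subseteq> unit_disc \<and> A \<in> sets lebesgue"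
  by (simp add: hyp_area_def sets_restrict_space_iff)

lemma null_sets_hyp_area:
  assumes "A \<in> sets hyp_area"
  shows "emeasure hyp_area A = 0 \<longleftrightarrow> A \<in> null_sets lebesgue"
proof -
  let ?w = "\<lambda>z. ennreal (4 / (1 - (cmod z)\<^sup>2)\<^sup>2)"
  have A: "A \<subseteq> unit_disc" "A \<in> sets lebesgue"
    using assms sets_hyp_area by auto
  have w: "?w \<in> borel_measurable (restrict_space lebesgue unit_disc)"
    by (intro measurable_restrict_space1 measurable_completion) measurable
  have pos: "?w z > 0" if "z \<in> unit_disc" for z
  proof -
    have "(cmod z)\<^sup>2 < 1"
      using that by (simp add: abs_square_less_1)
    then show ?thesis
      by simp
  qed
  have "emeasure hyp_area A = 0 \<longleftrightarrow> A \<in> null_sets hyp_area"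
    using assms by auto
  also have "\<dots> \<longleftrightarrow> (AE z in restrict_space lebesgue unit_disc. z \<in> A \<longrightarrow> ?w z = 0)"
    using assms by (auto simp: hyp_area_def null_sets_density_iff[OF w])
  also have "\<dots> \<longleftrightarrow> (AE z in lebesgue. z \<in> unit_disc \<longrightarrow> z \<in> A \<longrightarrow> ?w z = 0)"
    by (subst AE_restrict_space_iff) auto
  also have "\<dots> \<longleftrightarrow> (AE z in lebesgue. z \<notin> A)"
    using A pos by (intro AE_cong) (metis less_irrefl subsetD)
  also have "\<dots> \<longleftrightarrow> A \<in> null_sets lebesgue"
    using A by (simp add: AE_iff_null_sets)
  finally show ?thesis .
qed

lemma sets_fundamental_set:
  assumes "fundamental_set G F"
  shows "F \<in> sets hyp_area"
proof -
  obtain D where D: "F \<subseteq> unit_disc" "open D" "D \<subseteq> F" "F \<subseteq> closure D"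
      "emeasure hyp_area (frontier D \<inter> unit_disc) = 0"
    using assms unfolding fundamental_set_def by auto
  have "frontier D \<inter> unit_disc \<in> sets hyp_area"
    by (auto simp: sets_hyp_area)
  then have "frontier D \<inter> unit_disc \<in> null_sets lebesgue"
    using null_sets_hyp_area D(5) by blast
  moreover have "F - D \<subseteq> frontier D \<inter> unit_disc"
    using D by (auto simp: frontier_def interior_open)
  ultimately have "F - D \<in> sets lebesgue"
    by (metis null_sets_completion_subset null_setsD2)
  moreover have "D \<in> sets lebesgue"
    using D(2) by auto
  ultimately have "D \<union> (F - D) \<in> sets lebesgue"
    by blast
  moreover have "D \<union> (F - D) = F"
    using D by auto
  ultimately show ?thesis
    using D(1) by (simp add: sets_hyp_area)
qed

lemma sigma_algebra_surf:
  "sigma_algebra (surf G) {E. E \<subseteq> surf G \<and> preim G E \<in> sets hyp_area}"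
  unfolding sigma_algebra_iff2
proof (intro conjI ballI allI impI)
  show "{} \<in> {E. E \<subseteq> surf G \<and> preim G E \<in> sets hyp_area}"
    by (simp add: preim_def)
next
  fix E assume "E \<in> {E. E \<subseteq> surf G \<and> preim G E \<in> sets hyp_area}"
  moreover have "preim G (surf G - E) = space hyp_area - preim G E"
    by (auto simp: preim_def surf_def space_hyp_area)
  ultimately show "surf G - E \<in> {E. E \<subseteq> surf G \<and> preim G E \<in> sets hyp_area}"
    by auto
next
  fix A :: "nat \<Rightarrow> complex set set"
  assume "range A \<subseteq> {E. E \<subseteq> surf G \<and> preim G E \<in> sets hyp_area}"
  then have A: "A i \<subseteq> surf G" "preim G (A i) \<in> sets hyp_area" for i
    by blast+
  have "preim G (\<Union>i. A i) = (\<Union>i. preim G (A i))"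
    by (auto simp: preim_def)
  moreover have "(\<Union>i. preim G (A i)) \<in> sets hyp_area"
    using A(2) by (intro sets.countable_UN) auto
  ultimately show "(\<Union>i. A i) \<in> {E. E \<subseteq> surf G \<and> preim G E \<in> sets hyp_area}"
    using A(1) by auto
qed blast

lemma space_surf_measure: "space (surf_measure G F) = surf G"
  by (auto simp: surf_measure_def intro!: space_measure_of)

lemma sets_surf_measure:
  "sets (surf_measure G F) = {E. E \<subseteq> surf G \<and> preim G E \<in> sets hyp_area}"
  unfolding surf_measure_def
  by (rule sigma_algebra.sets_measure_of_eq[OF sigma_algebra_surf])

lemma emeasure_surf_measure:
  assumes F: "fundamental_set G F" and E: "E \<in> sets (surf_measure G F)"
  shows "emeasure (surf_measure G F) E = emeasure hyp_area (preim G E \<inter> F)"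
proof (rule emeasure_measure_of[OF surf_measure_def])
  note [measurable] = sets_fundamental_set[OF F]
  show "countably_additive (sets (surf_measure G F)) (\<lambda>E. emeasure hyp_area (preim G E \<inter> F))"
  proof (rule countably_additiveI)
    fix A :: "nat \<Rightarrow> complex set set"
    assume A: "range A \<subseteq> sets (surf_measure G F)" "disjoint_family A"
    have "(\<Sum>i. emeasure hyp_area (preim G (A i) \<inter> F)) =
          emeasure hyp_area (\<Union>i. preim G (A i) \<inter> F)"
    proof (rule suminf_emeasure)
      show "range (\<lambda>i. preim G (A i) \<inter> F) \<subseteq> sets hyp_area"
        using A(1) sets_fundamental_set[OF F] by (auto simp: sets_surf_measure)
      show "disjoint_family (\<lambda>i. preim G (A i) \<inter> F)"
        using A(2) by (auto simp: disjoint_family_on_def preim_def)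
    qed
    also have "(\<Union>i. preim G (A i) \<inter> F) = preim G (\<Union>i. A i) \<inter> F"
      by (auto simp: preim_def)
    finally show "(\<Sum>i. emeasure hyp_area (preim G (A i) \<inter> F)) =
        emeasure hyp_area (preim G (\<Union> (range A)) \<inter> F)" .
  qed
qed (use E in \<open>auto simp: positive_def preim_def sets_surf_measure\<close>)


section \<open>Curves, length and line integrals\<close>

text \<open>A curve is a parameter interval together with a function; only the values of the function on
  the interval matter.\<close>

type_synonym curve = "real set \<times> (real \<Rightarrow> complex set)"

definition curve_interval :: "real set \<Rightarrow> bool" where
  "curve_interval \<Delta> \<longleftrightarrow>
     (\<exists>a b. a < b \<and> (\<Delta> = {a..b} \<or> \<Delta> = {a..<b} \<or> \<Delta> = {a<..b} \<or> \<Delta> = {a<..<b}))"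

definition curves_in :: "(complex \<Rightarrow> complex) set \<Rightarrow> complex set set \<Rightarrow> curve set" where
  "curves_in G D =
     {(\<Delta>, \<gamma>). curve_interval \<Delta> \<and> continuous_map (top_of_set \<Delta>) (surf_topology G) \<gamma> \<and>
             \<gamma> ` \<Delta> \<subseteq> D}"

definition arc_length :: "(real \<Rightarrow> complex set) \<Rightarrow> real \<Rightarrow> real \<Rightarrow> ennreal" where
  "arc_length \<gamma> a b =
     (SUP (n, t) \<in> {(n :: nat, t :: nat \<Rightarrow> real). mono t \<and> range t \<subseteq> {a..b}}.
        \<Sum>i<n. ennreal (surf_dist (\<gamma> (t i)) (\<gamma> (t (Suc i)))))"

definition locally_rectifiable :: "curve \<Rightarrow> bool" where
  "locally_rectifiable = (\<lambda>(\<Delta>, \<gamma>). \<forall>a b. a \<le> b \<and> {a..b} \<subseteq> \<Delta> \<longrightarrow> arc_length \<gamma> a b < \<infinity>)"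

text \<open>The base point \<open>t\<^sub>0\<close> is the left endpoint of the interval if that belongs to it, and otherwise a
  point depending on the interval only, hence the same for a curve and its image.\<close>

definition base_point :: "real set \<Rightarrow> real" where
  "base_point \<Delta> = (if Inf \<Delta> \<in> \<Delta> then Inf \<Delta> else (SOME t. t \<in> \<Delta>))"

definition length_fun :: "curve \<Rightarrow> real \<Rightarrow> real" where
  "length_fun = (\<lambda>(\<Delta>, \<gamma>) t.
     let t\<^sub>0 = base_point \<Delta> in
     if t\<^sub>0 \<le> t then enn2real (arc_length \<gamma> t\<^sub>0 t) else - enn2real (arc_length \<gamma> t t\<^sub>0))"

definition length_range :: "curve \<Rightarrow> real set" where
  "length_range c = length_fun c ` fst c"

text \<open>The arc length reparametrization; a locally rectifiable curve is constant on each fibre of its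
  length function, so the choice of \<open>t\<close> does not matter.\<close>

definition arc_param :: "curve \<Rightarrow> real \<Rightarrow> complex set" where
  "arc_param c s = snd c (SOME t. t \<in> fst c \<and> length_fun c t = s)"

definition line_integral :: "curve \<Rightarrow> (complex set \<Rightarrow> ennreal) \<Rightarrow> ennreal" where
  "line_integral c \<rho> = (\<integral>\<^sup>+ s \<in> length_range c. \<rho> (arc_param c s) \<partial>lborel)"


section \<open>Modulus of curve families\<close>

definition surf_borel :: "(complex \<Rightarrow> complex) set \<Rightarrow> complex set measure" where
  "surf_borel G = sigma (surf G) {U. openin (surf_topology G) U}"

definition adm ::
    "(complex \<Rightarrow> complex) set \<Rightarrow> curve set \<Rightarrow> (complex set \<Rightarrow> ennreal) set" where
  "adm G \<Gamma> = {\<rho> \<in> surf_borel G \<rightarrow>\<^sub>M borel.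
                \<forall>c\<in>\<Gamma>. locally_rectifiable c \<longrightarrow> 1 \<le> line_integral c \<rho>}"

definition modulus ::
    "(complex \<Rightarrow> complex) set \<Rightarrow> complex set \<Rightarrow> curve set \<Rightarrow> ennreal" where
  "modulus G F \<Gamma> = (INF \<rho>\<in>adm G \<Gamma>. \<integral>\<^sup>+ p. (\<rho> p)\<^sup>2 \<partial>surf_measure G F)"

definition almost_all_curves_in ::
    "(complex \<Rightarrow> complex) set \<Rightarrow> complex set \<Rightarrow> complex set set \<Rightarrow> (curve \<Rightarrow> bool) \<Rightarrow> bool" where
  "almost_all_curves_in G F D P \<longleftrightarrow> modulus G F {c \<in> curves_in G D. \<not> P c} = 0"

definition image_curve :: "(complex set \<Rightarrow> complex set) \<Rightarrow> curve \<Rightarrow> curve" where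
  "image_curve f = (\<lambda>(\<Delta>, \<gamma>). (\<Delta>, f \<circ> \<gamma>))"


section \<open>Differentiability and dilatation\<close>

text \<open>The local coordinates used are the local inverses of the natural projections: \<open>\<phi>\<close> expresses
  \<open>f\<close> in the coordinates given by the sheets \<open>U\<close> and \<open>V\<close>.\<close>

definition local_expression ::
    "(complex \<Rightarrow> complex) set \<Rightarrow> (complex \<Rightarrow> complex) set \<Rightarrow> (complex set \<Rightarrow> complex set) \<Rightarrow>
     complex set \<Rightarrow> complex set \<Rightarrow> (complex \<Rightarrow> complex) \<Rightarrow> bool" where
  "local_expression G H f U V \<phi> \<longleftrightarrow>
     open U \<and> U \<subseteq> unit_disc \<and> inj_on (orbit G) U \<and>
     open V \<and> V \<subseteq> unit_disc \<and> inj_on (orbit H) V \<and>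
     \<phi> ` U \<subseteq> V \<and> (\<forall>w\<in>U. orbit H (\<phi> w) = f (orbit G w))"

definition has_local_derivative ::
    "(complex \<Rightarrow> complex) set \<Rightarrow> (complex \<Rightarrow> complex) set \<Rightarrow> (complex set \<Rightarrow> complex set) \<Rightarrow>
     complex set \<Rightarrow> (complex \<Rightarrow> complex) \<Rightarrow> bool" where
  "has_local_derivative G H f p A \<longleftrightarrow>
     (\<exists>U V \<phi> z. local_expression G H f U V \<phi> \<and> z \<in> U \<and> orbit G z = p \<and>
                (\<phi> has_derivative A) (at z))"

definition surf_differentiable ::
    "(complex \<Rightarrow> complex) set \<Rightarrow> (complex \<Rightarrow> complex) set \<Rightarrow> (complex set \<Rightarrow> complex set) \<Rightarrow>
     complex set \<Rightarrow> bool" where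
  "surf_differentiable G H f p \<longleftrightarrow> (\<exists>A. has_local_derivative G H f p A)"

text \<open>For the real differential \<open>A\<close> the partial derivatives are \<open>f\<^sub>x = A 1\<close> and \<open>f\<^sub>y = A \<i>\<close>.\<close>

definition linear_dilatation :: "(complex \<Rightarrow> complex) \<Rightarrow> ennreal" where
  "linear_dilatation A =
     (let fz = (A 1 - \<i> * A \<i>) / 2; fzbar = (A 1 + \<i> * A \<i>) / 2 in
      if (cmod fz)\<^sup>2 - (cmod fzbar)\<^sup>2 \<noteq> 0
      then ennreal ((cmod fz + cmod fzbar) / \<bar>cmod fz - cmod fzbar\<bar>)
      else if cmod fz + cmod fzbar = 0 then 1 else \<infinity>)"

definition dilatation ::
    "(complex \<Rightarrow> complex) set \<Rightarrow> (complex \<Rightarrow> complex) set \<Rightarrow> (complex set \<Rightarrow> complex set) \<Rightarrow>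
     complex set \<Rightarrow> ennreal" where
  "dilatation G H f p =
     (if surf_differentiable G H f p
      then linear_dilatation (SOME A. has_local_derivative G H f p A) else \<infinity>)"


section \<open>The class ACP-inverse and the Luzin properties\<close>

definition abs_continuous_on_interval :: "(real \<Rightarrow> real) \<Rightarrow> real \<Rightarrow> real \<Rightarrow> bool" where
  "abs_continuous_on_interval \<phi> c d \<longleftrightarrow>
     (\<forall>\<epsilon>>0. \<exists>\<delta>>0. \<forall>(n :: nat) a b.
        (\<forall>i<n. c \<le> a i \<and> a i \<le> b i \<and> b i \<le> d) \<and>
        disjoint_family_on (\<lambda>i. {a i<..<b i}) {..<n} \<and>
        (\<Sum>i<n. b i - a i) < \<delta> \<longrightarrow>
        (\<Sum>i<n. \<bar>\<phi> (b i) - \<phi> (a i)\<bar>) < \<epsilon>)"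

definition L_fun :: "(complex set \<Rightarrow> complex set) \<Rightarrow> curve \<Rightarrow> real \<Rightarrow> real" where
  "L_fun f c s =
     (THE u. \<exists>t\<in>fst c. length_fun c t = s \<and> u = length_fun (image_curve f c) t)"

definition L_inv :: "(complex set \<Rightarrow> complex set) \<Rightarrow> curve \<Rightarrow> real \<Rightarrow> real" where
  "L_inv f c = inv_into (length_range c) (L_fun f c)"

definition is_lift ::
    "(complex \<Rightarrow> complex) set \<Rightarrow> complex set set \<Rightarrow> (complex set \<Rightarrow> complex set) \<Rightarrow>
     curve \<Rightarrow> curve \<Rightarrow> bool" where
  "is_lift G D f c c' \<longleftrightarrow>
     c \<in> curves_in G D \<and> fst c = fst c' \<and> (\<forall>t\<in>fst c. f (snd c t) = snd c' t)"

text \<open>The function \<open>L\<close> only makes sense for a locally rectifiable image curve \<open>c'\<close>. Restricting to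
  such \<open>c'\<close> changes nothing, because admissibility only tests locally rectifiable curves.\<close>

definition ACP_inv ::
    "(complex \<Rightarrow> complex) set \<Rightarrow> (complex \<Rightarrow> complex) set \<Rightarrow> complex set \<Rightarrow>
     complex set set \<Rightarrow> (complex set \<Rightarrow> complex set) \<Rightarrow> bool" where
  "ACP_inv G H F\<^sub>H D f \<longleftrightarrow>
     (\<forall>(\<Delta>, \<gamma>) \<in> curves_in G D. f \<circ> \<gamma> constant_on \<Delta> \<longrightarrow> \<gamma> constant_on \<Delta>) \<and>
     almost_all_curves_in H F\<^sub>H (f ` D)
       (\<lambda>c'. locally_rectifiable c' \<longrightarrow>
          (\<forall>c. is_lift G D f c c' \<longrightarrow>
             locally_rectifiable c \<and>
             (\<forall>u v. u \<le> v \<and> {u..v} \<subseteq> length_range c' \<longrightarrow>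
                abs_continuous_on_interval (L_inv f c) u v)))"

definition luzin_N ::
    "complex set measure \<Rightarrow> complex set measure \<Rightarrow> complex set set \<Rightarrow>
     (complex set \<Rightarrow> complex set) \<Rightarrow> bool" where
  "luzin_N M M' D f \<longleftrightarrow> (\<forall>E. E \<subseteq> D \<and> E \<in> null_sets M \<longrightarrow> f ` E \<in> null_sets M')"

definition luzin_N_inv ::
    "complex set measure \<Rightarrow> complex set measure \<Rightarrow> complex set set \<Rightarrow> complex set set \<Rightarrow>
     (complex set \<Rightarrow> complex set) \<Rightarrow> bool" where
  "luzin_N_inv M M' D D' f \<longleftrightarrow>
     (\<forall>E. E \<subseteq> D' \<and> E \<in> null_sets M' \<longrightarrow> {p \<in> D. f p \<in> E} \<in> null_sets M)"

end

theory Submission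
  imports Defs "HOL-Complex_Analysis.Riemann_Mapping"
begin

text \<open>By Sard's theorem for equal dimensions and the \<open>N\<^sup>-\<^sup>1\<close>-property, \<open>f\<close> has a nonzero Jacobian almost
  everywhere. Cut the set of these points into countably many compact pieces on which \<open>f\<close> is
  injective and its minimal stretch \<open>l\<close>, its Jacobian and its dilatation \<open>K\<close> are nearly constant, and
  let \<open>\<rho>'\<close> be the supremum of the functions \<open>\<rho> / l\<close> pushed forward from the pieces, set to \<open>\<infinity>\<close> on the
  image of the rest, which is null by the \<open>N\<close>-property. Since \<open>J / l\<^sup>2 = K\<close>, the energy of \<open>\<rho>'\<close> is at most
  a factor close to 1 times the integral of \<open>K \<rho>\<^sup>2\<close>. For almost every image curve \<open>f \<circ> \<gamma>\<close> the
  arc length of \<open>\<gamma>\<close> is an absolutely continuous function of the arc length of \<open>f \<circ> \<gamma>\<close>, so \<open>\<gamma>\<close> spends no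
  length outside the pieces; on a piece its length is at most \<open>1 / l\<close> times that of the image. Hence
  the line integral of \<open>\<rho>'\<close> along \<open>f \<circ> \<gamma>\<close> dominates that of \<open>\<rho>\<close> along \<open>\<gamma>\<close>.\<close>

subsection \<open>The hyperbolic metric of the disc\<close>

text \<open>Two obstacles shape the proof. First, f need not be injective and its derivative exists
  only pointwise almost everywhere, so neither an area formula nor a chain rule along curves is at
  hand; inequalities replace both. In the plane, the area of an image is bounded by means of the
  Jacobian, which needs only pointwise differentiability. Along curves, differentiability at p
  enters only as a lower bound r d(p,q) <= d(f p, f q) for q near p, and inscribed polygons turn
  this into the bound on lengths. Second, images of different pieces may overlap. A supremum is
  compatible with this: its square is at most the sum of the squares, so the energies of the pieces
  add up, whereas the square of a sum would not split. All computations take place in open parts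
  \<open>D0\<close> and \<open>E0\<close> of the two fundamental sets, which carry the full measure;
  the \<open>N\<close>-inverse property also disposes of the points that f sends outside the chart
  \<open>E0\<close>.\<close>

definition pseudo_dist :: "complex \<Rightarrow> complex \<Rightarrow> real" where
  "pseudo_dist z w = cmod (z - w) / cmod (1 - z * cnj w)"

definition double_artanh :: "real \<Rightarrow> real" where
  "double_artanh t = ln ((1 + t) / (1 - t))"

text \<open>The Schwarz-Pick inequality concerns the pseudohyperbolic distance
  \<open>pseudo_dist\<close>. The hyperbolic distance is an increasing function of it, so
  inequalities carry over.\<close>

lemma hyp_dist_eq: "hyp_dist z w = double_artanh (pseudo_dist z w)"
  by (simp add: hyp_dist_def pseudo_dist_def double_artanh_def Let_def)

lemma norm_Moebius_function: "cmod (Moebius_function 0 w z) = pseudo_dist z w"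
  by (simp add: Moebius_function_simple pseudo_dist_def norm_divide mult.commute)

lemma pseudo_dist_nonneg: "0 \<le> pseudo_dist z w"
  by (simp add: pseudo_dist_def)

lemma pseudo_dist_less_1: "cmod z < 1 \<Longrightarrow> cmod w < 1 \<Longrightarrow> pseudo_dist z w < 1"
  using Moebius_function_norm_lt_1[of w z 0] by (simp add: norm_Moebius_function)

lemma one_minus_mult_cnj_nonzero:
  assumes "cmod z < 1" "cmod w < 1"
  shows "1 - z * cnj w \<noteq> 0"
proof
  assume "1 - z * cnj w = 0"
  then have "cmod z * cmod w = 1"
    by (metis complex_mod_cnj norm_mult norm_one right_minus_eq)
  moreover have "cmod z * cmod w < 1"
    using assms by (metis mult_less_cancel_right1 mult_strict_mono' norm_ge_zero mult.left_neutral)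
  ultimately show False by simp
qed

lemma pseudo_dist_sym: "pseudo_dist z w = pseudo_dist w z"
proof -
  have "cmod (1 - z * cnj w) = cmod (cnj (1 - z * cnj w))"
    by (simp only: complex_mod_cnj)
  then show ?thesis
    by (simp add: pseudo_dist_def norm_minus_commute mult.commute)
qed

lemma pseudo_dist_eq_0_iff:
  "cmod z < 1 \<Longrightarrow> cmod w < 1 \<Longrightarrow> pseudo_dist z w = 0 \<longleftrightarrow> z = w"
  using one_minus_mult_cnj_nonzero by (auto simp: pseudo_dist_def)

text \<open>Disc automorphisms that move w and \<open>g w\<close> to 0 turn g into a map fixing 0,
  to which the Schwarz lemma applies.\<close>

lemma Schwarz_Pick:
  assumes hol: "g holomorphic_on ball 0 1" and g: "g \<in> ball 0 1 \<rightarrow> ball 0 1"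
    and z: "cmod z < 1" and w: "cmod w < 1"
  shows "pseudo_dist (g z) (g w) \<le> pseudo_dist z w"
proof -
  have gw: "cmod (g w) < 1"
    using g w by fastforce
  define f where "f = Moebius_function 0 (g w) \<circ> g \<circ> Moebius_function 0 (- w)"
  define \<zeta> where "\<zeta> = Moebius_function 0 w z"
  have ball: "Moebius_function 0 (- w) ` ball 0 1 \<subseteq> ball 0 1"
    using Moebius_function_norm_lt_1 w by auto
  have "f holomorphic_on ball 0 1"
    unfolding f_def
    by (intro holomorphic_on_compose Moebius_function_holomorphic
        holomorphic_on_subset[OF hol ball] holomorphic_on_subset[OF Moebius_function_holomorphic[OF gw]])
       (use ball g w in \<open>auto simp: image_subset_iff Pi_iff\<close>)
  moreover have "f 0 = 0"
    by (simp add: f_def Moebius_function_of_zero Moebius_function_eq_zero)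
  moreover have "cmod (f x) < 1" if "cmod x < 1" for x
    unfolding f_def comp_def
    by (intro Moebius_function_norm_lt_1 gw) (use ball g that in \<open>auto simp: image_subset_iff Pi_iff\<close>)
  moreover have "cmod \<zeta> < 1"
    unfolding \<zeta>_def using w z by (rule Moebius_function_norm_lt_1)
  ultimately have "cmod (f \<zeta>) \<le> cmod \<zeta>"
    by (rule Schwarz_Lemma(1))
  moreover have "Moebius_function 0 (- w) \<zeta> = z"
    unfolding \<zeta>_def by (rule Moebius_function_compose) (use w z in auto)
  ultimately show ?thesis
    by (simp add: f_def \<zeta>_def norm_Moebius_function)
qed

text \<open>For fixed moduli of z and w, an upper bound for the denominator becomes an upper bound
  for the distance; this is how \<open>hyp_dist_triangle\<close> uses it.\<close>

lemma pseudo_dist_square: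
  assumes "cmod z < 1" "cmod w < 1"
  shows "1 - (pseudo_dist z w)\<^sup>2 = (1 - (cmod z)\<^sup>2) * (1 - (cmod w)\<^sup>2) / (cmod (1 - z * cnj w))\<^sup>2"
proof -
  have nz: "cmod (1 - z * cnj w) \<noteq> 0"
    using one_minus_mult_cnj_nonzero[OF assms] by simp
  have "(cmod (1 - z * cnj w))\<^sup>2 - (cmod (z - w))\<^sup>2 = (1 - (cmod z)\<^sup>2) * (1 - (cmod w)\<^sup>2)"
    unfolding cmod_power2 by (simp add: algebra_simps power2_eq_square)
  then show ?thesis
    using nz by (simp add: pseudo_dist_def power_divide field_simps)
qed

lemma double_artanh_mono:
  assumes "0 \<le> s" "s \<le> t" "t < 1"
  shows "double_artanh s \<le> double_artanh t"
proof -
  have "(1 + s) / (1 - s) \<le> (1 + t) / (1 - t)"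
    using assms by (intro frac_le) auto
  moreover have "0 < (1 + s) / (1 - s)"
    using assms by auto
  ultimately show ?thesis
    unfolding double_artanh_def using ln_le_cancel_iff by fastforce
qed

text \<open>From ln x >= 1 - 1/x at x = (1 + t)/(1 - t), where the right-hand side is 2t/(1 +
  t).\<close>

lemma double_artanh_ge:
  assumes "0 \<le> t" "t < 1"
  shows "t \<le> double_artanh t"
proof -
  have "t \<le> 1 - inverse ((1 + t) / (1 - t))"
  proof -
    have "t * (1 + t) \<le> 2 * t"
      using assms by (simp add: mult_left_le algebra_simps power2_eq_square[symmetric])
        (metis assms(2) less_eq_real_def mult_left_le power2_eq_square)
    then show ?thesis
      using assms by (simp add: field_simps)
  qed
  also have "\<dots> \<le> ln ((1 + t) / (1 - t))"
  proof -
    have "0 < inverse ((1 + t) / (1 - t))" using assms by auto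
    from ln_le_minus_one[OF this] show ?thesis
      using assms by (simp add: ln_inverse ln_div)
  qed
  finally show ?thesis by (simp add: double_artanh_def)
qed

lemma double_artanh_0 [simp]: "double_artanh 0 = 0"
  by (simp add: double_artanh_def)

lemma hyp_dist_sym: "hyp_dist z w = hyp_dist w z"
  by (simp add: hyp_dist_eq pseudo_dist_sym)

lemma hyp_dist_refl [simp]: "hyp_dist z z = 0"
  by (simp add: hyp_dist_eq pseudo_dist_def)

lemma pseudo_dist_le_hyp_dist:
  "cmod z < 1 \<Longrightarrow> cmod w < 1 \<Longrightarrow> pseudo_dist z w \<le> hyp_dist z w"
  unfolding hyp_dist_eq using double_artanh_ge pseudo_dist_less_1 pseudo_dist_nonneg by blast

lemma hyp_dist_nonneg: "cmod z < 1 \<Longrightarrow> cmod w < 1 \<Longrightarrow> 0 \<le> hyp_dist z w"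
  using pseudo_dist_le_hyp_dist pseudo_dist_nonneg order_trans by blast

text \<open>The denominator of \<open>pseudo_dist\<close> is at most 2. Hyperbolic smallness thus
  forces Euclidean smallness, with a factor 2 that reappears as a halved radius in later
  proofs.\<close>

lemma norm_diff_le_hyp_dist:
  assumes "cmod z < 1" "cmod w < 1"
  shows "cmod (z - w) \<le> 2 * hyp_dist z w"
proof -
  have "cmod (1 - z * cnj w) \<le> 1 + cmod z * cmod w"
    by (metis complex_mod_cnj norm_mult norm_one norm_triangle_ineq4)
  also have "\<dots> \<le> 2"
    using assms mult_mono[of "cmod z" 1 "cmod w" 1] by auto
  finally have "cmod (z - w) / 2 \<le> pseudo_dist z w"
    unfolding pseudo_dist_def using one_minus_mult_cnj_nonzero[OF assms]
    by (intro divide_left_mono) auto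
  then show ?thesis
    using pseudo_dist_le_hyp_dist[OF assms] by auto
qed

lemma hyp_dist_holomorphic_le:
  assumes "g holomorphic_on ball 0 1" "g \<in> ball 0 1 \<rightarrow> ball 0 1" "cmod z < 1" "cmod w < 1"
  shows "hyp_dist (g z) (g w) \<le> hyp_dist z w"
  unfolding hyp_dist_eq using assms
  by (intro double_artanh_mono Schwarz_Pick pseudo_dist_less_1 pseudo_dist_nonneg) auto

text \<open>A disc automorphism moves w to 0 and z, u to points a, b of moduli r, s. The largest
  possible \<open>pseudo_dist a b\<close> is (r + s)/(1 + rs), attained on opposite rays, and there
  the addition formula of artanh gives equality.\<close>

lemma hyp_dist_triangle:
  assumes z: "cmod z < 1" and w: "cmod w < 1" and u: "cmod u < 1"
  shows "hyp_dist z u \<le> hyp_dist z w + hyp_dist w u"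
proof -
  define a where "a = Moebius_function 0 w z"
  define b where "b = Moebius_function 0 w u"
  have a: "cmod a < 1" and b: "cmod b < 1"
    unfolding a_def b_def using assms Moebius_function_norm_lt_1 by auto
  define r where "r = cmod a"
  define s where "s = cmod b"
  have r: "0 \<le> r" "r < 1" and s: "0 \<le> s" "s < 1"
    using a b by (auto simp: r_def s_def)
  have rs: "1 + r * s > 0" "(1 - r) * (1 - s) > 0"
    using r s by (auto intro: add_pos_nonneg)
  have "hyp_dist z u = hyp_dist (Moebius_function 0 (- w) a) (Moebius_function 0 (- w) b)"
    unfolding a_def b_def using assms by (simp add: Moebius_function_compose)
  also have "\<dots> \<le> hyp_dist a b"
    by (rule hyp_dist_holomorphic_le)
       (use a b w in \<open>auto intro!: Moebius_function_holomorphic Moebius_function_norm_lt_1\<close>)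
  also have "\<dots> \<le> double_artanh ((r + s) / (1 + r * s))"
  proof -
    have "(r + s) / (1 + r * s) < 1"
      using rs by (simp add: field_simps)
    moreover have "pseudo_dist a b \<le> (r + s) / (1 + r * s)"
    proof (rule power2_le_imp_le)
      have "cmod (1 - a * cnj b) \<le> 1 + r * s"
        unfolding r_def s_def by (metis complex_mod_cnj norm_mult norm_one norm_triangle_ineq4)
      then have "(1 - r\<^sup>2) * (1 - s\<^sup>2) / (1 + r * s)\<^sup>2 \<le> 1 - (pseudo_dist a b)\<^sup>2"
        unfolding pseudo_dist_square[OF a b] r_def[symmetric] s_def[symmetric]
        using r s rs one_minus_mult_cnj_nonzero[OF a b]
        by (intro divide_left_mono power_mono mult_nonneg_nonneg) (auto simp: power_le_one intro!: mult_pos_pos zero_less_power)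
      moreover have "(1 - r\<^sup>2) * (1 - s\<^sup>2) / (1 + r * s)\<^sup>2 = 1 - ((r + s) / (1 + r * s))\<^sup>2"
        using rs by (simp add: power_divide divide_simps) (simp add: power2_eq_square algebra_simps)
      ultimately show "(pseudo_dist a b)\<^sup>2 \<le> ((r + s) / (1 + r * s))\<^sup>2"
        by linarith
    qed (use r s rs in auto)
    ultimately show ?thesis
      unfolding hyp_dist_eq using pseudo_dist_nonneg double_artanh_mono by blast
  qed
  also have "\<dots> = double_artanh r + double_artanh s"
  proof -
    have "(1 + (r + s) / (1 + r * s)) / (1 - (r + s) / (1 + r * s))
        = ((1 + r) * (1 + s)) / ((1 - r) * (1 - s))"
    proof -
      have "1 + (r + s) / (1 + r * s) = (1 + r) * (1 + s) / (1 + r * s)"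
        using rs by (simp add: field_simps)
      moreover have "1 - (r + s) / (1 + r * s) = (1 - r) * (1 - s) / (1 + r * s)"
        using rs by (simp add: field_simps)
      ultimately show ?thesis
        using rs by simp
    qed
    then show ?thesis
      unfolding double_artanh_def using r s by (simp add: ln_mult ln_div)
  qed
  also have "\<dots> = hyp_dist z w + hyp_dist w u"
    by (simp add: r_def s_def a_def b_def norm_Moebius_function hyp_dist_eq pseudo_dist_sym)
  finally show ?thesis .
qed

lemma double_artanh_quotient: "((\<lambda>t. double_artanh t / t) \<longlongrightarrow> 2) (at 0)"
proof -
  have "(double_artanh has_real_derivative 2) (at 0)"
    unfolding double_artanh_def by (auto intro!: derivative_eq_intros)
  then show ?thesis
    by (simp add: DERIV_def)
qed

text \<open>The infinitesimal form 2|dz|/(1 - |z|^2) of the metric. It connects derivatives in the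
  plane with \<open>hyp_dist\<close>, and its square is the area density.\<close>

lemma hyp_dist_quotient:
  assumes z: "cmod z < 1"
  shows "((\<lambda>w. hyp_dist z w / cmod (z - w)) \<longlongrightarrow> 2 / (1 - (cmod z)\<^sup>2)) (at z)"
proof -
  have nz: "cmod (1 - z * cnj z) \<noteq> 0"
    using one_minus_mult_cnj_nonzero[OF z z] by simp
  have ev: "\<forall>\<^sub>F w in at z. cmod w < 1 \<and> w \<noteq> z"
  proof -
    have "\<forall>\<^sub>F w in at z. w \<in> ball 0 1"
      using z by (intro eventually_at_in_open') auto
    then show ?thesis
      using eventually_at_filter by (auto simp: eventually_conj_iff eventually_neq_at_within)
  qed
  have "((\<lambda>w. pseudo_dist z w) \<longlongrightarrow> cmod (z - z) / cmod (1 - z * cnj z)) (at z)"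
    unfolding pseudo_dist_def using nz by (intro tendsto_intros) auto
  then have "filterlim (pseudo_dist z) (at 0) (at z)"
    unfolding filterlim_at using ev by (auto elim!: eventually_mono simp: pseudo_dist_eq_0_iff z)
  then have "((\<lambda>w. double_artanh (pseudo_dist z w) / pseudo_dist z w) \<longlongrightarrow> 2) (at z)"
    by (rule filterlim_compose[OF double_artanh_quotient])
  moreover have "((\<lambda>w. 1 / cmod (1 - z * cnj w)) \<longlongrightarrow> 1 / cmod (1 - z * cnj z)) (at z)"
    using nz by (intro tendsto_intros) auto
  ultimately have "((\<lambda>w. double_artanh (pseudo_dist z w) / pseudo_dist z w * (1 / cmod (1 - z * cnj w)))
      \<longlongrightarrow> 2 * (1 / cmod (1 - z * cnj z))) (at z)"
    by (rule tendsto_mult)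
  moreover have "cmod (1 - z * cnj z) = 1 - (cmod z)\<^sup>2"
  proof -
    have "1 - z * cnj z = of_real (1 - (cmod z)\<^sup>2)"
      by (simp add: complex_norm_square[symmetric] flip: of_real_power)
    moreover have "(cmod z)\<^sup>2 \<le> 1"
      using z by (simp add: power_le_one)
    ultimately show ?thesis
      by (metis abs_of_nonneg diff_ge_0_iff_ge norm_of_real)
  qed
  ultimately have "((\<lambda>w. double_artanh (pseudo_dist z w) / pseudo_dist z w * (1 / cmod (1 - z * cnj w)))
      \<longlongrightarrow> 2 / (1 - (cmod z)\<^sup>2)) (at z)"
    by simp
  then show ?thesis
  proof (rule Lim_transform_eventually)
    show "\<forall>\<^sub>F w in at z. double_artanh (pseudo_dist z w) / pseudo_dist z w * (1 / cmod (1 - z * cnj w))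
        = hyp_dist z w / cmod (z - w)"
      using ev
    proof eventually_elim
      case (elim w)
      then have "cmod (1 - z * cnj w) \<noteq> 0"
        using one_minus_mult_cnj_nonzero[OF z] by simp
      with elim show ?case
        by (simp add: hyp_dist_eq pseudo_dist_def)
    qed
  qed
qed

lemma hyp_dist_tendsto_0:
  assumes z: "cmod z < 1"
  shows "((\<lambda>w. hyp_dist z w) \<longlongrightarrow> 0) (at z)"
proof -
  have "((\<lambda>w. hyp_dist z w / cmod (z - w) * cmod (z - w)) \<longlongrightarrow> 2 / (1 - (cmod z)\<^sup>2) * cmod (z - z)) (at z)"
    by (intro tendsto_mult hyp_dist_quotient z tendsto_intros)
  then have "((\<lambda>w. hyp_dist z w / cmod (z - w) * cmod (z - w)) \<longlongrightarrow> 0) (at z)"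
    by simp
  then show ?thesis
    by (rule Lim_transform_eventually) (auto simp: eventually_at_filter)
qed

lemma hyp_dist_small:
  assumes z: "cmod z < 1" and e: "e > 0"
  obtains r where "r > 0" "ball z r \<subseteq> unit_disc" "\<And>w. w \<in> ball z r \<Longrightarrow> hyp_dist z w < e"
proof -
  have "\<forall>\<^sub>F w in at z. hyp_dist z w < e"
    using order_tendstoD(2)[OF hyp_dist_tendsto_0[OF z] e] .
  then obtain r1 where r1: "r1 > 0" "\<And>w. w \<noteq> z \<Longrightarrow> dist w z < r1 \<Longrightarrow> hyp_dist z w < e"
    unfolding eventually_at by auto
  obtain r2 where r2: "r2 > 0" "ball z r2 \<subseteq> unit_disc"
    using z openE[of unit_disc z] by auto
  show ?thesis
  proof (rule that[of "min r1 r2"])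
    show "hyp_dist z w < e" if "w \<in> ball z (min r1 r2)" for w
      using that r1(2)[of w] e by (cases "w = z") (auto simp: dist_commute)
  qed (use r1 r2 in auto)
qed

subsection \<open>Deck groups and the surface metric\<close>

locale deck_group =
  fixes G :: "(complex \<Rightarrow> complex) set"
  assumes disc_group: "disc_group G"
begin

lemma bij: "g \<in> G \<Longrightarrow> bij_betw g unit_disc unit_disc"
proof -
  have "G \<subseteq> Bij unit_disc"
    using disc_group subgroup.subset[of G "BijGroup unit_disc"] by (auto simp: disc_group_def BijGroup_def)
  then show "g \<in> G \<Longrightarrow> bij_betw g unit_disc unit_disc"
    by (auto simp: Bij_def)
qed

lemma in_disc: "g \<in> G \<Longrightarrow> cmod z < 1 \<Longrightarrow> cmod (g z) < 1"
  using bij[of g] by (auto simp: bij_betw_def)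

lemma id_mem: "restrict (\<lambda>z. z) unit_disc \<in> G"
  using disc_group subgroup.one_closed[of G "BijGroup unit_disc"]
  by (auto simp: disc_group_def BijGroup_def)

lemma comp_mem:
  assumes "g \<in> G" "h \<in> G"
  shows "\<exists>k\<in>G. \<forall>z\<in>unit_disc. k z = g (h z)"
proof -
  have "subgroup G (BijGroup unit_disc)" and sub: "G \<subseteq> Bij unit_disc"
    using disc_group subgroup.subset[of G "BijGroup unit_disc"] by (auto simp: disc_group_def BijGroup_def)
  then have "g \<otimes>\<^bsub>BijGroup unit_disc\<^esub> h \<in> G"
    using assms by (auto intro: subgroup.m_closed)
  then have "compose unit_disc g h \<in> G"
    using assms[THEN subsetD[OF sub]] by (simp add: BijGroup_def)
  then show ?thesis
    by (intro bexI[of _ "compose unit_disc g h"]) (auto simp: compose_def)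
qed

lemma inv_mem:
  assumes "g \<in> G"
  shows "\<exists>h\<in>G. \<forall>z. cmod z < 1 \<longrightarrow> h (g z) = z \<and> g (h z) = z"
proof -
  have sg: "subgroup G (BijGroup unit_disc)" and sub: "G \<subseteq> Bij unit_disc"
    using disc_group subgroup.subset[of G "BijGroup unit_disc"] by (auto simp: disc_group_def BijGroup_def)
  interpret group "BijGroup unit_disc" by (rule group_BijGroup)
  define h where "h = inv\<^bsub>BijGroup unit_disc\<^esub> g"
  have h: "h \<in> G"
    unfolding h_def using sg assms by (rule subgroup.m_inv_closed)
  have gc: "g \<in> carrier (BijGroup unit_disc)"
    using sub assms by (auto simp: BijGroup_def)
  have "compose unit_disc h g = restrict (\<lambda>z. z) unit_disc"
    using l_inv[OF gc] subsetD[OF sub h] subsetD[OF sub assms]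
    unfolding h_def[symmetric] by (simp add: BijGroup_def)
  moreover have "compose unit_disc g h = restrict (\<lambda>z. z) unit_disc"
    using r_inv[OF gc] subsetD[OF sub h] subsetD[OF sub assms]
    unfolding h_def[symmetric] by (simp add: BijGroup_def)
  ultimately show ?thesis
    using h by (intro bexI[of _ h]) (metis compose_eq mem_ball_0 restrict_apply')
qed

text \<open>A pole in the disc has to be excluded, since division by zero yields the harmless value
  0 there. As g maps into the disc, |aw + b| <= |cw + d| near a pole; in the limit the numerator
  vanishes too, against ad - bc \<noteq> 0.\<close>

lemma holomorphic:
  assumes g: "g \<in> G"
  shows "g holomorphic_on unit_disc"
proof -
  obtain a b c d where abcd: "a * d - b * c \<noteq> 0" and geq: "g = restrict (moebius a b c d) unit_disc"
    using disc_group g unfolding disc_group_def by blast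
  have ge: "g z = (a * z + b) / (c * z + d)" if "cmod z < 1" for z
    using that by (simp add: geq moebius_def)
  have nz: "c * z + d \<noteq> 0" if z: "cmod z < 1" for z
  proof
    assume 0: "c * z + d = 0"
    have c: "c \<noteq> 0"
      using 0 abcd by auto
    have "\<forall>\<^sub>F w in at z. w \<in> ball 0 1"
      using z by (intro eventually_at_in_open') auto
    moreover have "\<forall>\<^sub>F w in at z. w \<noteq> z"
      by (auto simp: eventually_at_filter)
    ultimately have "\<forall>\<^sub>F w in at z. cmod (a * w + b) \<le> cmod (c * w + d)"
    proof eventually_elim
      case (elim w)
      have cw: "c * w + d \<noteq> 0"
        using elim(2) 0 c by (metis add_right_cancel mult_cancel_left)
      have "cmod (g w) < 1"
        using in_disc[OF g] elim by auto
      then show ?case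
        using cw elim by (simp add: ge norm_divide)
    qed
    moreover have "((\<lambda>w. cmod (a * w + b)) \<longlongrightarrow> cmod (a * z + b)) (at z)"
      "((\<lambda>w. cmod (c * w + d)) \<longlongrightarrow> cmod (c * z + d)) (at z)"
      by (intro tendsto_intros)+
    ultimately have "cmod (a * z + b) \<le> cmod (c * z + d)"
      by (intro tendsto_le[of "at z"]) auto
    then have "a * z + b = 0"
      using 0 by simp
    then have "b = - a * z" "d = - c * z"
      using 0 by (auto simp: eq_neg_iff_add_eq_0 add.commute)
    then show False
      using abcd by (simp add: algebra_simps)
  qed
  have "(\<lambda>z. (a * z + b) / (c * z + d)) holomorphic_on unit_disc"
    using nz by (intro holomorphic_intros) auto
  then show ?thesis
    by (rule holomorphic_transform) (simp add: ge)
qed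

lemma has_nonzero_derivative:
  assumes g: "g \<in> G" and z: "cmod z < 1"
  obtains a where "a \<noteq> 0" "(g has_field_derivative a) (at z)"
proof (rule that)
  show "deriv g z \<noteq> 0"
    using holomorphic_injective_imp_regular[OF holomorphic[OF g] open_ball] bij[OF g] z
    by (auto simp: bij_betw_def)
  show "(g has_field_derivative deriv g z) (at z)"
    using holomorphic_derivI[OF holomorphic[OF g] open_ball] z by auto
qed

text \<open>Holomorphic self-maps of the disc do not increase the distance, and this applies to g
  and to its inverse.\<close>

lemma hyp_dist_invariant:
  assumes g: "g \<in> G" and z: "cmod z < 1" and w: "cmod w < 1"
  shows "hyp_dist (g z) (g w) = hyp_dist z w"
proof (rule antisym)
  have le: "hyp_dist (k x) (k y) \<le> hyp_dist x y" if "k \<in> G" "cmod x < 1" "cmod y < 1" for k x y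
    using that by (intro hyp_dist_holomorphic_le holomorphic) (auto intro: in_disc)
  show "hyp_dist (g z) (g w) \<le> hyp_dist z w"
    using le g z w by auto
  obtain h where h: "h \<in> G" "\<And>z. cmod z < 1 \<Longrightarrow> h (g z) = z" "\<And>z. cmod z < 1 \<Longrightarrow> g (h z) = z"
    using inv_mem[OF g] by blast
  show "hyp_dist z w \<le> hyp_dist (g z) (g w)"
    using le[OF h(1) in_disc[OF g z] in_disc[OF g w]] h(2)[OF z] h(2)[OF w] by simp
qed

lemma orbit_self: "cmod z < 1 \<Longrightarrow> z \<in> orbit G z"
  unfolding orbit_def using id_mem by (auto intro!: image_eqI[of _ _ "restrict (\<lambda>z. z) unit_disc"])

lemma orbit_subset: "cmod z < 1 \<Longrightarrow> w \<in> orbit G z \<Longrightarrow> cmod w < 1"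
  by (auto simp: orbit_def in_disc)

lemma orbit_eq:
  assumes z: "cmod z < 1" and w: "w \<in> orbit G z"
  shows "orbit G w = orbit G z"
proof -
  have *: "orbit G (g z) \<subseteq> orbit G z" if g: "g \<in> G" and z: "cmod z < 1" for g z
    unfolding orbit_def
  proof clarify
    fix k assume "k \<in> G"
    with g z show "k (g z) \<in> (\<lambda>g. g z) ` G"
      using comp_mem[of k g] by (auto simp: image_iff) (metis mem_ball_0)
  qed
  obtain g where g: "g \<in> G" "w = g z"
    using w by (auto simp: orbit_def)
  obtain h where h: "h \<in> G" "\<And>z. cmod z < 1 \<Longrightarrow> h (g z) = z" "\<And>z. cmod z < 1 \<Longrightarrow> g (h z) = z"
    using inv_mem[OF g(1)] by blast
  show ?thesis
    using *[OF g(1) z] *[OF h(1) in_disc[OF g(1) z]] h(2)[OF z] g by simp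
qed

lemma orbit_eq_iff:
  "cmod z < 1 \<Longrightarrow> cmod w < 1 \<Longrightarrow> orbit G w = orbit G z \<longleftrightarrow> (\<exists>g\<in>G. w = g z)"
proof
  assume "cmod z < 1" "cmod w < 1" "orbit G w = orbit G z"
  then show "\<exists>g\<in>G. w = g z"
    using orbit_self[of w] by (auto simp: orbit_def)
next
  assume "cmod z < 1" "cmod w < 1" "\<exists>g\<in>G. w = g z"
  then show "orbit G w = orbit G z"
    by (intro orbit_eq) (auto simp: orbit_def)
qed

lemma surfE:
  assumes "p \<in> surf G" obtains z where "cmod z < 1" "p = orbit G z"
  using assms by (auto simp: surf_def)

lemma orbit_in_surf: "cmod z < 1 \<Longrightarrow> orbit G z \<in> surf G"
  by (auto simp: surf_def)

lemma surf_element: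
  assumes "p \<in> surf G" "z \<in> p"
  shows "cmod z < 1" "p = orbit G z"
proof -
  obtain w where w: "cmod w < 1" "p = orbit G w"
    using surfE[OF assms(1)] .
  then show "cmod z < 1" "p = orbit G z"
    using orbit_subset[of w z] orbit_eq[of w z] assms(2) by simp_all
qed

text \<open>By discontinuity only finitely many elements g have g(U) meeting U. Those that fix z are
  the identity; each of the others moves z by a positive amount, which a small enough ball cannot
  bridge.\<close>

lemma orbit_local_inj:
  assumes z: "cmod z < 1"
  obtains r where "r > 0" "\<And>w w'. \<lbrakk>cmod w < 1; cmod w' < 1; hyp_dist z w < r; hyp_dist z w' < r;
    orbit G w = orbit G w'\<rbrakk> \<Longrightarrow> w = w'"
proof -
  obtain U where U: "open U" "z \<in> U" "U \<subseteq> unit_disc" and fin: "finite {g \<in> G. g ` U \<inter> U \<noteq> {}}"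
  proof -
    have "\<forall>z\<in>unit_disc. \<exists>U. open U \<and> z \<in> U \<and> U \<subseteq> unit_disc \<and> finite {g \<in> G. g ` U \<inter> U \<noteq> {}}"
      using disc_group by (simp add: disc_group_def)
    then have "\<exists>U. open U \<and> z \<in> U \<and> U \<subseteq> unit_disc \<and> finite {g \<in> G. g ` U \<inter> U \<noteq> {}}"
      by (rule bspec) (use z in auto)
    then show ?thesis
      using that by blast
  qed
  define A where "A = {g \<in> G. g ` U \<inter> U \<noteq> {} \<and> g z \<noteq> z}"
  have "finite A"
    using fin by (rule finite_subset[rotated]) (auto simp: A_def)
  have "\<forall>\<^sub>F w in nhds z. \<forall>g\<in>A. 0 < cmod (g z - z) / 3 \<and> dist (g w) (g z) < cmod (g z - z) / 3
      \<and> dist w z < cmod (g z - z) / 3"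
  proof (rule eventually_ball_finite[OF \<open>finite A\<close>], rule ballI)
    fix g assume g: "g \<in> A"
    then have e: "0 < cmod (g z - z) / 3"
      by (auto simp: A_def)
    have "isCont g z"
      using holomorphic[of g] g z by (auto simp: A_def intro!: continuous_on_interior holomorphic_on_imp_continuous_on)
    then have "filterlim g (nhds (g z)) (nhds z)"
      by (simp add: isCont_def tendsto_at_iff_tendsto_nhds)
    then have "\<forall>\<^sub>F w in nhds z. dist (g w) (g z) < cmod (g z - z) / 3"
      using e by (rule tendstoD)
    moreover have "\<forall>\<^sub>F w in nhds z. dist w z < cmod (g z - z) / 3"
      unfolding eventually_nhds_metric using e by blast
    ultimately show "\<forall>\<^sub>F w in nhds z. 0 < cmod (g z - z) / 3 \<and> dist (g w) (g z) < cmod (g z - z) / 3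
        \<and> dist w z < cmod (g z - z) / 3"
      by eventually_elim (use e in auto)
  qed
  moreover have "\<forall>\<^sub>F w in nhds z. w \<in> U"
    using U by (intro eventually_nhds_in_open)
  ultimately have "\<forall>\<^sub>F w in nhds z. w \<in> U \<and> (\<forall>g\<in>A. 0 < cmod (g z - z) / 3 \<and>
      dist (g w) (g z) < cmod (g z - z) / 3 \<and> dist w z < cmod (g z - z) / 3)"
    by eventually_elim auto
  then obtain e where e: "e > 0" and eU: "\<And>w. dist w z < e \<Longrightarrow> w \<in> U"
    and eA: "\<And>w g. dist w z < e \<Longrightarrow> g \<in> A \<Longrightarrow> 0 < cmod (g z - z) / 3 \<and>
      dist (g w) (g z) < cmod (g z - z) / 3 \<and> dist w z < cmod (g z - z) / 3"
    unfolding eventually_nhds_metric by metis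
  show ?thesis
  \<comment> \<open>Half the Euclidean radius e, because of the factor 2 in
    \<open>norm_diff_le_hyp_dist\<close>.\<close>
  proof (rule that[of "e/2"])
    fix w w' assume w: "cmod w < 1" "hyp_dist z w < e/2" and w': "cmod w' < 1" "hyp_dist z w' < e/2"
      and eq: "orbit G w = orbit G w'"
    have d: "dist w z < e" "dist w' z < e"
      using norm_diff_le_hyp_dist[OF z w(1)] norm_diff_le_hyp_dist[OF z w'(1)] w w'
      by (auto simp: dist_norm norm_minus_commute)
    obtain g where g: "g \<in> G" "w = g w'"
      using eq orbit_eq_iff w w' by blast
    show "w = w'"
    proof (cases "g z = z")
      case True
      then have "\<forall>z\<in>unit_disc. g z = z"
        using disc_group g(1) z by (auto simp: disc_group_def)
      then show ?thesis
        using g w' by auto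
    next
      case False
      then have "g \<in> A"
        using g eU[OF d(1)] eU[OF d(2)] by (auto simp: A_def)
      from eA[OF d(2) this] eA[OF d(1) this] g have "dist w (g z) < cmod (g z - z) / 3" "dist w z < cmod (g z - z) / 3"
        "0 < cmod (g z - z)"
        by auto
      then show ?thesis
        using dist_triangle2[of "g z" z w] by (auto simp: dist_norm norm_minus_commute[of "g z" z] norm_minus_commute[of "g z" w] norm_minus_commute[of z w])
          (use norm_ge_zero[of "z - g z"] in linarith)
    qed
  qed (use e in auto)
qed

lemma hyp_dists_bdd_below:
  assumes "p \<in> surf G" "q \<in> surf G"
  shows "bdd_below {hyp_dist z w | z w. z \<in> p \<and> w \<in> q}"
proof (rule bdd_belowI[of _ 0])
  fix x assume "x \<in> {hyp_dist z w | z w. z \<in> p \<and> w \<in> q}"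
  then obtain z w where "x = hyp_dist z w" "z \<in> p" "w \<in> q" by auto
  then show "0 \<le> x"
    using surf_element(1)[OF assms(1)] surf_element(1)[OF assms(2)] by (simp add: hyp_dist_nonneg)
qed

lemma surf_dist_le:
  assumes "p \<in> surf G" "q \<in> surf G" "z \<in> p" "w \<in> q"
  shows "surf_dist p q \<le> hyp_dist z w"
proof -
  have "hyp_dist z w \<in> {hyp_dist z w | z w. z \<in> p \<and> w \<in> q}"
    using assms(3,4) by blast
  then show ?thesis
    unfolding surf_dist_def by (rule cInf_lower[OF _ hyp_dists_bdd_below[OF assms(1,2)]])
qed

lemma surf_dist_orbit_le:
  assumes "cmod z < 1" "cmod w < 1"
  shows "surf_dist (orbit G z) (orbit G w) \<le> hyp_dist z w"
  by (rule surf_dist_le[OF orbit_in_surf[OF assms(1)] orbit_in_surf[OF assms(2)]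
        orbit_self[OF assms(1)] orbit_self[OF assms(2)]])

lemma surf_nonempty:
  assumes "p \<in> surf G" shows "p \<noteq> {}"
proof -
  obtain z where "cmod z < 1" "p = orbit G z"
    using surfE[OF assms] .
  then show ?thesis
    using orbit_self[of z] by auto
qed

lemma hyp_dists_nonempty:
  assumes "p \<in> surf G" "q \<in> surf G"
  shows "{hyp_dist z w | z w. z \<in> p \<and> w \<in> q} \<noteq> {}"
proof -
  obtain z w where "z \<in> p" "w \<in> q"
    using surf_nonempty[OF assms(1)] surf_nonempty[OF assms(2)] by auto
  then have "hyp_dist z w \<in> {hyp_dist z w | z w. z \<in> p \<and> w \<in> q}" by auto
  then show ?thesis by (metis empty_iff)
qed

text \<open>The infimum runs over both orbits, but a group element carries the first point to the
  given z without changing the distance. Keeping the representative of p fixed allows distances to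
  be chained.\<close>

lemma surf_dist_lessE:
  assumes p: "p \<in> surf G" and q: "q \<in> surf G" and z: "z \<in> p" and less: "surf_dist p q < r"
  obtains w where "w \<in> q" "hyp_dist z w < r"
proof -
  obtain x where "x \<in> {hyp_dist z w | z w. z \<in> p \<and> w \<in> q}" "x < r"
    using cInf_lessD[OF hyp_dists_nonempty[OF p q] less[unfolded surf_dist_def]] by (metis (lifting))
  then obtain z' w' where zw: "z' \<in> p" "w' \<in> q" "hyp_dist z' w' < r"
    by auto
  have disc: "cmod z < 1" "cmod z' < 1" "cmod w' < 1"
    using surf_element p q z zw by auto
  obtain g where g: "g \<in> G" "z = g z'"
    using orbit_eq_iff[OF disc(2,1)] surf_element(2)[OF p] z zw by metis
  have "g w' \<in> q"
    using surf_element(2)[OF q zw(2)] g by (auto simp: orbit_def)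
  moreover have "hyp_dist z (g w') < r"
    using g hyp_dist_invariant[OF g(1) disc(2,3)] zw by simp
  ultimately show ?thesis
    by (rule that)
qed

lemma surf_dist_nonneg:
  assumes "p \<in> surf G" "q \<in> surf G"
  shows "0 \<le> surf_dist p q"
  unfolding surf_dist_def
proof (rule cInf_greatest)
  show "{hyp_dist z w |z w. z \<in> p \<and> w \<in> q} \<noteq> {}"
    by (rule hyp_dists_nonempty[OF assms])
next
  fix x assume "x \<in> {hyp_dist z w | z w. z \<in> p \<and> w \<in> q}"
  then obtain z w where "x = hyp_dist z w" "z \<in> p" "w \<in> q" by auto
  then show "0 \<le> x"
    using surf_element(1)[OF assms(1)] surf_element(1)[OF assms(2)] by (simp add: hyp_dist_nonneg)
qed

lemma surf_dist_sym: "surf_dist p q = surf_dist q p"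
proof -
  have "{hyp_dist z w |z w. z \<in> p \<and> w \<in> q} = {hyp_dist z w |z w. z \<in> q \<and> w \<in> p}"
    using hyp_dist_sym by blast
  then show ?thesis
    by (simp add: surf_dist_def)
qed

lemma surf_dist_refl:
  assumes "p \<in> surf G" shows "surf_dist p p = 0"
proof -
  obtain z where "cmod z < 1" "p = orbit G z"
    using surfE[OF assms] .
  then show ?thesis
    using surf_dist_orbit_le[of z z] surf_dist_nonneg[OF assms assms] by auto
qed

lemma surf_dist_triangle:
  assumes p: "p \<in> surf G" and q: "q \<in> surf G" and u: "u \<in> surf G"
  shows "surf_dist p u \<le> surf_dist p q + surf_dist q u"
proof (rule field_le_epsilon)
  fix e :: real assume "e > 0"
  obtain z where z: "cmod z < 1" "p = orbit G z"
    using surfE[OF p] .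
  obtain w where w: "w \<in> q" "hyp_dist z w < surf_dist p q + e/2"
    using surf_dist_lessE[OF p q, of z "surf_dist p q + e/2"] z \<open>e > 0\<close> orbit_self by auto
  obtain v where v: "v \<in> u" "hyp_dist w v < surf_dist q u + e/2"
    using surf_dist_lessE[OF q u w(1), of "surf_dist q u + e/2"] \<open>e > 0\<close> by auto
  have "surf_dist p u \<le> hyp_dist z v"
    using surf_dist_le[OF p u _ v(1)] z orbit_self by auto
  also have "\<dots> \<le> hyp_dist z w + hyp_dist w v"
    using z surf_element[OF q w(1)] surf_element[OF u v(1)] by (intro hyp_dist_triangle) auto
  finally show "surf_dist p u \<le> surf_dist p q + surf_dist q u + e"
    using w v by linarith
qed

text \<open>A point of the orbit of w nearer to z than w itself would lie in the ball on which the
  projection is injective, so it would be w.\<close>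

lemma surf_dist_eq_hyp_dist:
  assumes z: "cmod z < 1"
  obtains r where "r > 0" "\<And>w. cmod w < 1 \<Longrightarrow> hyp_dist z w < r \<Longrightarrow> surf_dist (orbit G z) (orbit G w) = hyp_dist z w"
proof -
  obtain r where r: "r > 0" "\<And>w w'. \<lbrakk>cmod w < 1; cmod w' < 1; hyp_dist z w < r; hyp_dist z w' < r;
    orbit G w = orbit G w'\<rbrakk> \<Longrightarrow> w = w'"
    using orbit_local_inj[OF z] by blast
  show ?thesis
  proof (rule that[OF r(1)])
    fix w assume w: "cmod w < 1" "hyp_dist z w < r"
    show "surf_dist (orbit G z) (orbit G w) = hyp_dist z w"
    proof (rule antisym[OF surf_dist_orbit_le[OF z w(1)]], rule ccontr)
      assume "\<not> hyp_dist z w \<le> surf_dist (orbit G z) (orbit G w)"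
      then obtain v where v: "v \<in> orbit G w" "hyp_dist z v < hyp_dist z w"
        using surf_dist_lessE[OF orbit_in_surf[OF z] orbit_in_surf[OF w(1)] orbit_self[OF z], of "hyp_dist z w"]
        by auto
      then have "v = w"
        using r(2)[OF orbit_subset[OF w(1) v(1)] w(1) _ w(2) orbit_eq[OF w(1) v(1)]] v(2) w(2) by linarith
      with v show False by simp
    qed
  qed
qed

lemma surf_dist_eq_0:
  assumes p: "p \<in> surf G" and q: "q \<in> surf G" and "surf_dist p q = 0"
  shows "p = q"
proof -
  obtain z where z: "cmod z < 1" "p = orbit G z"
    using surfE[OF p] .
  obtain r where r: "r > 0" "\<And>w. cmod w < 1 \<Longrightarrow> hyp_dist z w < r \<Longrightarrow> surf_dist (orbit G z) (orbit G w) = hyp_dist z w"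
    using surf_dist_eq_hyp_dist[OF z(1)] by blast
  obtain w where w: "w \<in> q" "hyp_dist z w < r"
    using surf_dist_lessE[OF p q, of z r] z r(1) assms(3) orbit_self by auto
  have "q = orbit G w" "cmod w < 1"
    using surf_element[OF q w(1)] by auto
  with r(2)[of w] w z assms(3) have "hyp_dist z w = 0"
    by auto
  then have "z = w"
    using pseudo_dist_le_hyp_dist[of z w] pseudo_dist_nonneg[of z w] pseudo_dist_eq_0_iff[of z w]
      z \<open>cmod w < 1\<close> by auto
  then show ?thesis
    using z \<open>q = orbit G w\<close> by simp
qed

lemma preim_image_orbit:
  assumes "U \<subseteq> unit_disc"
  shows "preim G (orbit G ` U) = (\<Union>g\<in>G. g ` U)"
proof (intro subset_antisym subsetI)
  fix z assume "z \<in> preim G (orbit G ` U)"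
  then obtain u where u: "cmod z < 1" "u \<in> U" "orbit G z = orbit G u"
    by (auto simp: preim_def)
  moreover have "cmod u < 1"
    using assms u(2) by auto
  ultimately show "z \<in> (\<Union>g\<in>G. g ` U)"
    using orbit_eq_iff[of u z] by auto
next
  fix z assume "z \<in> (\<Union>g\<in>G. g ` U)"
  then obtain g u where g: "g \<in> G" "u \<in> U" "z = g u" by auto
  then have "cmod u < 1" "cmod z < 1"
    using assms in_disc by auto
  then show "z \<in> preim G (orbit G ` U)"
    using g orbit_eq_iff[of u z] by (auto simp: preim_def)
qed

lemma open_image:
  assumes g: "g \<in> G" and U: "open U" "U \<subseteq> unit_disc"
  shows "open (g ` U)"
proof -
  have "inj_on g U"
    using bij[OF g] U by (auto simp: bij_betw_def intro: inj_on_subset)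
  then show ?thesis
    using open_mapping_thm3[OF holomorphic_on_subset[OF holomorphic[OF g] U(2)] U(1)] by blast
qed

lemma openin_orbit_image:
  assumes U: "open U" "U \<subseteq> unit_disc"
  shows "openin (surf_topology G) (orbit G ` U)"
  unfolding openin_surf_topology preim_image_orbit[OF U(2)]
  using U open_image by (auto simp: surf_def)

text \<open>Together with \<open>surf_dist_nbhd\<close> this identifies the quotient topology with
  the topology of \<open>surf_dist\<close>.\<close>

lemma openin_surf_distE:
  assumes U: "openin (surf_topology G) U" and p: "p \<in> U"
  obtains r where "r > 0" "\<And>q. q \<in> surf G \<Longrightarrow> surf_dist p q < r \<Longrightarrow> q \<in> U"
proof -
  have "p \<in> surf G"
    using U p by (auto simp: openin_surf_topology)
  then obtain z where z: "cmod z < 1" "p = orbit G z"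
    using surfE by blast
  have "open (preim G U)" "z \<in> preim G U"
    using U z p by (auto simp: openin_surf_topology preim_def)
  then obtain r where r: "r > 0" "ball z r \<subseteq> preim G U"
    using openE by blast
  show ?thesis
  proof (rule that[of "r/2"])
    fix q assume q: "q \<in> surf G" and "surf_dist p q < r/2"
    then obtain w where w: "w \<in> q" "hyp_dist z w < r/2"
      using surf_dist_lessE[OF \<open>p \<in> surf G\<close> q, of z "r/2"] z orbit_self by auto
    then have "cmod w < 1" "q = orbit G w"
      using surf_element[OF q] by auto
    then have "w \<in> ball z r"
      using norm_diff_le_hyp_dist[OF z(1), of w] w by (auto simp: dist_norm)
    then show "q \<in> U"
      using r \<open>q = orbit G w\<close> by (auto simp: preim_def)
  qed (use r in auto)
qed

lemma surf_dist_nbhd: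
  assumes p: "p \<in> surf G" and "e > 0"
  obtains U where "openin (surf_topology G) U" "p \<in> U" "\<And>q. q \<in> U \<Longrightarrow> surf_dist p q < e"
proof -
  obtain z where z: "cmod z < 1" "p = orbit G z"
    using surfE[OF p] .
  obtain r where r: "r > 0" "ball z r \<subseteq> unit_disc" "\<And>w. w \<in> ball z r \<Longrightarrow> hyp_dist z w < e"
    using hyp_dist_small[OF z(1) \<open>e > 0\<close>] by blast
  show ?thesis
  proof (rule that[of "orbit G ` ball z r"])
    show "openin (surf_topology G) (orbit G ` ball z r)"
      using r by (intro openin_orbit_image) auto
    show "p \<in> orbit G ` ball z r"
      using z r by auto
    show "surf_dist p q < e" if q: "q \<in> orbit G ` ball z r" for q
    proof -
      obtain w where w: "w \<in> ball z r" "q = orbit G w"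
        using q by auto
      with r have "cmod w < 1" by auto
      then show ?thesis
        using surf_dist_orbit_le[OF z(1), of w] r(3)[OF w(1)] w z by auto
    qed
  qed
qed

lemma continuous_map_surf_dist:
  assumes cont: "continuous_map (top_of_set S) (surf_topology G) \<gamma>" and t: "t \<in> S" and "e > 0"
  shows "\<exists>d>0. \<forall>u\<in>S. dist u t < d \<longrightarrow> surf_dist (\<gamma> t) (\<gamma> u) < e"
proof -
  have "\<gamma> t \<in> surf G"
    using cont t by (auto simp: continuous_map_def topspace_surf_topology)
  then obtain U where U: "openin (surf_topology G) U" "\<gamma> t \<in> U" "\<And>q. q \<in> U \<Longrightarrow> surf_dist (\<gamma> t) q < e"
    using surf_dist_nbhd \<open>e > 0\<close> by metis
  have "openin (top_of_set S) {u \<in> S. \<gamma> u \<in> U}"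
    using cont U(1) by (auto simp: continuous_map_def)
  then obtain d where "d > 0" "\<And>u. u \<in> S \<Longrightarrow> dist u t < d \<Longrightarrow> \<gamma> u \<in> U"
    unfolding openin_euclidean_subtopology_iff using t U(2) by blast
  then show ?thesis
    using U(3) by blast
qed

lemma continuous_map_surfI:
  fixes \<gamma> :: "'a::metric_space \<Rightarrow> complex set"
  assumes "\<gamma> ` S \<subseteq> surf G" and "\<And>t e. t \<in> S \<Longrightarrow> e > 0 \<Longrightarrow> \<exists>d>0. \<forall>u\<in>S. dist u t < d \<longrightarrow> surf_dist (\<gamma> t) (\<gamma> u) < e"
  shows "continuous_map (top_of_set S) (surf_topology G) \<gamma>"
  unfolding continuous_map_def
proof (intro conjI allI impI)
  show "\<gamma> \<in> topspace (top_of_set S) \<rightarrow> topspace (surf_topology G)"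
    using assms by (auto simp: topspace_surf_topology)
  fix U assume U: "openin (surf_topology G) U"
  show "openin (top_of_set S) {x \<in> topspace (top_of_set S). \<gamma> x \<in> U}"
    unfolding openin_euclidean_subtopology_iff
  proof (intro conjI ballI)
    fix t assume "t \<in> {x \<in> topspace (top_of_set S). \<gamma> x \<in> U}"
    then have t: "t \<in> S" "\<gamma> t \<in> U" by auto
    obtain r where r: "r > 0" "\<And>q. q \<in> surf G \<Longrightarrow> surf_dist (\<gamma> t) q < r \<Longrightarrow> q \<in> U"
      using openin_surf_distE[OF U t(2)] by blast
    show "\<exists>e>0. \<forall>x'\<in>S. dist x' t < e \<longrightarrow> x' \<in> {x \<in> topspace (top_of_set S). \<gamma> x \<in> U}"
      using assms(2)[OF t(1) r(1)] r(2) assms(1) by force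
  qed auto
qed

end

subsection \<open>Arc length\<close>

definition chord_sum :: "(real \<Rightarrow> complex set) \<Rightarrow> nat \<Rightarrow> (nat \<Rightarrow> real) \<Rightarrow> real" where
  "chord_sum \<gamma> n t = (\<Sum>i<n. surf_dist (\<gamma> (t i)) (\<gamma> (t (Suc i))))"

context deck_group
begin

lemma chord_sum_nonneg:
  assumes "\<And>i. i \<le> n \<Longrightarrow> \<gamma> (t i) \<in> surf G"
  shows "0 \<le> chord_sum \<gamma> n t"
  unfolding chord_sum_def using assms by (intro sum_nonneg surf_dist_nonneg) auto

lemma arc_length_eq:
  assumes "\<gamma> ` {a..b} \<subseteq> surf G"
  shows "arc_length \<gamma> a b =
    (SUP (n, t) \<in> {(n, t). mono t \<and> range t \<subseteq> {a..b}}. ennreal (chord_sum \<gamma> n t))"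
proof -
  have "(\<Sum>i<n. ennreal (surf_dist (\<gamma> (t i)) (\<gamma> (t (Suc i))))) = ennreal (chord_sum \<gamma> n t)"
    if t: "range t \<subseteq> {a..b}" for n t
    unfolding chord_sum_def
  proof (intro sum_ennreal surf_dist_nonneg)
    have "\<gamma> (t i) \<in> surf G" for i
      using t assms by auto
    then show "\<gamma> (t i) \<in> surf G" "\<gamma> (t (Suc i)) \<in> surf G" for i by auto
  qed
  then show ?thesis
    unfolding arc_length_def by (intro SUP_cong) auto
qed

lemma chord_sum_le_arc_length:
  assumes "\<gamma> ` {a..b} \<subseteq> surf G" "mono t" "range t \<subseteq> {a..b}"
  shows "ennreal (chord_sum \<gamma> n t) \<le> arc_length \<gamma> a b"
  unfolding arc_length_eq[OF assms(1)]
  by (rule SUP_upper2[of "(n, t)"]) (use assms in auto)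

lemma arc_length_leI:
  assumes "\<gamma> ` {a..b} \<subseteq> surf G"
    and "\<And>n t. mono t \<Longrightarrow> range t \<subseteq> {a..b} \<Longrightarrow> ennreal (chord_sum \<gamma> n t) \<le> x"
  shows "arc_length \<gamma> a b \<le> x"
  unfolding arc_length_eq[OF assms(1)] by (rule SUP_least) (use assms(2) in auto)

lemma surf_dist_le_arc_length:
  assumes "\<gamma> ` {a..b} \<subseteq> surf G" "a \<le> b"
  shows "ennreal (surf_dist (\<gamma> a) (\<gamma> b)) \<le> arc_length \<gamma> a b"
proof -
  define t where "t = (\<lambda>i::nat. if i = 0 then a else b)"
  have "ennreal (chord_sum \<gamma> 1 t) \<le> arc_length \<gamma> a b"
    using assms by (intro chord_sum_le_arc_length) (auto simp: t_def mono_def)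
  then show ?thesis
    by (simp add: chord_sum_def t_def)
qed

lemma arc_length_mono:
  assumes "a' \<le> a" "b \<le> b'"
  shows "arc_length \<gamma> a b \<le> arc_length \<gamma> a' b'"
  unfolding arc_length_def proof (rule SUP_subset_mono)
  show "{(n, t). mono t \<and> range t \<subseteq> {a..b}} \<subseteq> {(n, t). mono t \<and> range t \<subseteq> {a'..b'}}"
    using assms by (auto simp: image_subset_iff intro: order_trans)
qed simp

text \<open>The concatenated polygon has one further chord, from \<open>t n\<close> to
  \<open>u 0\<close>, which can only add to the sum.\<close>

lemma chord_sum_append:
  assumes surf: "\<gamma> ` {a..c} \<subseteq> surf G" and t: "mono t" "range t \<subseteq> {a..b}" and u: "mono u" "range u \<subseteq> {b..c}"
    and "a \<le> b" "b \<le> c"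
  shows "ennreal (chord_sum \<gamma> n t) + ennreal (chord_sum \<gamma> m u) \<le> arc_length \<gamma> a c"
proof -
  define v where "v = (\<lambda>i. if i \<le> n then t i else u (i - Suc n))"
  have tu: "t i \<le> b" "a \<le> t i" "b \<le> u i" "u i \<le> c" for i
    using t(2) u(2) by (auto simp: image_subset_iff)
  have tu': "a \<le> t i" "t i \<le> c" "a \<le> u i" "u i \<le> c" for i
    using tu[of i] \<open>a \<le> b\<close> \<open>b \<le> c\<close> by linarith+
  have v: "mono v" "range v \<subseteq> {a..c}"
  proof -
    show "mono v"
      unfolding mono_def v_def using t(1) u(1) order_trans[OF tu(1) tu(3)] by (auto simp: mono_def)
    show "range v \<subseteq> {a..c}"
      using tu' by (auto simp: v_def)
  qed
  have sv: "\<gamma> (v i) \<in> surf G" for i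
    using v(2) surf by auto
  have nonneg: "0 \<le> chord_sum \<gamma> n t" "0 \<le> chord_sum \<gamma> m u"
    using tu' surf by (auto intro!: chord_sum_nonneg simp: image_subset_iff)
  have "chord_sum \<gamma> n t + chord_sum \<gamma> m u \<le> chord_sum \<gamma> (Suc n + m) v"
  proof -
    have "chord_sum \<gamma> (Suc n + m) v =
        (\<Sum>i<Suc n. surf_dist (\<gamma> (v i)) (\<gamma> (v (Suc i)))) + (\<Sum>i<m. surf_dist (\<gamma> (v (Suc n + i))) (\<gamma> (v (Suc (Suc n + i)))))"
      unfolding chord_sum_def by (induction m) (simp_all add: add.assoc)
    also have "(\<Sum>i<m. surf_dist (\<gamma> (v (Suc n + i))) (\<gamma> (v (Suc (Suc n + i))))) = chord_sum \<gamma> m u"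
      by (simp add: chord_sum_def v_def)
    also have "(\<Sum>i<Suc n. surf_dist (\<gamma> (v i)) (\<gamma> (v (Suc i)))) = chord_sum \<gamma> n t + surf_dist (\<gamma> (v n)) (\<gamma> (v (Suc n)))"
      by (simp add: chord_sum_def v_def)
    finally show ?thesis
      using surf_dist_nonneg[OF sv[of n] sv[of "Suc n"]] by linarith
  qed
  then have "ennreal (chord_sum \<gamma> n t) + ennreal (chord_sum \<gamma> m u) \<le> ennreal (chord_sum \<gamma> (Suc n + m) v)"
    using nonneg by (simp add: ennreal_leI flip: ennreal_plus)
  also have "\<dots> \<le> arc_length \<gamma> a c"
    by (rule chord_sum_le_arc_length[OF surf v])
  finally show ?thesis .
qed

text \<open>Truncating all vertices of a polygon with \<open>min\<close> and \<open>max\<close> at b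
  cuts it at b while keeping the index range and monotonicity. This spares the search for the chord
  that crosses b.\<close>

lemma surf_dist_split:
  fixes \<gamma> :: "real \<Rightarrow> complex set"
  assumes surf: "\<gamma> ` {a..c} \<subseteq> surf G" and "b \<in> {a..c}" "x \<in> {a..c}" "y \<in> {a..c}" "x \<le> y"
  shows "surf_dist (\<gamma> x) (\<gamma> y) \<le> surf_dist (\<gamma> (min x b)) (\<gamma> (min y b)) + surf_dist (\<gamma> (max x b)) (\<gamma> (max y b))"
proof -
  have s: "\<gamma> x \<in> surf G" "\<gamma> y \<in> surf G" "\<gamma> b \<in> surf G"
    using assms by auto
  consider "y \<le> b" | "b \<le> x" | "x < b" "b < y" by fastforce
  then show ?thesis
  proof cases
    case 1
    with \<open>x \<le> y\<close> have "min x b = x" "min y b = y" "max x b = b" "max y b = b" by auto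
    then show ?thesis by (simp add: surf_dist_refl s)
  next
    case 2
    with \<open>x \<le> y\<close> have "min x b = b" "min y b = b" "max x b = x" "max y b = y" by auto
    then show ?thesis by (simp add: surf_dist_refl s)
  next
    case 3
    then have "min x b = x" "min y b = b" "max x b = b" "max y b = y" by auto
    then show ?thesis
      using surf_dist_triangle[OF s(1,3,2)] by simp
  qed
qed

lemma chord_sum_split:
  assumes surf: "\<gamma> ` {a..c} \<subseteq> surf G" and "b \<in> {a..c}" and t: "mono t" "range t \<subseteq> {a..c}"
  shows "chord_sum \<gamma> n t \<le> chord_sum \<gamma> n (\<lambda>i. min (t i) b) + chord_sum \<gamma> n (\<lambda>i. max (t i) b)"
  unfolding chord_sum_def sum.distrib[symmetric]
proof (rule sum_mono, rule surf_dist_split[OF surf \<open>b \<in> _\<close>])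
  fix i
  show "t i \<in> {a..c}" "t (Suc i) \<in> {a..c}" "t i \<le> t (Suc i)"
    using t by (auto simp: mono_def image_subset_iff)
qed

text \<open>Cutting polygons at b gives one inequality, gluing them at b the other.\<close>

lemma arc_length_add:
  assumes surf: "\<gamma> ` {a..c} \<subseteq> surf G" and ab: "a \<le> b" and bc: "b \<le> c"
  shows "arc_length \<gamma> a c = arc_length \<gamma> a b + arc_length \<gamma> b c"
proof (rule antisym)
  have surf': "\<gamma> ` {a..b} \<subseteq> surf G" "\<gamma> ` {b..c} \<subseteq> surf G"
    using surf ab bc by (auto simp: image_subset_iff)
  show "arc_length \<gamma> a c \<le> arc_length \<gamma> a b + arc_length \<gamma> b c"
  proof (rule arc_length_leI[OF surf])
    fix n and t :: "nat \<Rightarrow> real" assume t: "mono t" "range t \<subseteq> {a..c}"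
    have r: "range (\<lambda>i. min (t i) b) \<subseteq> {a..b}" "range (\<lambda>i. max (t i) b) \<subseteq> {b..c}"
      using t ab bc by auto
    have m: "mono (\<lambda>i. min (t i) b)" "mono (\<lambda>i. max (t i) b)"
      using t(1) by (auto simp: mono_def min.coboundedI1 max.coboundedI1 intro: min.mono max.mono)
    have "ennreal (chord_sum \<gamma> n t) \<le> ennreal (chord_sum \<gamma> n (\<lambda>i. min (t i) b) + chord_sum \<gamma> n (\<lambda>i. max (t i) b))"
      using ab bc by (intro ennreal_leI chord_sum_split[OF surf _ t]) auto
    also have "\<dots> = ennreal (chord_sum \<gamma> n (\<lambda>i. min (t i) b)) + ennreal (chord_sum \<gamma> n (\<lambda>i. max (t i) b))"
      by (rule ennreal_plus) (use r surf' in \<open>auto intro!: chord_sum_nonneg simp: image_subset_iff\<close>)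
    also have "\<dots> \<le> arc_length \<gamma> a b + arc_length \<gamma> b c"
      by (intro add_mono chord_sum_le_arc_length surf' m r)
    finally show "ennreal (chord_sum \<gamma> n t) \<le> arc_length \<gamma> a b + arc_length \<gamma> b c" .
  qed
  show "arc_length \<gamma> a b + arc_length \<gamma> b c \<le> arc_length \<gamma> a c"
  proof -
    define P where "P x y = {(n::nat, t::nat \<Rightarrow> real). mono t \<and> range t \<subseteq> {x..y}}" for x y
    have P: "P a b \<noteq> {}" "P b c \<noteq> {}"
      using ab bc by (auto simp: P_def mono_def intro!: exI[of _ "\<lambda>_. b"])
    have 1: "ennreal (chord_sum \<gamma> n t) + arc_length \<gamma> b c \<le> arc_length \<gamma> a c" if "mono t" "range t \<subseteq> {a..b}" for n t
    proof -
      have "ennreal (chord_sum \<gamma> n t) + arc_length \<gamma> b c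
          = (SUP (m, u) \<in> P b c. ennreal (chord_sum \<gamma> n t) + ennreal (chord_sum \<gamma> m u))"
        unfolding arc_length_eq[OF surf'(2)] P_def[symmetric]
        using ennreal_SUP_add_right[OF P(2), of "ennreal (chord_sum \<gamma> n t)" "\<lambda>(m, u). ennreal (chord_sum \<gamma> m u)"]
        by (simp add: case_prod_unfold)
      also have "\<dots> \<le> arc_length \<gamma> a c"
        by (rule SUP_least) (use chord_sum_append[OF surf that] ab bc in \<open>auto simp: P_def\<close>)
      finally show ?thesis .
    qed
    have "arc_length \<gamma> a b + arc_length \<gamma> b c = (SUP (n, t) \<in> P a b. ennreal (chord_sum \<gamma> n t) + arc_length \<gamma> b c)"
      unfolding arc_length_eq[OF surf'(1)] P_def[symmetric]
      using ennreal_SUP_add_left[OF P(1), of "\<lambda>(m, u). ennreal (chord_sum \<gamma> m u)" "arc_length \<gamma> b c"]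
      by (simp add: case_prod_unfold)
    also have "\<dots> \<le> arc_length \<gamma> a c"
      by (rule SUP_least) (use 1 in \<open>auto simp: P_def\<close>)
    finally show ?thesis .
  qed
qed

lemma chord_sum_approx:
  assumes surf: "\<gamma> ` {a..b} \<subseteq> surf G" and ab: "a \<le> b" and fin: "arc_length \<gamma> a b < \<infinity>" and "e > 0"
  obtains n t where "mono t" "range t \<subseteq> {a..b}" "t 0 = a" "t n = b"
    "enn2real (arc_length \<gamma> a b) - e < chord_sum \<gamma> n t"
proof -
  define V where "V = enn2real (arc_length \<gamma> a b)"
  have V: "arc_length \<gamma> a b = ennreal V" "V \<ge> 0"
    using fin by (auto simp: V_def ennreal_enn2real_if)
  have "\<exists>n t. mono t \<and> range t \<subseteq> {a..b} \<and> V - e < chord_sum \<gamma> n t"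
  proof (rule ccontr)
    assume "\<not> ?thesis"
    then have le: "\<And>n t. mono t \<Longrightarrow> range t \<subseteq> {a..b} \<Longrightarrow> chord_sum \<gamma> n t \<le> V - e"
      by (meson not_le)
    have "arc_length \<gamma> a b \<le> ennreal (V - e)"
      by (rule arc_length_leI[OF surf]) (use le in \<open>auto intro: ennreal_leI\<close>)
    moreover have "0 \<le> V - e"
      using le[of "\<lambda>_. a" 0] ab by (auto simp: mono_def chord_sum_def)
    ultimately show False
      using V \<open>e > 0\<close> by (simp add: ennreal_le_iff)
  qed
  then obtain n t where t: "mono t" "range t \<subseteq> {a..b}" "V - e < chord_sum \<gamma> n t"
    by blast
  \<comment> \<open>The endpoints a and b become the first and last vertices; the two extra chords
    are nonnegative, and the shift by one makes room for a.\<close>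
  define u where "u = (\<lambda>i. if i = 0 then a else if i \<le> Suc n then t (i - 1) else b)"
  have tab: "a \<le> t i" "t i \<le> b" for i
    using t(2) by (auto simp: image_subset_iff)
  have u: "mono u" "range u \<subseteq> {a..b}"
  proof -
    show "mono u"
      unfolding mono_def u_def using t(1) tab ab by (auto simp: mono_def)
    show "range u \<subseteq> {a..b}"
      using tab ab by (auto simp: u_def)
  qed
  have su: "\<gamma> (u i) \<in> surf G" for i
    using u(2) surf by auto
  have "chord_sum \<gamma> n t = (\<Sum>i<n. surf_dist (\<gamma> (u (Suc i))) (\<gamma> (u (Suc (Suc i)))))"
    unfolding chord_sum_def u_def by (intro sum.cong) auto
  also have "\<dots> \<le> chord_sum \<gamma> (Suc (Suc n)) u"
    unfolding chord_sum_def sum.lessThan_Suc_shift[of _ "Suc n"] sum.lessThan_Suc[of _ n]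
    using surf_dist_nonneg[OF su su] by simp
  finally have "V - e < chord_sum \<gamma> (Suc (Suc n)) u"
    using t(3) by simp
  then show ?thesis
    using that[of u "Suc (Suc n)"] u by (simp add: V_def) (simp add: u_def)
qed

text \<open>Take a polygon whose length is within e/2 of the full length. Cut at a point u beyond
  its last vertex before b, it leaves only the chord from u to b on the right, and that chord is
  below e/2 by continuity. So the arc from u to b has length below e.\<close>

lemma arc_length_small_left:
  assumes surf: "\<gamma> ` {a..b} \<subseteq> surf G" and ab: "a < b" and fin: "arc_length \<gamma> a b < \<infinity>" and "e > 0"
    and cont: "\<And>e. e > 0 \<Longrightarrow> \<exists>d>0. \<forall>u\<in>{a..b}. dist u b < d \<longrightarrow> surf_dist (\<gamma> b) (\<gamma> u) < e"
  obtains d where "d > 0" "\<And>u. u \<in> {a..b} \<Longrightarrow> b - u < d \<Longrightarrow> enn2real (arc_length \<gamma> u b) < e"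
proof -
  obtain n t where t: "mono t" "range t \<subseteq> {a..b}" "t 0 = a" "t n = b"
    "enn2real (arc_length \<gamma> a b) - e / 2 < chord_sum \<gamma> n t"
    using chord_sum_approx[OF surf less_imp_le[OF ab] fin half_gt_zero[OF \<open>e > 0\<close>]] by blast
  \<comment> \<open>\<open>t m\<close> is the last vertex different from b.\<close>
  obtain m where m: "m < n" "\<forall>i\<le>m. t i \<noteq> b" "t (Suc m) = b"
    using ex_least_nat_less[of "\<lambda>i. t i = b" n] t ab by auto
  have tm: "t m < b"
    using m(2) t(2) by (metis atLeastAtMost_iff le_refl order_le_less range_subsetD)
  obtain d where d: "d > 0" "\<forall>u\<in>{a..b}. dist u b < d \<longrightarrow> surf_dist (\<gamma> b) (\<gamma> u) < e/2"
    using cont[of "e/2"] \<open>e > 0\<close> by auto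
  show ?thesis
  proof (rule that[of "min d (b - t m)"])
    fix u assume u: "u \<in> {a..b}" "b - u < min d (b - t m)"
    have surf': "\<gamma> ` {a..u} \<subseteq> surf G"
      using u surf by (auto simp: image_subset_iff)
    have tle: "max (t i) u = u" if "i \<le> m" for i
      using monoD[OF t(1) that] u by auto
    have tge: "max (t i) u = b" if "i > m" for i
    proof -
      have "t i = b"
        using monoD[OF t(1), of "Suc m" i] that m(3) t(2) by (metis Suc_leI antisym atLeastAtMost_iff range_subsetD)
      then show ?thesis using u by auto
    qed
    have "chord_sum \<gamma> n t \<le> chord_sum \<gamma> n (\<lambda>i. min (t i) u) + chord_sum \<gamma> n (\<lambda>i. max (t i) u)"
      by (rule chord_sum_split[OF surf u(1) t(1,2)])
    moreover have "chord_sum \<gamma> n (\<lambda>i. max (t i) u) = surf_dist (\<gamma> u) (\<gamma> b)"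
    proof -
      have "chord_sum \<gamma> n (\<lambda>i. max (t i) u) = (\<Sum>i<n. if i = m then surf_dist (\<gamma> u) (\<gamma> b) else 0)"
        unfolding chord_sum_def
      proof (rule sum.cong[OF refl])
        fix i
        have "\<gamma> u \<in> surf G" "\<gamma> b \<in> surf G"
          using surf u by auto
        then show "surf_dist (\<gamma> (max (t i) u)) (\<gamma> (max (t (Suc i)) u)) = (if i = m then surf_dist (\<gamma> u) (\<gamma> b) else 0)"
          using tle[of i] tle[of "Suc i"] tge[of i] tge[of "Suc i"]
          by (cases i m rule: linorder_cases) (auto simp: surf_dist_refl)
      qed
      then show ?thesis using m(1) by simp
    qed
    moreover have "surf_dist (\<gamma> u) (\<gamma> b) < e/2"
      using d(2) u by (auto simp: dist_real_def surf_dist_sym)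
    moreover have "chord_sum \<gamma> n (\<lambda>i. min (t i) u) \<le> enn2real (arc_length \<gamma> a u)"
    proof -
      have "ennreal (chord_sum \<gamma> n (\<lambda>i. min (t i) u)) \<le> arc_length \<gamma> a u"
        using t u by (intro chord_sum_le_arc_length surf') (auto simp: mono_def min.coboundedI1 intro: min.mono)
      moreover have "arc_length \<gamma> a u < \<infinity>"
        using arc_length_mono[of a a u b \<gamma>] fin u by auto
      moreover have "0 \<le> chord_sum \<gamma> n (\<lambda>i. min (t i) u)"
        using surf' u t(2) by (intro chord_sum_nonneg) (auto simp: image_subset_iff)
      ultimately show ?thesis
        by (metis enn2real_ennreal enn2real_mono infinity_ennreal_def)
    qed
    moreover have "enn2real (arc_length \<gamma> a b) = enn2real (arc_length \<gamma> a u) + enn2real (arc_length \<gamma> u b)"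
    proof -
      have *: "arc_length \<gamma> a b = arc_length \<gamma> a u + arc_length \<gamma> u b"
        using u by (intro arc_length_add[OF surf]) auto
      then show ?thesis
        using fin by (auto simp: enn2real_plus)
    qed
    ultimately show "enn2real (arc_length \<gamma> u b) < e"
      using t(5) by linarith
  qed (use d tm in auto)
qed

text \<open>The mirror image of \<open>arc_length_small_left\<close>, with the first vertex after
  a.\<close>

lemma arc_length_small_right:
  assumes surf: "\<gamma> ` {a..b} \<subseteq> surf G" and ab: "a < b" and fin: "arc_length \<gamma> a b < \<infinity>" and "e > 0"
    and cont: "\<And>e. e > 0 \<Longrightarrow> \<exists>d>0. \<forall>u\<in>{a..b}. dist u a < d \<longrightarrow> surf_dist (\<gamma> a) (\<gamma> u) < e"
  obtains d where "d > 0" "\<And>u. u \<in> {a..b} \<Longrightarrow> u - a < d \<Longrightarrow> enn2real (arc_length \<gamma> a u) < e"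
proof -
  obtain n t where t: "mono t" "range t \<subseteq> {a..b}" "t 0 = a" "t n = b"
    "enn2real (arc_length \<gamma> a b) - e / 2 < chord_sum \<gamma> n t"
    using chord_sum_approx[OF surf less_imp_le[OF ab] fin half_gt_zero[OF \<open>e > 0\<close>]] by blast
  obtain m where m: "m < n" "\<forall>i\<le>m. \<not> a < t i" "a < t (Suc m)"
    using ex_least_nat_less[of "\<lambda>i. a < t i" n] t ab by auto
  obtain d where d: "d > 0" "\<forall>u\<in>{a..b}. dist u a < d \<longrightarrow> surf_dist (\<gamma> a) (\<gamma> u) < e/2"
    using cont[of "e/2"] \<open>e > 0\<close> by auto
  show ?thesis
  proof (rule that[of "min d (t (Suc m) - a)"])
    fix u assume u: "u \<in> {a..b}" "u - a < min d (t (Suc m) - a)"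
    have surf': "\<gamma> ` {u..b} \<subseteq> surf G"
      using u surf by (auto simp: image_subset_iff)
    have tge: "min (t i) u = u" if "i > m" for i
      using monoD[OF t(1), of "Suc m" i] that u by auto
    have tle: "min (t i) u = a" if "i \<le> m" for i
    proof -
      have "t i = a"
        using that m(2) t(2) by (metis antisym_conv2 atLeastAtMost_iff range_subsetD)
      then show ?thesis using u by auto
    qed
    have "chord_sum \<gamma> n t \<le> chord_sum \<gamma> n (\<lambda>i. min (t i) u) + chord_sum \<gamma> n (\<lambda>i. max (t i) u)"
      by (rule chord_sum_split[OF surf u(1) t(1,2)])
    moreover have "chord_sum \<gamma> n (\<lambda>i. min (t i) u) = surf_dist (\<gamma> a) (\<gamma> u)"
    proof -
      have "chord_sum \<gamma> n (\<lambda>i. min (t i) u) = (\<Sum>i<n. if i = m then surf_dist (\<gamma> a) (\<gamma> u) else 0)"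
        unfolding chord_sum_def
      proof (rule sum.cong[OF refl])
        fix i
        have "\<gamma> u \<in> surf G" "\<gamma> a \<in> surf G"
          using surf u by auto
        then show "surf_dist (\<gamma> (min (t i) u)) (\<gamma> (min (t (Suc i)) u)) = (if i = m then surf_dist (\<gamma> a) (\<gamma> u) else 0)"
          using tle[of i] tle[of "Suc i"] tge[of i] tge[of "Suc i"]
          by (cases i m rule: linorder_cases) (auto simp: surf_dist_refl)
      qed
      then show ?thesis using m(1) by simp
    qed
    moreover have "surf_dist (\<gamma> a) (\<gamma> u) < e/2"
      using d(2) u by (auto simp: dist_real_def)
    moreover have "chord_sum \<gamma> n (\<lambda>i. max (t i) u) \<le> enn2real (arc_length \<gamma> u b)"
    proof -
      have "ennreal (chord_sum \<gamma> n (\<lambda>i. max (t i) u)) \<le> arc_length \<gamma> u b"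
        using t u by (intro chord_sum_le_arc_length surf') (auto simp: mono_def max.coboundedI1 intro: max.mono)
      moreover have "arc_length \<gamma> u b < \<infinity>"
        using arc_length_mono[of a u b b \<gamma>] fin u by auto
      moreover have "0 \<le> chord_sum \<gamma> n (\<lambda>i. max (t i) u)"
        using surf' u t(2) by (intro chord_sum_nonneg) (auto simp: image_subset_iff)
      ultimately show ?thesis
        by (metis enn2real_ennreal enn2real_mono infinity_ennreal_def)
    qed
    moreover have "enn2real (arc_length \<gamma> a b) = enn2real (arc_length \<gamma> a u) + enn2real (arc_length \<gamma> u b)"
    proof -
      have *: "arc_length \<gamma> a b = arc_length \<gamma> a u + arc_length \<gamma> u b"
        using u by (intro arc_length_add[OF surf]) auto
      then show ?thesis
        using fin by (auto simp: enn2real_plus)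
    qed
    ultimately show "enn2real (arc_length \<gamma> a u) < e"
      using t(5) by linarith
  qed (use d m in auto)
qed

end

section \<open>Length function and arc length parametrization of a locally rectifiable curve\<close>

lemma curve_interval_nonempty: "curve_interval \<Delta> \<Longrightarrow> \<Delta> \<noteq> {}"
  by (auto simp: curve_interval_def)

lemma curve_interval_convex:
  assumes "curve_interval \<Delta>" "t \<in> \<Delta>" "u \<in> \<Delta>"
  shows "{t..u} \<subseteq> \<Delta>"
  using assms by (auto simp: curve_interval_def)

lemma base_point_mem: "curve_interval \<Delta> \<Longrightarrow> base_point \<Delta> \<in> \<Delta>"
  using curve_interval_nonempty[of \<Delta>] by (auto simp: base_point_def intro: someI)

locale rectifiable_curve = deck_group +
  fixes \<Delta> :: "real set" and \<gamma> :: "real \<Rightarrow> complex set"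
  assumes interval: "curve_interval \<Delta>"
    and cont: "continuous_map (top_of_set \<Delta>) (surf_topology G) \<gamma>"
    and rect: "locally_rectifiable (\<Delta>, \<gamma>)"
begin

abbreviation "len \<equiv> length_fun (\<Delta>, \<gamma>)"

lemma in_surf: "t \<in> \<Delta> \<Longrightarrow> \<gamma> t \<in> surf G"
  using cont by (auto simp: continuous_map_def topspace_surf_topology)

lemma segment:
  assumes "t \<in> \<Delta>" "u \<in> \<Delta>"
  shows "{t..u} \<subseteq> \<Delta>" "\<gamma> ` {t..u} \<subseteq> surf G"
  using curve_interval_convex[OF interval assms] in_surf by auto

lemma finite_length:
  assumes "t \<in> \<Delta>" "u \<in> \<Delta>"
  shows "arc_length \<gamma> t u < \<infinity>"
proof (cases "t \<le> u")
  case True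
  then show ?thesis
    using rect segment(1)[OF assms] by (auto simp: locally_rectifiable_def)
next
  case False
  then have empty: "{(n :: nat, \<sigma> :: nat \<Rightarrow> real). mono \<sigma> \<and> range \<sigma> \<subseteq> {t..u}} = {}"
    by auto
  then show ?thesis
    unfolding arc_length_def empty by (simp add: bot_ennreal)
qed

lemma enn2real_arc_length_add:
  assumes "t \<in> \<Delta>" "u \<in> \<Delta>" "v \<in> \<Delta>" "t \<le> u" "u \<le> v"
  shows "enn2real (arc_length \<gamma> t v) = enn2real (arc_length \<gamma> t u) + enn2real (arc_length \<gamma> u v)"
  using arc_length_add[OF segment(2)[OF assms(1,3)] assms(4,5)] finite_length[OF assms(1,2)]
    finite_length[OF assms(2,3)] by (simp add: enn2real_plus)

lemma len_diff:
  assumes "t \<in> \<Delta>" "u \<in> \<Delta>" "t \<le> u"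
  shows "len u - len t = enn2real (arc_length \<gamma> t u)"
proof -
  let ?b = "base_point \<Delta>"
  have b: "?b \<in> \<Delta>"
    by (rule base_point_mem[OF interval])
  consider "?b \<le> t" | "t < ?b" "?b \<le> u" | "u < ?b" by linarith
  then show ?thesis
  proof cases
    case 1
    then show ?thesis
      using enn2real_arc_length_add[OF b assms(1,2) 1 assms(3)] assms(3)
      by (simp add: length_fun_def)
  next
    case 2
    then show ?thesis
      using enn2real_arc_length_add[OF assms(1) b assms(2) less_imp_le[OF 2(1)] 2(2)]
      by (simp add: length_fun_def)
  next
    case 3
    then show ?thesis
      using enn2real_arc_length_add[OF assms(1,2) b assms(3) less_imp_le[OF 3]] assms(3)
      by (simp add: length_fun_def)
  qed
qed

lemma len_mono:
  assumes "t \<in> \<Delta>" "u \<in> \<Delta>" "t \<le> u" shows "len t \<le> len u"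
  using len_diff[OF assms] enn2real_nonneg[of "arc_length \<gamma> t u"] by linarith

lemma dist_le_len:
  assumes "t \<in> \<Delta>" "u \<in> \<Delta>"
  shows "surf_dist (\<gamma> t) (\<gamma> u) \<le> \<bar>len t - len u\<bar>"
proof -
  have *: "surf_dist (\<gamma> t) (\<gamma> u) \<le> len u - len t" if "t \<in> \<Delta>" "u \<in> \<Delta>" "t \<le> u" for t u
  proof -
    have "ennreal (surf_dist (\<gamma> t) (\<gamma> u)) \<le> arc_length \<gamma> t u"
      using surf_dist_le_arc_length[OF segment(2)[OF that(1,2)] that(3)] .
    then have "enn2real (ennreal (surf_dist (\<gamma> t) (\<gamma> u))) \<le> enn2real (arc_length \<gamma> t u)"
      using finite_length[OF that(1,2)] by (intro enn2real_mono) auto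
    then show ?thesis
      using surf_dist_nonneg[OF in_surf in_surf] that len_diff[OF that] by simp
  qed
  show ?thesis
    using *[OF assms] *[OF assms(2,1)] surf_dist_sym[of "\<gamma> t" "\<gamma> u"] by linarith
qed

lemma len_eq_imp:
  assumes "t \<in> \<Delta>" "u \<in> \<Delta>" "len t = len u"
  shows "\<gamma> t = \<gamma> u"
proof (rule surf_dist_eq_0)
  show "\<gamma> t \<in> surf G" "\<gamma> u \<in> surf G"
    using assms in_surf by auto
  then show "surf_dist (\<gamma> t) (\<gamma> u) = 0"
    using dist_le_len[OF assms(1,2)] surf_dist_nonneg[of "\<gamma> t" "\<gamma> u"] assms(3) by simp
qed

lemma len_eq_of_constant:
  assumes "t \<in> \<Delta>" "u \<in> \<Delta>" "t \<le> u" "\<And>v. v \<in> {t..u} \<Longrightarrow> \<gamma> v = \<gamma> t"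
  shows "len t = len u"
proof -
  have "arc_length \<gamma> t u \<le> 0"
  proof (rule arc_length_leI[OF segment(2)[OF assms(1,2)]])
    fix n and \<sigma> :: "nat \<Rightarrow> real" assume "range \<sigma> \<subseteq> {t..u}"
    then have "\<gamma> (\<sigma> i) = \<gamma> t" for i
      using assms(4) by (simp add: image_subset_iff)
    then show "ennreal (chord_sum \<gamma> n \<sigma>) \<le> 0"
      using surf_dist_refl[OF in_surf[OF assms(1)]] by (simp add: chord_sum_def)
  qed
  then show ?thesis
    using len_diff[OF assms(1-3)] by simp
qed

text \<open>One-sided lengths near t tend to 0; at an end of \<Delta> the missing side is
  void.\<close>

lemma len_continuous: "continuous_on \<Delta> len"
proof (rule continuous_onI)
  fix t e :: real assume t: "t \<in> \<Delta>" and e: "e > 0"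
  have cont': "\<exists>d>0. \<forall>u\<in>S. dist u t < d \<longrightarrow> surf_dist (\<gamma> t) (\<gamma> u) < e" if "S \<subseteq> \<Delta>" "e > 0" for S e
    using continuous_map_surf_dist[OF cont t that(2)] that(1) by blast
  have "\<exists>d>0. \<forall>u\<in>\<Delta>. u \<le> t \<longrightarrow> t - u < d \<longrightarrow> \<bar>len u - len t\<bar> < e"
  proof (cases "\<exists>a\<in>\<Delta>. a < t")
    case True
    then obtain a where a: "a \<in> \<Delta>" "a < t" by auto
    obtain d where d: "d > 0" "\<And>u. u \<in> {a..t} \<Longrightarrow> t - u < d \<Longrightarrow> enn2real (arc_length \<gamma> u t) < e"
      using arc_length_small_left[OF segment(2)[OF a(1) t] a(2) finite_length[OF a(1) t] e
          cont'[OF segment(1)[OF a(1) t]]] by blast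
    have "\<bar>len u - len t\<bar> < e" if "u \<in> \<Delta>" "u \<le> t" "t - u < min d (t - a)" for u
      using d(2)[of u] len_diff[OF that(1) t that(2)] len_mono[OF that(1) t that(2)] that by auto
    then show ?thesis
      using d(1) a(2) by (intro exI[of _ "min d (t - a)"]) auto
  next
    case False
    then have *: "u = t" if "u \<in> \<Delta>" "u \<le> t" for u
      using that by force
    show ?thesis
    proof (intro exI[of _ 1] conjI ballI impI)
      show "\<bar>len u - len t\<bar> < e" if "u \<in> \<Delta>" "u \<le> t" for u
        using *[OF that] e by simp
    qed simp
  qed
  then obtain d1 where d1: "d1 > 0" "\<forall>u\<in>\<Delta>. u \<le> t \<longrightarrow> t - u < d1 \<longrightarrow> \<bar>len u - len t\<bar> < e" by blast
  have "\<exists>d>0. \<forall>u\<in>\<Delta>. t \<le> u \<longrightarrow> u - t < d \<longrightarrow> \<bar>len u - len t\<bar> < e"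
  proof (cases "\<exists>b\<in>\<Delta>. t < b")
    case True
    then obtain b where b: "b \<in> \<Delta>" "t < b" by auto
    obtain d where d: "d > 0" "\<And>u. u \<in> {t..b} \<Longrightarrow> u - t < d \<Longrightarrow> enn2real (arc_length \<gamma> t u) < e"
      using arc_length_small_right[OF segment(2)[OF t b(1)] b(2) finite_length[OF t b(1)] e
          cont'[OF segment(1)[OF t b(1)]]] by blast
    have "\<bar>len u - len t\<bar> < e" if "u \<in> \<Delta>" "t \<le> u" "u - t < min d (b - t)" for u
      using d(2)[of u] len_diff[OF t that(1,2)] len_mono[OF t that(1,2)] that by auto
    then show ?thesis
      using d(1) b(2) by (intro exI[of _ "min d (b - t)"]) auto
  next
    case False
    then have *: "u = t" if "u \<in> \<Delta>" "t \<le> u" for u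
      using that by force
    show ?thesis
    proof (intro exI[of _ 1] conjI ballI impI)
      show "\<bar>len u - len t\<bar> < e" if "u \<in> \<Delta>" "t \<le> u" for u
        using *[OF that] e by simp
    qed simp
  qed
  then obtain d2 where d2: "d2 > 0" "\<forall>u\<in>\<Delta>. t \<le> u \<longrightarrow> u - t < d2 \<longrightarrow> \<bar>len u - len t\<bar> < e" by blast
  have "dist (len u) (len t) \<le> e" if "u \<in> \<Delta>" "dist u t < min d1 d2" for u
    using d1(2) d2(2) that by (cases "u \<le> t") (auto simp: dist_real_def less_imp_le)
  then show "\<exists>d>0. \<forall>x'\<in>\<Delta>. dist x' t < d \<longrightarrow> dist (len x') (len t) \<le> e"
    using d1(1) d2(1) by (intro exI[of _ "min d1 d2"]) auto
qed

abbreviation "I \<equiv> length_range (\<Delta>, \<gamma>)"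
abbreviation "\<eta> \<equiv> arc_param (\<Delta>, \<gamma>)"

lemma I_eq: "I = len ` \<Delta>"
  by (simp add: length_range_def)

lemma I_interval: "is_interval I"
proof -
  have "connected \<Delta>"
    using interval by (auto simp: curve_interval_def)
  then show ?thesis
    unfolding I_eq is_interval_connected_1 by (rule connected_continuous_image[OF len_continuous])
qed

lemma arc_param_len:
  assumes "t \<in> \<Delta>" shows "\<eta> (len t) = \<gamma> t"
proof -
  define u where "u = (SOME u. u \<in> \<Delta> \<and> len u = len t)"
  have "u \<in> \<Delta> \<and> len u = len t"
    unfolding u_def by (rule someI[of _ t]) (use assms in auto)
  then have "\<gamma> u = \<gamma> t"
    by (intro len_eq_imp) (use assms in auto)
  then show ?thesis
    by (simp add: arc_param_def u_def)
qed

lemma I_E: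
  assumes "s \<in> I" obtains t where "t \<in> \<Delta>" "s = len t" "\<eta> s = \<gamma> t"
  using assms that arc_param_len unfolding I_eq by blast

lemma arc_param_in_surf: "s \<in> I \<Longrightarrow> \<eta> s \<in> surf G"
  by (auto elim!: I_E simp: in_surf)

lemma arc_param_dist: "s \<in> I \<Longrightarrow> s' \<in> I \<Longrightarrow> surf_dist (\<eta> s) (\<eta> s') \<le> \<bar>s - s'\<bar>"
  by (auto elim!: I_E intro: dist_le_len)

text \<open>Unit speed in a form free of derivatives: chords of \<eta> nearly exhaust the parameter
  length. Nearly optimal vertices for \<gamma> are transported by \<open>len\<close>.\<close>

lemma arc_param_chords:
  assumes "s \<in> I" "s' \<in> I" "s \<le> s'" "e > 0"
  shows "\<exists>n \<sigma>. mono \<sigma> \<and> range \<sigma> \<subseteq> {s..s'} \<and> \<sigma> 0 = s \<and> \<sigma> n = s' \<and> s' - s - e < chord_sum \<eta> n \<sigma>"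
proof -
  \<comment> \<open>Parameters over s and s' can be in the wrong order only if s = s', and then one
    of them serves for both.\<close>
  obtain t u where t: "t \<in> \<Delta>" "s = len t" "u \<in> \<Delta>" "s' = len u" "t \<le> u"
  proof -
    obtain t u where tu: "t \<in> \<Delta>" "s = len t" "u \<in> \<Delta>" "s' = len u"
      using assms by (auto simp: I_eq)
    show ?thesis
    proof (cases "t \<le> u")
      case True
      then show ?thesis using tu that by blast
    next
      case False
      then have "s = s'"
        using len_mono[OF tu(3,1)] tu assms(3) by auto
      then show ?thesis
        using tu that[of t t] by simp
    qed
  qed
  obtain n \<tau> where \<tau>: "mono \<tau>" "range \<tau> \<subseteq> {t..u}" "\<tau> 0 = t" "\<tau> n = u"
    "enn2real (arc_length \<gamma> t u) - e < chord_sum \<gamma> n \<tau>"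
    using chord_sum_approx[OF segment(2)[OF t(1,3)] t(5) finite_length[OF t(1,3)] assms(4)] by blast
  have \<tau>\<Delta>: "\<tau> i \<in> \<Delta>" "t \<le> \<tau> i" "\<tau> i \<le> u" for i
    using \<tau>(2) segment(1)[OF t(1,3)] by (auto simp: image_subset_iff)
  show ?thesis
  proof (intro exI conjI)
    show "mono (len \<circ> \<tau>)"
      using \<tau>(1) len_mono \<tau>\<Delta> by (auto simp: mono_def)
    show "range (len \<circ> \<tau>) \<subseteq> {s..s'}"
      using len_mono[OF t(1) \<tau>\<Delta>(1,2)] len_mono[OF \<tau>\<Delta>(1) t(3) \<tau>\<Delta>(3)] t by auto
    show "s' - s - e < chord_sum \<eta> n (len \<circ> \<tau>)"
      using \<tau>(5) len_diff[OF t(1,3,5)] t by (simp add: chord_sum_def arc_param_len \<tau>\<Delta>)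
  qed (use \<tau> t in auto)
qed

lemma arc_param_continuous: "continuous_map (top_of_set I) (surf_topology G) \<eta>"
proof (rule continuous_map_surfI)
  fix t e :: real assume "t \<in> I" "e > 0"
  then show "\<exists>d>0. \<forall>u\<in>I. dist u t < d \<longrightarrow> surf_dist (\<eta> t) (\<eta> u) < e"
    using arc_param_dist by (intro exI[of _ e]) (force simp: dist_real_def)
qed (use arc_param_in_surf in auto)

end

subsection \<open>Measures and absolute continuity on the line\<close>

text \<open>All types of intervals are treated at once: the smallest and largest of the first n + 1
  members of a countable set that is cofinal in I at both ends.\<close>

lemma interval_exhaustion:
  fixes I :: "real set"
  assumes I: "is_interval I" "I \<noteq> {}"
  obtains a b :: "nat \<Rightarrow> real" where "decseq a" "incseq b" "\<And>n. a n \<in> I" "\<And>n. b n \<in> I" "I = (\<Union>n. {a n..b n})"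
proof -
  obtain x0 where x0: "x0 \<in> I"
    using I by auto
  \<comment> \<open>Rationals reach every point of I from both sides except an endpoint belonging to
    I, which is therefore added; \<open>x0\<close> makes C nonempty.\<close>
  define C where "C = I \<inter> (\<rat> \<union> {Inf I, Sup I, x0})"
  have C: "C \<subseteq> I" "C \<noteq> {}" "countable C"
    using x0 by (auto simp: C_def countable_rat)
  define c where "c = from_nat_into C"
  have rc: "range c = C"
    unfolding c_def using C by (intro range_from_nat_into)
  have lower: "\<exists>p\<in>C. p \<le> x" if x: "x \<in> I" for x
  proof (cases "\<exists>y\<in>I. y < x")
    case True
    then obtain y r where y: "y \<in> I" "y < r" "r < x" "r \<in> \<rat>"
      using Rats_dense_in_real by blast
    then have "r \<in> I"
      using mem_is_interval_1_I[OF I(1) y(1) x] by simp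
    with y show ?thesis by (intro bexI[of _ r]) (auto simp: C_def)
  next
    case False
    then have "Inf I = x"
      using x by (intro cInf_eq_minimum) (auto simp: not_less)
    with x show ?thesis by (intro bexI[of _ x]) (auto simp: C_def)
  qed
  have upper: "\<exists>p\<in>C. x \<le> p" if x: "x \<in> I" for x
  proof (cases "\<exists>y\<in>I. x < y")
    case True
    then obtain y r where y: "y \<in> I" "x < r" "r < y" "r \<in> \<rat>"
      using Rats_dense_in_real by blast
    then have "r \<in> I"
      using mem_is_interval_1_I[OF I(1) x y(1)] by simp
    with y show ?thesis by (intro bexI[of _ r]) (auto simp: C_def)
  next
    case False
    then have "Sup I = x"
      using x by (intro cSup_eq_maximum) (auto simp: not_less)
    with x show ?thesis by (intro bexI[of _ x]) (auto simp: C_def)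
  qed
  define a where "a n = Min (c ` {..n})" for n
  define b where "b n = Max (c ` {..n})" for n
  have ab: "a n \<in> C" "b n \<in> C" for n
  proof -
    have "a n \<in> c ` {..n}" "b n \<in> c ` {..n}"
      using Min_in[of "c ` {..n}"] Max_in[of "c ` {..n}"] by (simp_all add: a_def b_def)
    then show "a n \<in> C" "b n \<in> C"
      using rc by auto
  qed
  show ?thesis
  proof (rule that)
    show "decseq a" unfolding decseq_def a_def by (auto intro!: Min_antimono)
    show "incseq b" unfolding incseq_def b_def by (auto intro!: Max_mono)
    show "a n \<in> I" "b n \<in> I" for n using ab C by auto
    show "I = (\<Union>n. {a n..b n})"
    proof (intro subset_antisym subsetI)
      fix x assume "x \<in> (\<Union>n. {a n..b n})"
      then obtain n where "a n \<le> x" "x \<le> b n" by auto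
      then show "x \<in> I"
        using mem_is_interval_1_I[OF I(1), of "a n" "b n" x] ab[of n] C by auto
    next
      fix x assume "x \<in> I"
      then obtain p q where pq: "p \<in> C" "p \<le> x" "q \<in> C" "x \<le> q"
        using lower upper by blast
      then obtain m n where "p = c m" "q = c n"
        using rc by (metis rangeE)
      then have "a (max m n) \<le> p" "q \<le> b (max m n)"
        unfolding a_def b_def by (auto intro!: Min_le Max_ge)
      with pq show "x \<in> (\<Union>n. {a n..b n})"
        by (auto intro!: exI[of _ "max m n"])
    qed
  qed
qed

text \<open>Absolute continuity is available on closed segments only, so line integrals are
  estimated there, and monotone convergence passes to the whole interval.\<close>

lemma set_nn_integral_le_on_interval:
  fixes g :: "real \<Rightarrow> ennreal"
  assumes I: "is_interval I" and g: "(\<lambda>x. g x * indicator I x) \<in> borel_measurable lborel"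
    and le: "\<And>p q. p \<in> I \<Longrightarrow> q \<in> I \<Longrightarrow> p \<le> q \<Longrightarrow> (\<integral>\<^sup>+x\<in>{p..q}. g x \<partial>lborel) \<le> C"
  shows "(\<integral>\<^sup>+x\<in>I. g x \<partial>lborel) \<le> C"
proof (cases "I = {}")
  case False
  obtain a b where ab: "decseq a" "incseq b" "\<And>n. a n \<in> I" "\<And>n. b n \<in> I" "I = (\<Union>n. {a n..b n})"
    using interval_exhaustion[OF I False] by blast
  have sub: "{a n..b n} \<subseteq> I" for n using ab(5) by auto
  have inc: "incseq (\<lambda>n x. g x * indicator {a n..b n} x)"
  proof (rule incseq_SucI, rule le_funI)
    fix n x
    have "{a n..b n} \<subseteq> {a (Suc n)..b (Suc n)}"
      using decseq_SucD[OF ab(1)] incseq_SucD[OF ab(2)] by (auto intro: order_trans)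
    then show "g x * indicator {a n..b n} x \<le> g x * indicator {a (Suc n)..b (Suc n)} x"
      by (auto simp: indicator_def)
  qed
  have m: "(\<lambda>x. g x * indicator {a n..b n} x) \<in> borel_measurable lborel" for n
  proof -
    have "(\<lambda>x. (g x * indicator I x) * indicator {a n..b n} x) \<in> borel_measurable lborel"
      by (rule borel_measurable_times_ennreal[OF g]) simp
    also have "(\<lambda>x. (g x * indicator I x) * indicator {a n..b n} x) = (\<lambda>x. g x * indicator {a n..b n} x)"
      using sub[of n] by (auto simp: indicator_def fun_eq_iff)
    finally show ?thesis .
  qed
  have "(\<integral>\<^sup>+x\<in>I. g x \<partial>lborel) = (\<integral>\<^sup>+x. (SUP n. g x * indicator {a n..b n} x) \<partial>lborel)"
  proof (rule nn_integral_cong)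
    fix x
    show "g x * indicator I x = (SUP n. g x * indicator {a n..b n} x)"
    proof (cases "x \<in> I")
      case True
      then obtain n where "x \<in> {a n..b n}" using ab(5) by auto
      then show ?thesis
        using True by (intro antisym SUP_upper2[of n] SUP_least) (auto simp: indicator_def)
    next
      case False
      then have "x \<notin> {a n..b n}" for n using sub[of n] by auto
      then have "indicator {a n..b n} x = (0::ennreal)" for n by (simp add: indicator_def)
      then show ?thesis using False by simp
    qed
  qed
  also have "\<dots> = (SUP n. \<integral>\<^sup>+x\<in>{a n..b n}. g x \<partial>lborel)"
    using inc m by (rule nn_integral_monotone_convergence_SUP)
  also have "\<dots> \<le> C"
  proof (rule SUP_least)
    fix n show "(\<integral>\<^sup>+x\<in>{a n..b n}. g x \<partial>lborel) \<le> C"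
    proof (cases "a n \<le> b n")
      case True then show ?thesis using le ab by blast
    qed simp
  qed
  finally show ?thesis .
qed simp

text \<open>The intervals are the components of U, which are open, pairwise disjoint and hence
  countably many.\<close>

lemma open_real_disjoint_intervals:
  fixes U :: "real set"
  assumes U: "open U" "U \<subseteq> {p<..<q}" and pq: "p \<le> q"
  obtains a b :: "nat \<Rightarrow> real" where "disjoint_family (\<lambda>n. {a n<..<b n})" "U = (\<Union>n. {a n<..<b n})"
    "\<And>n. p \<le> a n \<and> a n \<le> b n \<and> b n \<le> q"
proof -
  have "countable (components U)"
    using pairwise_disjoint_components[of U] open_components[OF U(1)]
    by (intro countable_disjoint_open_subsets) (auto simp: pairwise_def disjnt_def)
  then obtain h :: "real set \<Rightarrow> nat" where h: "inj_on h (components U)"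
    by (auto simp: countable_def)
  define S where "S n = (if n \<in> h ` components U then inv_into (components U) h n else {})" for n
  have S: "S n \<in> components U \<and> h (S n) = n \<or> S n = {}" for n
    by (auto simp: S_def inv_into_into f_inv_into_f h)
  have Sh: "S (h C) = C" if "C \<in> components U" for C
    using that h by (simp add: S_def)
  have SU: "S n \<subseteq> U" for n
    using S[of n] in_components_subset by auto
  have *: "\<exists>a b. S n = {a<..<b} \<and> p \<le> a \<and> a \<le> b \<and> b \<le> q" for n
  proof (cases "S n = {}")
    case True
    \<comment> \<open>Indices that belong to no component get the empty interval from p to
      p.\<close>
    then show ?thesis using pq by (intro exI[of _ p] exI[of _ p]) auto
  next
    case False
    then have C: "S n \<in> components U" using S by auto
    have op: "open (S n)" using open_components[OF U(1) C] .
    have bd: "S n \<subseteq> {p<..<q}" using SU U(2) by blast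
    have bdd: "bdd_above (S n)" "bdd_below (S n)"
      using bd by (meson bdd_above_Ioo bdd_above_mono, meson bdd_below_Ioo bdd_below_mono)
    have conn: "is_interval (S n)"
      using in_components_connected[OF C] by (simp add: is_interval_connected_1)
    have "S n = {Inf (S n)<..<Sup (S n)}"
    proof (intro subset_antisym subsetI)
      fix x assume x: "x \<in> S n"
      obtain e where e: "e > 0" "ball x e \<subseteq> S n"
        using op x openE by blast
      have "x - e/2 \<in> S n" "x + e/2 \<in> S n"
        using e by (auto simp: subset_iff dist_real_def)
      then have "Inf (S n) \<le> x - e/2" "x + e/2 \<le> Sup (S n)"
        using bdd by (auto intro: cInf_lower cSup_upper)
      then show "x \<in> {Inf (S n)<..<Sup (S n)}" using e by auto
    next
      fix x assume "x \<in> {Inf (S n)<..<Sup (S n)}"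
      then obtain y z where "y \<in> S n" "y < x" "z \<in> S n" "x < z"
        using False bdd by (metis cInf_lessD greaterThanLessThan_iff less_cSupD)
      then show "x \<in> S n"
        using mem_is_interval_1_I[OF conn, of y z x] by auto
    qed
    moreover have "p \<le> Inf (S n)"
      using bd False by (intro cInf_greatest) auto
    moreover have "Sup (S n) \<le> q"
      using bd False by (intro cSup_least) auto
    moreover have "Inf (S n) \<le> Sup (S n)"
      using False bdd by (intro cInf_le_cSup) auto
    ultimately show ?thesis by blast
  qed
  then obtain a b where ab: "\<And>n. S n = {a n<..<b n} \<and> p \<le> a n \<and> a n \<le> b n \<and> b n \<le> q"
    by metis
  show ?thesis
  proof (rule that[of a b])
    show "disjoint_family (\<lambda>n. {a n<..<b n})"
      unfolding disjoint_family_on_def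
    proof (intro ballI impI)
      fix m n :: nat assume "m \<noteq> n"
      then have "S m \<inter> S n = {}"
        using S[of m] S[of n] pairwise_disjoint_components[of U] unfolding pairwise_def by (metis inf_bot_left inf_bot_right)
      then show "{a m<..<b m} \<inter> {a n<..<b n} = {}" using ab by metis
    qed
    have "U = (\<Union>n. S n)"
    proof (intro subset_antisym subsetI)
      fix x assume "x \<in> U"
      then obtain C where "C \<in> components U" "x \<in> C"
        using Union_components by blast
      then show "x \<in> (\<Union>n. S n)" using Sh by blast
    qed (use SU in auto)
    then show "U = (\<Union>n. {a n<..<b n})" using ab by simp
  qed (use ab in auto)
qed

lemma outer_open_in_interval:
  fixes B :: "real set"
  assumes B: "B \<in> sets borel" "B \<subseteq> {p<..<q}" and "e > 0"
  obtains U where "open U" "B \<subseteq> U" "U \<subseteq> {p<..<q}" "emeasure lborel U \<le> emeasure lborel B + ennreal e"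
proof -
  obtain V where V: "open V" "B \<subseteq> V" "emeasure lborel (V - B) < ennreal e"
    using outer_regular_lborel[OF B(1) \<open>e > 0\<close>] by blast
  have "emeasure lborel (V \<inter> {p<..<q}) \<le> emeasure lborel (B \<union> (V - B))"
    using V B by (intro emeasure_mono) auto
  also have "\<dots> \<le> emeasure lborel B + emeasure lborel (V - B)"
    using V B by (intro emeasure_subadditive) auto
  also have "\<dots> \<le> emeasure lborel B + ennreal e"
    using V by (intro add_left_mono) auto
  finally show ?thesis
    using V B by (intro that[of "V \<inter> {p<..<q}"]) auto
qed

text \<open>The bound passes from intervals to open sets through their components, and from open
  sets to Borel sets by outer regularity of Lebesgue measure.\<close>

lemma emeasure_le_of_intervals:
  fixes m :: "real measure"
  assumes sets: "sets m = sets borel" and "0 \<le> c"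
    and le: "\<And>u v. p \<le> u \<Longrightarrow> u \<le> v \<Longrightarrow> v \<le> q \<Longrightarrow> emeasure m {u<..<v} \<le> ennreal (c * (v - u))"
    and B: "B \<in> sets borel" "B \<subseteq> {p<..<q}" and pq: "p \<le> q"
  shows "emeasure m B \<le> ennreal c * emeasure lborel B"
proof -
  have op: "emeasure m U \<le> ennreal c * emeasure lborel U" if U: "open U" "U \<subseteq> {p<..<q}" for U
  proof -
    obtain a b where ab: "disjoint_family (\<lambda>n. {a n<..<b n})" "U = (\<Union>n. {a n<..<b n})"
      "\<And>n::nat. p \<le> a n \<and> a n \<le> b n \<and> b n \<le> q"
      using open_real_disjoint_intervals[OF U pq] by blast
    have "emeasure m U = (\<Sum>n. emeasure m {a n<..<b n})"
      unfolding ab(2) using ab(1) by (intro suminf_emeasure[symmetric]) (auto simp: sets)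
    also have "\<dots> \<le> (\<Sum>n. ennreal c * emeasure lborel {a n<..<b n})"
    proof (rule suminf_le)
      fix n show "emeasure m {a n<..<b n} \<le> ennreal c * emeasure lborel {a n<..<b n}"
        using le[of "a n" "b n"] ab(3)[of n] \<open>0 \<le> c\<close> by (simp add: ennreal_mult)
    qed auto
    also have "\<dots> = ennreal c * (\<Sum>n. emeasure lborel {a n<..<b n})" by simp
    also have "(\<Sum>n. emeasure lborel {a n<..<b n}) = emeasure lborel U"
      unfolding ab(2) using ab(1) by (intro suminf_emeasure) auto
    finally show ?thesis .
  qed
  show ?thesis
  proof (rule ennreal_le_epsilon)
    fix e :: real assume e: "e > 0"
    \<comment> \<open>The error is e/(c + 1), since c may be 0.\<close>
    obtain U where U: "open U" "B \<subseteq> U" "U \<subseteq> {p<..<q}" "emeasure lborel U \<le> emeasure lborel B + ennreal (e / (c + 1))"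
      using outer_open_in_interval[OF B, of "e / (c + 1)"] e \<open>0 \<le> c\<close> by auto
    have "emeasure m B \<le> emeasure m U"
      using U sets by (intro emeasure_mono) auto
    also have "\<dots> \<le> ennreal c * emeasure lborel U" by (rule op[OF U(1,3)])
    also have "\<dots> \<le> ennreal c * (emeasure lborel B + ennreal (e / (c + 1)))"
      using U(4) by (intro mult_left_mono) auto
    also have "\<dots> = ennreal c * emeasure lborel B + ennreal (c * (e / (c + 1)))"
      using e \<open>0 \<le> c\<close> ennreal_mult[of c "e / (c + 1)"] by (simp add: distrib_left)
    also have "\<dots> \<le> ennreal c * emeasure lborel B + ennreal e"
    proof (intro add_left_mono ennreal_leI)
      show "c * (e / (c + 1)) \<le> e" using e \<open>0 \<le> c\<close> by (simp add: field_simps)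
    qed
    finally show "emeasure m B \<le> ennreal c * emeasure lborel B + ennreal e" .
  qed
qed

lemma abs_continuousE:
  assumes "abs_continuous_on_interval \<phi> p q" "e > 0"
  obtains \<delta> where "\<delta> > 0" "\<forall>(n :: nat) a b. (\<forall>i<n. p \<le> a i \<and> a i \<le> b i \<and> b i \<le> q) \<and>
        disjoint_family_on (\<lambda>i. {a i<..<b i}) {..<n} \<and> (\<Sum>i<n. b i - a i) < \<delta> \<longrightarrow>
        (\<Sum>i<n. \<bar>\<phi> (b i) - \<phi> (a i)\<bar>) < e"
  using assms unfolding abs_continuous_on_interval_def by blast

text \<open>A null set is covered by an open set shorter than the \<delta> of absolute continuity;
  the components of that set carry total increment below e.\<close>

lemma abs_continuous_null:
  fixes m :: "real measure"
  assumes sets: "sets m = sets borel" and AC: "abs_continuous_on_interval \<phi> p q"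
    and m: "\<And>u v. p \<le> u \<Longrightarrow> u \<le> v \<Longrightarrow> v \<le> q \<Longrightarrow> emeasure m {u<..<v} \<le> ennreal \<bar>\<phi> v - \<phi> u\<bar>"
    and B: "B \<in> sets borel" "B \<subseteq> {p<..<q}" "emeasure lborel B = 0" and pq: "p \<le> q"
  shows "emeasure m B = 0"
proof -
  have small: "emeasure m B \<le> ennreal e" if e: "e > 0" for e
  proof -
    obtain \<delta> where \<delta>: "\<delta> > 0" "\<forall>(n :: nat) a b. (\<forall>i<n. p \<le> a i \<and> a i \<le> b i \<and> b i \<le> q) \<and>
        disjoint_family_on (\<lambda>i. {a i<..<b i}) {..<n} \<and> (\<Sum>i<n. b i - a i) < \<delta> \<longrightarrow>
        (\<Sum>i<n. \<bar>\<phi> (b i) - \<phi> (a i)\<bar>) < e"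
      by (rule abs_continuousE[OF AC e])
    obtain U where U: "open U" "B \<subseteq> U" "U \<subseteq> {p<..<q}" "emeasure lborel U \<le> emeasure lborel B + ennreal (\<delta> / 2)"
      using outer_open_in_interval[OF B(1,2), of "\<delta> / 2"] \<delta>(1) by auto
    obtain a b where ab: "disjoint_family (\<lambda>n. {a n<..<b n})" "U = (\<Union>n. {a n<..<b n})"
      "\<And>n::nat. p \<le> a n \<and> a n \<le> b n \<and> b n \<le> q"
      using open_real_disjoint_intervals[OF U(1,3) pq] by blast
    have "emeasure m B \<le> emeasure m U"
      using U sets by (intro emeasure_mono) auto
    also have "emeasure m U = (\<Sum>n. emeasure m {a n<..<b n})"
      unfolding ab(2) using ab(1) by (intro suminf_emeasure[symmetric]) (auto simp: sets)
    \<comment> \<open>Absolute continuity speaks of finite families only, so the series is bounded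
      through its partial sums.\<close>
    also have "\<dots> = (SUP n. \<Sum>i<n. emeasure m {a i<..<b i})"
      by (rule suminf_eq_SUP)
    also have "\<dots> \<le> ennreal e"
    proof (rule SUP_least)
      fix n
      have dis: "disjoint_family_on (\<lambda>i. {a i<..<b i}) {..<n}"
        using ab(1) by (rule disjoint_family_on_mono[rotated]) auto
      have "ennreal (\<Sum>i<n. b i - a i) = (\<Sum>i<n. emeasure lborel {a i<..<b i})"
        using ab(3) by (subst sum_ennreal[symmetric]) auto
      also have "\<dots> = emeasure lborel (\<Union>i<n. {a i<..<b i})"
        using dis by (intro sum_emeasure) auto
      also have "\<dots> \<le> emeasure lborel U"
        unfolding ab(2) by (intro emeasure_mono) auto
      also have "\<dots> \<le> ennreal (\<delta> / 2)" using U(4) B(3) by simp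
      finally have "(\<Sum>i<n. b i - a i) \<le> \<delta> / 2"
        using \<delta>(1) by (simp add: ennreal_le_iff)
      then have "(\<Sum>i<n. \<bar>\<phi> (b i) - \<phi> (a i)\<bar>) < e"
        using \<delta>(1) ab(3) dis by (intro \<delta>(2)[rule_format]) auto
      moreover have "(\<Sum>i<n. emeasure m {a i<..<b i}) \<le> (\<Sum>i<n. ennreal \<bar>\<phi> (b i) - \<phi> (a i)\<bar>)"
        using ab(3) by (intro sum_mono m) auto
      moreover have "(\<Sum>i<n. ennreal \<bar>\<phi> (b i) - \<phi> (a i)\<bar>) = ennreal (\<Sum>i<n. \<bar>\<phi> (b i) - \<phi> (a i)\<bar>)"
        by (rule sum_ennreal) simp
      ultimately show "(\<Sum>i<n. emeasure m {a i<..<b i}) \<le> ennreal e"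
        by (simp add: ennreal_leI order_trans[of _ "ennreal (\<Sum>i<n. \<bar>\<phi> (b i) - \<phi> (a i)\<bar>)"])
    qed
    finally show ?thesis .
  qed
  have "emeasure m B \<le> 0"
  proof (rule ennreal_le_epsilon)
    fix e :: real assume "e > 0"
    then show "emeasure m B \<le> 0 + ennreal e"
      using small[of e] by simp
  qed
  then show ?thesis by simp
qed

lemma abs_continuous_imp_continuous_on:
  assumes "abs_continuous_on_interval \<phi> p q"
  shows "continuous_on {p..q} \<phi>"
proof (rule continuous_onI)
  fix x e :: real assume x: "x \<in> {p..q}" and e: "e > 0"
  obtain \<delta> where \<delta>: "\<delta> > 0" "\<forall>(n :: nat) a b. (\<forall>i<n. p \<le> a i \<and> a i \<le> b i \<and> b i \<le> q) \<and>
      disjoint_family_on (\<lambda>i. {a i<..<b i}) {..<n} \<and> (\<Sum>i<n. b i - a i) < \<delta> \<longrightarrow>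
      (\<Sum>i<n. \<bar>\<phi> (b i) - \<phi> (a i)\<bar>) < e"
    by (rule abs_continuousE[OF assms e])
  have "dist (\<phi> y) (\<phi> x) \<le> e" if y: "y \<in> {p..q}" "dist y x < \<delta>" for y
  proof (cases "x \<le> y")
    case True
    then show ?thesis
      using \<delta>(2)[rule_format, of 1 "\<lambda>_. x" "\<lambda>_. y"] x y
      by (simp add: disjoint_family_on_def dist_real_def)
  next
    case False
    then show ?thesis
      using \<delta>(2)[rule_format, of 1 "\<lambda>_. y" "\<lambda>_. x"] x y
      by (simp add: disjoint_family_on_def dist_real_def abs_minus_commute)
  qed
  then show "\<exists>d>0. \<forall>x'\<in>{p..q}. dist x' x < d \<longrightarrow> dist (\<phi> x') (\<phi> x) \<le> e"
    using \<delta>(1) by blast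
qed

subsection \<open>Curves and their images\<close>

lemma measurable_surf_borel_continuous:
  fixes \<eta> :: "'a::topological_space \<Rightarrow> complex set"
  assumes \<eta>: "continuous_map (top_of_set S) (surf_topology G) \<eta>" and S: "S \<in> sets borel"
  shows "\<eta> \<in> restrict_space borel S \<rightarrow>\<^sub>M surf_borel G"
  unfolding surf_borel_def
proof (rule measurable_measure_of)
  show "{U. openin (surf_topology G) U} \<subseteq> Pow (surf G)"
    by (auto simp: openin_surf_topology)
  show "\<eta> \<in> space (restrict_space borel S) \<rightarrow> surf G"
    using \<eta> by (auto simp: space_restrict_space continuous_map_def topspace_surf_topology)
  fix U assume "U \<in> {U. openin (surf_topology G) U}"
  then have "openin (top_of_set S) {x \<in> S. \<eta> x \<in> U}"
    using \<eta> by (auto simp: continuous_map_def)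
  then obtain T where "open T" "{x \<in> S. \<eta> x \<in> U} = S \<inter> T"
    by (auto simp: openin_open)
  then have "\<eta> -` U \<inter> space (restrict_space borel S) = S \<inter> T"
    by (auto simp: space_restrict_space)
  then show "\<eta> -` U \<inter> space (restrict_space borel S) \<in> sets (restrict_space borel S)"
    using S \<open>open T\<close> by (simp add: sets_restrict_space_iff)
qed

text \<open>\<open>no_collapse\<close> gives the two length functions the same fibres, so that
  \<open>L_fun\<close> is an increasing bijection between the two arc length intervals.\<close>

locale lifted_curve = A: rectifiable_curve G \<Delta> \<gamma> + B: rectifiable_curve H \<Delta> "f \<circ> \<gamma>"
  for G H :: "(complex \<Rightarrow> complex) set" and \<Delta> \<gamma> f +
  assumes no_collapse: "\<And>t u. t \<in> \<Delta> \<Longrightarrow> u \<in> \<Delta> \<Longrightarrow> t \<le> u \<Longrightarrow> (\<And>v. v \<in> {t..u} \<Longrightarrow> f (\<gamma> v) = f (\<gamma> t)) \<Longrightarrow>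
      (\<forall>v\<in>{t..u}. \<gamma> v = \<gamma> t)"
begin

text \<open>Equal lengths at t and u mean that the curve is constant in between, and \<gamma> and f
  \<circ> \<gamma> are constant on the same segments.\<close>

lemma len_eq_iff:
  assumes t: "t \<in> \<Delta>" "u \<in> \<Delta>"
  shows "A.len t = A.len u \<longleftrightarrow> B.len t = B.len u"
proof -
  have *: "A.len t = A.len u \<longleftrightarrow> B.len t = B.len u" if t: "t \<in> \<Delta>" "u \<in> \<Delta>" "t \<le> u" for t u
  proof
    assume eq: "A.len t = A.len u"
    have const: "\<gamma> v = \<gamma> t" if v: "v \<in> {t..u}" for v
    proof -
      have "v \<in> \<Delta>" using v A.segment(1)[OF t(1,2)] by auto
      then have "A.len v = A.len t"
        using A.len_mono[OF t(1) \<open>v \<in> \<Delta>\<close>] A.len_mono[OF \<open>v \<in> \<Delta>\<close> t(2)] v eq by auto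
      then show ?thesis
        by (rule A.len_eq_imp[OF \<open>v \<in> \<Delta>\<close> t(1)])
    qed
    show "B.len t = B.len u"
    proof (rule B.len_eq_of_constant[OF t])
      fix v assume "v \<in> {t..u}"
      from const[OF this] show "(f \<circ> \<gamma>) v = (f \<circ> \<gamma>) t" by simp
    qed
  next
    assume eq: "B.len t = B.len u"
    have "f (\<gamma> v) = f (\<gamma> t)" if v: "v \<in> {t..u}" for v
    proof -
      have "v \<in> \<Delta>" using v A.segment(1)[OF t(1,2)] by auto
      then have "B.len v = B.len t"
        using B.len_mono[OF t(1) \<open>v \<in> \<Delta>\<close>] B.len_mono[OF \<open>v \<in> \<Delta>\<close> t(2)] v eq by auto
      then show ?thesis
        using B.len_eq_imp[OF \<open>v \<in> \<Delta>\<close> t(1)] by simp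
    qed
    then have "\<forall>v\<in>{t..u}. \<gamma> v = \<gamma> t"
      by (rule no_collapse[OF t])
    then show "A.len t = A.len u"
      using A.len_eq_of_constant[OF t] by blast
  qed
  show ?thesis
    using *[OF t] *[OF t(2,1)] by (cases "t \<le> u") auto
qed

lemma len_le_iff:
  assumes t: "t \<in> \<Delta>" "u \<in> \<Delta>"
  shows "A.len t \<le> A.len u \<longleftrightarrow> B.len t \<le> B.len u"
proof (cases "t \<le> u")
  case True
  then show ?thesis using A.len_mono[OF t] B.len_mono[OF t] by simp
next
  case False
  then have "A.len u \<le> A.len t" "B.len u \<le> B.len t"
    using A.len_mono[OF t(2,1)] B.len_mono[OF t(2,1)] by auto
  then show ?thesis using len_eq_iff[OF t] by auto
qed

abbreviation "L \<equiv> L_fun f (\<Delta>, \<gamma>)"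
abbreviation "\<phi> \<equiv> L_inv f (\<Delta>, \<gamma>)"

lemma L_len:
  assumes "t \<in> \<Delta>" shows "L (A.len t) = B.len t"
  unfolding L_fun_def
proof (rule the_equality)
  show "\<exists>t'\<in>fst (\<Delta>, \<gamma>). A.len t' = A.len t \<and> B.len t = length_fun (image_curve f (\<Delta>, \<gamma>)) t'"
    using assms by (auto simp: image_curve_def)
  fix u assume "\<exists>t'\<in>fst (\<Delta>, \<gamma>). A.len t' = A.len t \<and> u = length_fun (image_curve f (\<Delta>, \<gamma>)) t'"
  then show "u = B.len t"
    using assms len_eq_iff by (auto simp: image_curve_def)
qed

lemma L_inj: "inj_on L A.I"
proof (rule inj_onI)
  fix s s' assume "s \<in> A.I" "s' \<in> A.I" "L s = L s'"
  moreover then obtain t u where "t \<in> \<Delta>" "s = A.len t" "u \<in> \<Delta>" "s' = A.len u"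
    by (auto simp: A.I_eq)
  ultimately show "s = s'"
    using L_len len_eq_iff[of t u] by simp
qed

lemma \<phi>_len:
  assumes "t \<in> \<Delta>" shows "\<phi> (B.len t) = A.len t"
proof -
  have "A.len t \<in> A.I" using assms by (simp add: A.I_eq)
  from inv_into_f_f[OF L_inj this] show ?thesis
    by (simp add: L_inv_def L_len[OF assms])
qed

lemma \<phi>_le_iff: "x \<in> B.I \<Longrightarrow> y \<in> B.I \<Longrightarrow> \<phi> x \<le> \<phi> y \<longleftrightarrow> x \<le> y"
  unfolding B.I_eq using \<phi>_len len_le_iff by auto

lemma \<phi>_less_iff: "x \<in> B.I \<Longrightarrow> y \<in> B.I \<Longrightarrow> \<phi> x < \<phi> y \<longleftrightarrow> x < y"
  using \<phi>_le_iff[of y x] by (auto simp: not_le[symmetric])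

lemma \<phi>_in_I: "x \<in> B.I \<Longrightarrow> \<phi> x \<in> A.I"
  unfolding B.I_eq A.I_eq using \<phi>_len by auto

lemma L_in_I: "s \<in> A.I \<Longrightarrow> L s \<in> B.I"
  unfolding B.I_eq A.I_eq using L_len by auto

lemma \<phi>_L: "s \<in> A.I \<Longrightarrow> \<phi> (L s) = s"
  unfolding A.I_eq using L_len \<phi>_len by auto

lemma L_\<phi>: "x \<in> B.I \<Longrightarrow> L (\<phi> x) = x"
  unfolding B.I_eq using L_len \<phi>_len by auto

lemma f_arc_param: "x \<in> B.I \<Longrightarrow> f (A.\<eta> (\<phi> x)) = B.\<eta> x"
  unfolding B.I_eq using \<phi>_len A.arc_param_len B.arc_param_len by auto

lemma arc_param_image: "s \<in> A.I \<Longrightarrow> A.\<eta> s \<in> \<gamma> ` \<Delta>"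
  unfolding A.I_eq using A.arc_param_len by auto

lemma B_segment: "x \<in> B.I \<Longrightarrow> y \<in> B.I \<Longrightarrow> {x..y} \<subseteq> B.I"
  using mem_is_interval_1_I[OF B.I_interval, of x y] by auto

lemma A_segment: "x \<in> A.I \<Longrightarrow> y \<in> A.I \<Longrightarrow> {x..y} \<subseteq> A.I"
  using mem_is_interval_1_I[OF A.I_interval, of x y] by auto

text \<open>The Stieltjes measure of \<phi> on the segment from p to q, realized as an image of
  Lebesgue measure: the length of \<gamma>, seen in the arc length parameter of f \<circ> \<gamma>.
  Off the segment L is replaced by 0 to obtain a total measurable function.\<close>

definition m :: "real \<Rightarrow> real \<Rightarrow> real measure" where
  "m p q = distr (density lborel (indicator {\<phi> p..\<phi> q})) borel (\<lambda>s. if s \<in> {\<phi> p..\<phi> q} then L s else 0)"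

lemma sets_m [simp, measurable_cong]: "sets (m p q) = sets borel"
  by (simp add: m_def)

lemma space_m [simp]: "space (m p q) = UNIV"
  by (simp add: m_def)

context
  fixes p q assumes p: "p \<in> B.I" and q: "q \<in> B.I" and pq: "p \<le> q"
begin

lemma segI: "{p..q} \<subseteq> B.I" "{\<phi> p..\<phi> q} \<subseteq> A.I"
  using B_segment[OF p q] A_segment[OF \<phi>_in_I[OF p] \<phi>_in_I[OF q]] by auto

lemma L_measurable: "(\<lambda>s. if s \<in> {\<phi> p..\<phi> q} then L s else 0) \<in> borel_measurable borel"
proof (rule measurable_restrict_space_iff[THEN iffD1])
  have "mono_on {\<phi> p..\<phi> q} L"
  proof (rule mono_onI)
    fix r s assume "r \<in> {\<phi> p..\<phi> q}" "s \<in> {\<phi> p..\<phi> q}" "r \<le> s"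
    moreover then have "r \<in> A.I" "s \<in> A.I"
      using subsetD[OF segI(2)] by blast+
    ultimately show "L r \<le> L s"
      using \<phi>_le_iff[OF L_in_I L_in_I, of r s] \<phi>_L[of r] \<phi>_L[of s] by simp
  qed
  then show "L \<in> borel_measurable (restrict_space borel {\<phi> p..\<phi> q})"
    by (rule borel_measurable_mono_on_fnc)
qed auto

lemma emeasure_m:
  assumes B: "B \<in> sets borel"
  shows "emeasure (m p q) B = emeasure lborel {s \<in> {\<phi> p..\<phi> q}. L s \<in> B}"
proof -
  let ?L = "\<lambda>s. if s \<in> {\<phi> p..\<phi> q} then L s else 0"
  have mL: "?L -` B \<in> sets lborel"
    using measurable_sets[OF L_measurable B] by simp
  have "emeasure (m p q) B = emeasure (density lborel (indicator {\<phi> p..\<phi> q})) (?L -` B)"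
    unfolding m_def using L_measurable B by (subst emeasure_distr) auto
  also have "\<dots> = emeasure lborel ({\<phi> p..\<phi> q} \<inter> ?L -` B)"
    by (rule emeasure_restricted) (use mL in simp_all)
  also have "{\<phi> p..\<phi> q} \<inter> ?L -` B = {s \<in> {\<phi> p..\<phi> q}. L s \<in> B}"
    by auto
  finally show ?thesis .
qed

lemma L_vimage:
  assumes uv: "u \<in> {p..q}" "v \<in> {p..q}"
  shows "{s \<in> {\<phi> p..\<phi> q}. L s \<in> {u..<v}} = {\<phi> u..<\<phi> v}"
    "{s \<in> {\<phi> p..\<phi> q}. L s \<in> {u..v}} = {\<phi> u..\<phi> v}"
    "{s \<in> {\<phi> p..\<phi> q}. L s \<in> {u<..<v}} = {\<phi> u<..<\<phi> v}"
proof -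
  have uI: "u \<in> B.I" "v \<in> B.I" using uv segI by auto
  have sub: "\<phi> p \<le> \<phi> u" "\<phi> v \<le> \<phi> q"
    using \<phi>_le_iff[OF p uI(1)] \<phi>_le_iff[OF uI(2) q] uv by auto
  have *: "u \<le> L s \<longleftrightarrow> \<phi> u \<le> s" "L s < v \<longleftrightarrow> s < \<phi> v" "L s \<le> v \<longleftrightarrow> s \<le> \<phi> v" "u < L s \<longleftrightarrow> \<phi> u < s"
    if s: "s \<in> {\<phi> p..\<phi> q}" for s
  proof -
    have sI: "s \<in> A.I" using s segI by auto
    show "u \<le> L s \<longleftrightarrow> \<phi> u \<le> s" "L s < v \<longleftrightarrow> s < \<phi> v" "L s \<le> v \<longleftrightarrow> s \<le> \<phi> v" "u < L s \<longleftrightarrow> \<phi> u < s"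
      using \<phi>_le_iff[OF uI(1) L_in_I[OF sI]] \<phi>_less_iff[OF L_in_I[OF sI] uI(2)]
        \<phi>_le_iff[OF L_in_I[OF sI] uI(2)] \<phi>_less_iff[OF uI(1) L_in_I[OF sI]] \<phi>_L[OF sI] by auto
  qed
  show "{s \<in> {\<phi> p..\<phi> q}. L s \<in> {u..<v}} = {\<phi> u..<\<phi> v}"
    "{s \<in> {\<phi> p..\<phi> q}. L s \<in> {u..v}} = {\<phi> u..\<phi> v}"
    "{s \<in> {\<phi> p..\<phi> q}. L s \<in> {u<..<v}} = {\<phi> u<..<\<phi> v}"
    using * sub by (auto 0 3 intro: order_trans)
qed

lemma emeasure_m_interval:
  assumes uv: "u \<in> {p..q}" "v \<in> {p..q}" "u \<le> v"
  shows "emeasure (m p q) {u..<v} = ennreal (\<phi> v - \<phi> u)"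
    "emeasure (m p q) {u..v} = ennreal (\<phi> v - \<phi> u)"
    "emeasure (m p q) {u<..<v} = ennreal (\<phi> v - \<phi> u)"
proof -
  have "\<phi> u \<le> \<phi> v"
    using \<phi>_le_iff[OF subsetD[OF segI(1) uv(1)] subsetD[OF segI(1) uv(2)]] uv(3) by simp
  then show "emeasure (m p q) {u..<v} = ennreal (\<phi> v - \<phi> u)"
    "emeasure (m p q) {u..v} = ennreal (\<phi> v - \<phi> u)"
    "emeasure (m p q) {u<..<v} = ennreal (\<phi> v - \<phi> u)"
    by (subst emeasure_m, simp, subst L_vimage[OF uv(1,2)], simp)+
qed

lemma nn_integral_m:
  assumes g: "g \<in> borel_measurable borel"
  shows "(\<integral>\<^sup>+x. g x \<partial>m p q) = (\<integral>\<^sup>+s\<in>{\<phi> p..\<phi> q}. g (L s) \<partial>lborel)"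
proof -
  let ?L = "\<lambda>s. if s \<in> {\<phi> p..\<phi> q} then L s else 0"
  have "(\<integral>\<^sup>+x. g x \<partial>m p q) = (\<integral>\<^sup>+s. g (?L s) \<partial>density lborel (indicator {\<phi> p..\<phi> q}))"
    unfolding m_def using L_measurable g by (subst nn_integral_distr) auto
  also have "\<dots> = (\<integral>\<^sup>+s. indicator {\<phi> p..\<phi> q} s * g (?L s) \<partial>lborel)"
    using measurable_compose[OF L_measurable g] by (subst nn_integral_density) auto
  also have "\<dots> = (\<integral>\<^sup>+s\<in>{\<phi> p..\<phi> q}. g (L s) \<partial>lborel)"
    by (intro nn_integral_cong) (auto simp: indicator_def)
  finally show ?thesis .
qed

end

end

context lifted_curve
begin

context
  fixes p q assumes p: "p \<in> B.I" and q: "q \<in> B.I" and pq: "p \<le> q"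
begin

lemma finite_measure_m: "finite_measure (m p q)"
proof (rule finite_measureI)
  have "emeasure (m p q) UNIV \<le> emeasure lborel {\<phi> p..\<phi> q}"
    by (subst emeasure_m[OF p q pq]) (auto intro: emeasure_mono)
  also have "\<dots> < \<infinity>" by (simp add: emeasure_lborel_Icc_eq)
  finally show "emeasure (m p q) (space (m p q)) \<noteq> \<infinity>" by simp
qed

text \<open>Only the points \<open>\<phi> p\<close> and \<open>\<phi> q\<close> lie over p and q, so
  the endpoints have no mass. The lemmas on subsets of open intervals thereby become
  applicable.\<close>

lemma emeasure_m_restrict:
  assumes B: "B \<in> sets borel"
  shows "emeasure (m p q) B = emeasure (m p q) (B \<inter> {p<..<q})"
proof -
  have "{s \<in> {\<phi> p..\<phi> q}. L s \<in> - {p<..<q}} \<subseteq> {\<phi> p, \<phi> q}"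
  proof
    fix s assume "s \<in> {s \<in> {\<phi> p..\<phi> q}. L s \<in> - {p<..<q}}"
    then have s: "s \<in> {\<phi> p..\<phi> q}" "L s \<notin> {p<..<q}" by auto
    then have sI: "s \<in> A.I" using subsetD[OF segI(2)[OF p q pq]] by blast
    have "p \<le> L s" "L s \<le> q"
      using \<phi>_le_iff[OF p L_in_I[OF sI]] \<phi>_le_iff[OF L_in_I[OF sI] q] \<phi>_L[OF sI] s(1) by auto
    then have "L s = p \<or> L s = q" using s(2) by auto
    then show "s \<in> {\<phi> p, \<phi> q}" using \<phi>_L[OF sI] by auto
  qed
  then have "emeasure lborel {s \<in> {\<phi> p..\<phi> q}. L s \<in> - {p<..<q}} \<le> emeasure lborel {\<phi> p, \<phi> q}"
    by (intro emeasure_mono) auto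
  also have "\<dots> = 0"
    by (intro emeasure_lborel_countable) auto
  finally have "- {p<..<q} \<in> null_sets (m p q)"
    using emeasure_m[OF p q pq, of "- {p<..<q}"] by (auto simp: null_sets_def)
  then have "emeasure (m p q) (B - - {p<..<q}) = emeasure (m p q) B"
    by (rule emeasure_Diff_null_set) (use B in auto)
  then show ?thesis
    by (simp add: Diff_eq)
qed

text \<open>Y will be the set of parameters at which the curve is in a given piece, and r the lower
  bound for the stretching there.\<close>

context
  fixes Y :: "real set" and r \<delta> :: real
  assumes cont: "continuous_on {p..q} \<phi>"
    and Y: "Y \<in> sets borel" "Y \<subseteq> {p..q}" and r: "r > 0" and \<delta>: "\<delta> > 0"
    and expand: "\<And>x y. x \<in> Y \<Longrightarrow> y \<in> {p..q} \<Longrightarrow> \<bar>\<phi> x - \<phi> y\<bar> < \<delta> \<Longrightarrow>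
      r * surf_dist (A.\<eta> (\<phi> x)) (A.\<eta> (\<phi> y)) \<le> \<bar>x - y\<bar>"
begin

text \<open>Compare the chords of a fine inscribed polygon with the parameter of the image curve when the
  corresponding arc meets \<open>Y\<close>, and with the length of the arc otherwise.\<close>

lemma measure_m_short:
  assumes u: "u \<in> {p..q}" and v: "v \<in> {p..q}" and uv: "u \<le> v" "\<phi> v - \<phi> u < \<delta>"
  shows "measure (m p q) ({u..<v} \<inter> Y) \<le> (v - u) / r"
proof (rule field_le_epsilon)
  fix e :: real assume e: "e > 0"
  interpret M: finite_measure "m p q" by (rule finite_measure_m)
  have uI: "u \<in> B.I" "v \<in> B.I" using u v segI(1)[OF p q pq] by auto
  have "\<phi> u \<le> \<phi> v" using \<phi>_le_iff[OF uI] uv by simp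
  from A.arc_param_chords[OF \<phi>_in_I[OF uI(1)] \<phi>_in_I[OF uI(2)] this e]
  obtain n \<sigma> where \<sigma>: "mono \<sigma>" "range \<sigma> \<subseteq> {\<phi> u..\<phi> v}" "\<sigma> 0 = \<phi> u" "\<sigma> n = \<phi> v"
    "\<phi> v - \<phi> u - e < chord_sum A.\<eta> n \<sigma>" by blast
  have \<sigma>b: "\<phi> u \<le> \<sigma> i" "\<sigma> i \<le> \<phi> v" for i
    using \<sigma>(2) by (auto simp: image_subset_iff)
  have \<sigma>I: "\<sigma> i \<in> A.I" for i
    using subsetD[OF A_segment[OF \<phi>_in_I[OF uI(1)] \<phi>_in_I[OF uI(2)]]] \<sigma>b[of i] by auto
  define x where "x i = L (\<sigma> i)" for i
  have xI: "x i \<in> B.I" and \<phi>x: "\<phi> (x i) = \<sigma> i" for i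
    unfolding x_def using L_in_I[OF \<sigma>I] \<phi>_L[OF \<sigma>I] by auto
  have x0: "x 0 = u" "x n = v"
    unfolding x_def \<sigma> using L_\<phi> uI by auto
  have xmono: "x i \<le> x j" if "i \<le> j" for i j
    using \<phi>_le_iff[OF xI xI, of i j] \<phi>x monoD[OF \<sigma>(1) that] by simp
  have xb: "u \<le> x i" "x i \<le> v" for i
    using \<phi>_le_iff[OF uI(1) xI] \<phi>_le_iff[OF xI uI(2)] \<phi>x \<sigma>b by auto
  have xpq: "x i \<in> {p..q}" for i
    using xb[of i] u v by auto
  have chord: "surf_dist (A.\<eta> (\<sigma> i)) (A.\<eta> (\<sigma> (Suc i))) \<le> (x (Suc i) - x i) / r + measure (m p q) ({x i..<x (Suc i)} - Y)" for i
  proof (cases "\<exists>y. y \<in> {x i..<x (Suc i)} \<inter> Y")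
    case True
    \<comment> \<open>The chord is split at y, a point of Y on the arc. The whole arc from
      \<open>\<phi> u\<close> to \<open>\<phi> v\<close> is shorter than \<delta>, so
      \<open>expand\<close> applies from y to both ends.\<close>
    then obtain y where y: "y \<in> Y" "x i \<le> y" "y < x (Suc i)" by auto
    have yI: "y \<in> B.I" using y(1) Y(2) segI(1)[OF p q pq] by auto
    have \<phi>y: "\<phi> u \<le> \<phi> y" "\<phi> y \<le> \<phi> v"
      using \<phi>_le_iff[OF uI(1) yI] \<phi>_le_iff[OF yI uI(2)] y xb[of i] xb[of "Suc i"] by auto
    have "r * surf_dist (A.\<eta> (\<phi> y)) (A.\<eta> (\<phi> (x j))) \<le> \<bar>y - x j\<bar>" for j
      using \<phi>y \<sigma>b[of j] uv(2) by (intro expand y xpq) (auto simp: \<phi>x abs_less_iff)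
    then have d: "surf_dist (A.\<eta> (\<phi> y)) (A.\<eta> (\<sigma> j)) \<le> \<bar>y - x j\<bar> / r" for j
      using r by (simp add: \<phi>x field_simps)
    have "surf_dist (A.\<eta> (\<sigma> i)) (A.\<eta> (\<sigma> (Suc i))) \<le>
        surf_dist (A.\<eta> (\<sigma> i)) (A.\<eta> (\<phi> y)) + surf_dist (A.\<eta> (\<phi> y)) (A.\<eta> (\<sigma> (Suc i)))"
      by (intro A.surf_dist_triangle A.arc_param_in_surf \<sigma>I \<phi>_in_I yI)
    also have "\<dots> \<le> \<bar>y - x i\<bar> / r + \<bar>y - x (Suc i)\<bar> / r"
      using d[of i] d[of "Suc i"] by (simp add: A.surf_dist_sym[of "A.\<eta> (\<sigma> i)"])
    also have "\<dots> = (x (Suc i) - x i) / r"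
      using y r by (simp add: field_simps)
    finally show ?thesis
      using measure_nonneg[of "m p q" "{x i..<x (Suc i)} - Y"] by linarith
  next
    case False
    then have "{x i..<x (Suc i)} - Y = {x i..<x (Suc i)}" by auto
    moreover have "measure (m p q) {x i..<x (Suc i)} = \<sigma> (Suc i) - \<sigma> i"
      using emeasure_m_interval(1)[OF p q pq xpq xpq xmono, of i "Suc i"] monoD[OF \<sigma>(1), of i "Suc i"]
      by (simp add: measure_def \<phi>x)
    moreover have "surf_dist (A.\<eta> (\<sigma> i)) (A.\<eta> (\<sigma> (Suc i))) \<le> \<bar>\<sigma> i - \<sigma> (Suc i)\<bar>"
      by (intro A.arc_param_dist \<sigma>I)
    moreover have "0 \<le> (x (Suc i) - x i) / r"
      using xmono[of i "Suc i"] r by simp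
    ultimately show ?thesis
      using monoD[OF \<sigma>(1), of i "Suc i"] by simp
  qed
  \<comment> \<open>Half-open arcs partition {u..<v}, so their masses outside Y add up
    exactly.\<close>
  have Msum: "(\<Sum>i<k. measure (m p q) ({x i..<x (Suc i)} - Y)) = measure (m p q) ({u..<x k} - Y)" for k
  proof (induction k)
    case 0
    then show ?case using x0 by simp
  next
    case (Suc k)
    have "measure (m p q) (({u..<x k} - Y) \<union> ({x k..<x (Suc k)} - Y))
        = measure (m p q) ({u..<x k} - Y) + measure (m p q) ({x k..<x (Suc k)} - Y)"
      using Y by (intro M.finite_measure_Union) auto
    also have "({u..<x k} - Y) \<union> ({x k..<x (Suc k)} - Y) = {u..<x (Suc k)} - Y"
      using xb[of k] xmono[of k "Suc k"] by auto
    finally show ?case using Suc by simp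
  qed
  have "chord_sum A.\<eta> n \<sigma> \<le> (\<Sum>i<n. (x (Suc i) - x i) / r + measure (m p q) ({x i..<x (Suc i)} - Y))"
    unfolding chord_sum_def by (intro sum_mono chord)
  also have "\<dots> = (v - u) / r + measure (m p q) ({u..<v} - Y)"
    by (simp add: sum.distrib Msum x0 sum_divide_distrib[symmetric] sum_lessThan_telescope)
  finally have 1: "\<phi> v - \<phi> u - e \<le> (v - u) / r + measure (m p q) ({u..<v} - Y)"
    using \<sigma>(5) by simp
  \<comment> \<open>Subtracting the mass outside Y from the total mass leaves the estimate for
    Y.\<close>
  have "measure (m p q) {u..<v} = \<phi> v - \<phi> u"
    using emeasure_m_interval(1)[OF p q pq u v uv(1)] \<open>\<phi> u \<le> \<phi> v\<close> by (simp add: measure_def)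
  moreover have "measure (m p q) (({u..<v} \<inter> Y) \<union> ({u..<v} - Y)) = measure (m p q) ({u..<v} \<inter> Y) + measure (m p q) ({u..<v} - Y)"
    using Y by (intro M.finite_measure_Union) auto
  moreover have "({u..<v} \<inter> Y) \<union> ({u..<v} - Y) = {u..<v}" by auto
  ultimately show "measure (m p q) ({u..<v} \<inter> Y) \<le> (v - u) / r + e"
    using 1 by simp
qed

text \<open>The estimate is additive under subdivision, and by continuity of \<phi> it holds on all
  sufficiently short intervals around any point; Bolzano's bisection principle combines the
  two.\<close>

lemma measure_m_interval_le:
  assumes u: "p \<le> u" "u \<le> v" "v \<le> q"
  shows "measure (m p q) ({u..<v} \<inter> Y) \<le> (v - u) / r"
proof -
  interpret M: finite_measure "m p q" by (rule finite_measure_m)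
  have "p \<le> u \<longrightarrow> v \<le> q \<longrightarrow> u \<le> v \<longrightarrow> measure (m p q) ({u..<v} \<inter> Y) \<le> (v - u) / r"
  proof (rule Bolzano[OF u(2), of "\<lambda>a b. p \<le> a \<longrightarrow> b \<le> q \<longrightarrow> a \<le> b \<longrightarrow> measure (m p q) ({a..<b} \<inter> Y) \<le> (b - a) / r"])
    fix a b c :: real
    assume 1: "p \<le> a \<longrightarrow> b \<le> q \<longrightarrow> a \<le> b \<longrightarrow> measure (m p q) ({a..<b} \<inter> Y) \<le> (b - a) / r"
      "p \<le> b \<longrightarrow> c \<le> q \<longrightarrow> b \<le> c \<longrightarrow> measure (m p q) ({b..<c} \<inter> Y) \<le> (c - b) / r"
      and abc: "a \<le> b" "b \<le> c"
    show "p \<le> a \<longrightarrow> c \<le> q \<longrightarrow> a \<le> c \<longrightarrow> measure (m p q) ({a..<c} \<inter> Y) \<le> (c - a) / r"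
    proof (intro impI)
      assume 2: "p \<le> a" "c \<le> q"
      have "measure (m p q) ({a..<b} \<inter> Y \<union> {b..<c} \<inter> Y) \<le> measure (m p q) ({a..<b} \<inter> Y) + measure (m p q) ({b..<c} \<inter> Y)"
        using Y by (intro measure_Un_le) auto
      also have "{a..<b} \<inter> Y \<union> {b..<c} \<inter> Y = {a..<c} \<inter> Y"
        using abc by auto
      also have "measure (m p q) ({a..<b} \<inter> Y) + measure (m p q) ({b..<c} \<inter> Y) \<le> (b - a) / r + (c - b) / r"
        using 1 2 abc by (intro add_mono) auto
      also have "\<dots> = (c - a) / r" by (simp add: add_divide_distrib[symmetric])
      finally show "measure (m p q) ({a..<c} \<inter> Y) \<le> (c - a) / r" .
    qed
  next
    fix x assume x: "u \<le> x" "x \<le> v"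
    then have "x \<in> {p..q}" using u by auto
    then obtain d where d: "d > 0" "\<And>y. y \<in> {p..q} \<Longrightarrow> dist y x < d \<Longrightarrow> dist (\<phi> y) (\<phi> x) < \<delta> / 2"
      using cont half_gt_zero[OF \<delta>] unfolding continuous_on_iff by blast
    show "\<exists>d>0. \<forall>a b. a \<le> x \<and> x \<le> b \<and> b - a < d \<longrightarrow> p \<le> a \<longrightarrow> b \<le> q \<longrightarrow> a \<le> b \<longrightarrow>
        measure (m p q) ({a..<b} \<inter> Y) \<le> (b - a) / r"
    proof (intro exI[of _ d] conjI allI impI)
      fix a b assume ab: "a \<le> x \<and> x \<le> b \<and> b - a < d" "p \<le> a" "b \<le> q" "a \<le> b"
      then have "a \<in> {p..q}" "b \<in> {p..q}" "dist a x < d" "dist b x < d"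
        by (auto simp: dist_real_def)
      then have "dist (\<phi> a) (\<phi> x) < \<delta> / 2" "dist (\<phi> b) (\<phi> x) < \<delta> / 2"
        using d(2) by auto
      then have "\<phi> b - \<phi> a < \<delta>"
        unfolding dist_real_def by linarith
      then show "measure (m p q) ({a..<b} \<inter> Y) \<le> (b - a) / r"
        using ab by (intro measure_m_short) auto
    qed (use d in auto)
  qed
  then show ?thesis using u by simp
qed

lemma emeasure_m_le:
  assumes B: "B \<in> sets borel" "B \<subseteq> Y"
  shows "emeasure (m p q) B \<le> ennreal (1 / r) * emeasure lborel B"
proof -
  interpret M: finite_measure "m p q" by (rule finite_measure_m)
  \<comment> \<open>Restricting the measure to Y turns the estimate for Y within intervals into one
    for intervals, as \<open>emeasure_le_of_intervals\<close> requires.\<close>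
  define N where "N = density (m p q) (indicator Y)"
  have N: "emeasure N S = emeasure (m p q) (S \<inter> Y)" if "S \<in> sets borel" for S
    unfolding N_def using emeasure_restricted[of Y "m p q" S] Y that by (simp add: Int_commute)
  have "emeasure N (B \<inter> {p<..<q}) \<le> ennreal (1 / r) * emeasure lborel (B \<inter> {p<..<q})"
  proof (rule emeasure_le_of_intervals[where p=p and q=q])
    fix u v assume uv: "p \<le> u" "u \<le> v" "v \<le> q"
    have "emeasure N {u<..<v} \<le> emeasure (m p q) ({u..<v} \<inter> Y)"
      unfolding N[OF borel_open[OF open_greaterThanLessThan]] using Y by (intro emeasure_mono) auto
    also have "\<dots> \<le> ennreal ((v - u) / r)"
      unfolding M.emeasure_eq_measure by (intro ennreal_leI measure_m_interval_le uv)
    finally show "emeasure N {u<..<v} \<le> ennreal (1 / r * (v - u))" by simp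
  qed (use B r pq in \<open>auto simp: N_def\<close>)
  also have "\<dots> \<le> ennreal (1 / r) * emeasure lborel B"
    using B by (intro mult_left_mono emeasure_mono) auto
  finally have "emeasure N (B \<inter> {p<..<q}) \<le> ennreal (1 / r) * emeasure lborel B" .
  moreover have "B \<inter> {p<..<q} \<inter> Y = B \<inter> {p<..<q}"
    using B by auto
  ultimately show ?thesis
    using emeasure_m_restrict[OF B(1)] N[of "B \<inter> {p<..<q}"] B(1) by simp
qed

end

text \<open>Absolute continuity of \<phi> enters here: where the image curve spends no length, the
  lift spends none either.\<close>

lemma emeasure_m_null:
  assumes AC: "abs_continuous_on_interval \<phi> p q"
    and B: "B \<in> sets borel" "emeasure lborel B = 0"
  shows "emeasure (m p q) B = 0"
proof -
  have "emeasure (m p q) (B \<inter> {p<..<q}) = 0"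
  proof (rule abs_continuous_null[OF _ AC])
    fix u v assume uv: "p \<le> u" "u \<le> v" "v \<le> q"
    show "emeasure (m p q) {u<..<v} \<le> ennreal \<bar>\<phi> v - \<phi> u\<bar>"
      using emeasure_m_interval(3)[OF p q pq, of u v] uv by (simp add: ennreal_leI)
  next
    have "emeasure lborel (B \<inter> {p<..<q}) \<le> emeasure lborel B"
      using B by (intro emeasure_mono) auto
    then show "emeasure lborel (B \<inter> {p<..<q}) = 0" using B by simp
  qed (use B pq in auto)
  then show ?thesis using emeasure_m_restrict[OF B(1)] by simp
qed

end

end

lemma nn_integral_le_of_emeasure_le:
  assumes sets: "sets M = sets N" and Y: "Y \<in> sets M"
    and le: "\<And>B. B \<in> sets M \<Longrightarrow> B \<subseteq> Y \<Longrightarrow> emeasure M B \<le> c * emeasure N B"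
    and g: "g \<in> borel_measurable M"
  shows "(\<integral>\<^sup>+x\<in>Y. g x \<partial>M) \<le> c * (\<integral>\<^sup>+x\<in>Y. g x \<partial>N)"
proof -
  have gN: "g \<in> borel_measurable N"
    using g sets measurable_cong_sets[OF sets refl, of borel] by simp
  have YN: "Y \<in> sets N" using Y sets by simp
  have "density M (indicator Y) \<le> scale_measure c (density N (indicator Y))"
  proof (subst le_measure)
    show "\<forall>A\<in>sets (density M (indicator Y)). emeasure (density M (indicator Y)) A \<le> emeasure (scale_measure c (density N (indicator Y))) A"
    proof
      fix A assume "A \<in> sets (density M (indicator Y))"
      then have A: "A \<in> sets M" by simp
      then have "emeasure (density M (indicator Y)) A \<le> c * emeasure N (A \<inter> Y)"
        unfolding emeasure_restricted[OF Y A] Int_commute[of Y] by (intro le) (use A Y in auto)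
      then show "emeasure (density M (indicator Y)) A \<le> emeasure (scale_measure c (density N (indicator Y))) A"
        using emeasure_restricted[OF YN, of A] A sets by (simp add: Int_commute)
    qed
  qed (simp add: sets)
  then have "nn_integral (density M (indicator Y)) g \<le> nn_integral (scale_measure c (density N (indicator Y))) g"
    by (intro nn_integral_mono_measure) (auto simp: sets)
  also have "\<dots> = c * nn_integral (density N (indicator Y)) g"
    using gN by (intro nn_integral_scale_measure) simp
  finally show ?thesis
    using g gN Y YN by (simp add: nn_integral_density mult.commute)
qed

lemma ennreal_le_suminf:
  fixes f :: "nat \<Rightarrow> ennreal"
  shows "f k \<le> (\<Sum>i. f i)"
  using sum_le_suminf[of f "{k}"] by simp

context lifted_curve
begin

text \<open>While the curve is in \<open>C k\<close>, the length element of \<gamma> is at most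
  1/\<open>r k\<close> times that of f \<circ> \<gamma>, and \<rho>/\<open>r k\<close> is at most
  \<rho>' at the image. At all other parameters the image lies in Z, where \<rho>' is infinite:
  either the right-hand side is infinite, or these parameters form a null set for both
  lengths.\<close>

lemma line_integral_le:
  assumes AC: "\<And>u v. u \<le> v \<Longrightarrow> {u..v} \<subseteq> B.I \<Longrightarrow> abs_continuous_on_interval \<phi> u v"
    and \<rho>: "\<rho> \<in> surf_borel G \<rightarrow>\<^sub>M borel" and \<rho>': "\<rho>' \<in> surf_borel H \<rightarrow>\<^sub>M borel"
    and C: "\<And>k::nat. C k \<in> sets (surf_borel G)" "disjoint_family C"
    and r: "\<And>k. r k > 0" and \<delta>: "\<And>k. \<delta> k > (0::real)"
    and expand: "\<And>k t u. t \<in> \<Delta> \<Longrightarrow> u \<in> \<Delta> \<Longrightarrow> \<gamma> t \<in> C k \<Longrightarrow> surf_dist (\<gamma> t) (\<gamma> u) < \<delta> k \<Longrightarrow>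
      r k * surf_dist (\<gamma> t) (\<gamma> u) \<le> surf_dist (f (\<gamma> t)) (f (\<gamma> u))"
    and le: "\<And>k t. t \<in> \<Delta> \<Longrightarrow> \<gamma> t \<in> C k \<Longrightarrow> ennreal (1 / r k) * \<rho> (\<gamma> t) \<le> \<rho>' (f (\<gamma> t))"
    and Z: "Z \<in> sets (surf_borel H)" "\<And>t. t \<in> \<Delta> \<Longrightarrow> (\<forall>k. \<gamma> t \<notin> C k) \<Longrightarrow> f (\<gamma> t) \<in> Z"
      "\<And>x. x \<in> Z \<Longrightarrow> \<rho>' x = \<infinity>"
  shows "line_integral (\<Delta>, \<gamma>) \<rho> \<le> line_integral (image_curve f (\<Delta>, \<gamma>)) \<rho>'"
proof -
  have IA: "A.I \<in> sets borel" and IB: "B.I \<in> sets borel"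
    by (intro real_interval_borel_measurable A.I_interval B.I_interval)+
  have mA: "A.\<eta> \<in> restrict_space borel A.I \<rightarrow>\<^sub>M surf_borel G"
    and mB: "B.\<eta> \<in> restrict_space borel B.I \<rightarrow>\<^sub>M surf_borel H"
    by (intro measurable_surf_borel_continuous A.arc_param_continuous B.arc_param_continuous IA IB)+
  define R where "R = (\<integral>\<^sup>+x\<in>B.I. \<rho>' (B.\<eta> x) \<partial>lborel)"
  have gA: "(\<lambda>x. \<rho> (A.\<eta> x) * indicator A.I x) \<in> borel_measurable lborel"
    using borel_measurable_restrict_space_iff_ennreal[of A.I borel "\<lambda>x. \<rho> (A.\<eta> x)"] IA
      measurable_compose[OF mA \<rho>] by simp
  have gB: "(\<lambda>x. \<rho>' (B.\<eta> x) * indicator B.I x) \<in> borel_measurable lborel"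
    using borel_measurable_restrict_space_iff_ennreal[of B.I borel "\<lambda>x. \<rho>' (B.\<eta> x)"] IB
      measurable_compose[OF mB \<rho>'] by simp
  have "(\<integral>\<^sup>+s\<in>A.I. \<rho> (A.\<eta> s) \<partial>lborel) \<le> R"
  proof (rule set_nn_integral_le_on_interval[OF A.I_interval gA])
    fix p' q' assume pq': "p' \<in> A.I" "q' \<in> A.I" "p' \<le> q'"
    define p where "p = L p'"
    define q where "q = L q'"
    have p: "p \<in> B.I" "q \<in> B.I" and \<phi>p: "\<phi> p = p'" "\<phi> q = q'"
      unfolding p_def q_def using L_in_I pq' \<phi>_L by auto
    have pq: "p \<le> q" using \<phi>_le_iff[OF p] \<phi>p pq' by simp
    note pqs = p pq
    define J where "J = {p..q}"
    have JI: "J \<subseteq> B.I" "J \<in> sets borel" unfolding J_def using segI(1)[OF pqs] by auto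
    have ACpq: "abs_continuous_on_interval \<phi> p q"
      using AC[OF pq] segI(1)[OF pqs] by simp
    have cont: "continuous_on {p..q} \<phi>"
      by (rule abs_continuous_imp_continuous_on[OF ACpq])
    \<comment> \<open>The curve \<gamma> as a function of the arc length of f \<circ>
      \<gamma>.\<close>
    define e where "e x = A.\<eta> (\<phi> x)" for x
    have e_im: "e x \<in> \<gamma> ` \<Delta>" if "x \<in> J" for x
      unfolding e_def using arc_param_image \<phi>_in_I JI that by blast
    have fe: "f (e x) = B.\<eta> x" if "x \<in> J" for x
      unfolding e_def using f_arc_param JI that by blast
    have "continuous_map (top_of_set J) (surf_topology G) e"
    proof (rule A.continuous_map_surfI)
      show "e ` J \<subseteq> surf G"
        unfolding e_def using A.arc_param_in_surf \<phi>_in_I JI(1) by blast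
      fix t \<epsilon> :: real assume t: "t \<in> J" and "\<epsilon> > 0"
      then obtain d where d: "d > 0" "\<And>u. u \<in> J \<Longrightarrow> dist u t < d \<Longrightarrow> dist (\<phi> u) (\<phi> t) < \<epsilon>"
        using cont unfolding continuous_on_iff J_def by blast
      have "surf_dist (e t) (e u) < \<epsilon>" if "u \<in> J" "dist u t < d" for u
      proof -
        have "surf_dist (e t) (e u) \<le> \<bar>\<phi> t - \<phi> u\<bar>"
          unfolding e_def using t that JI by (intro A.arc_param_dist \<phi>_in_I) auto
        also have "\<dots> < \<epsilon>" using d(2)[OF that] by (simp add: dist_real_def abs_minus_commute)
        finally show ?thesis .
      qed
      then show "\<exists>d>0. \<forall>u\<in>J. dist u t < d \<longrightarrow> surf_dist (e t) (e u) < \<epsilon>"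
        using d(1) by blast
    qed
    then have me: "e \<in> restrict_space borel J \<rightarrow>\<^sub>M surf_borel G"
      by (rule measurable_surf_borel_continuous[OF _ JI(2)])
    have mBJ: "B.\<eta> \<in> restrict_space borel J \<rightarrow>\<^sub>M surf_borel H"
      using continuous_map_from_subtopology_mono[OF B.arc_param_continuous JI(1)]
      by (rule measurable_surf_borel_continuous[OF _ JI(2)])
    define g where "g x = \<rho> (e x) * indicator J x" for x
    have g: "g \<in> borel_measurable borel"
      unfolding g_def using borel_measurable_restrict_space_iff_ennreal[of J borel "\<lambda>x. \<rho> (e x)"] JI(2)
        measurable_compose[OF me \<rho>] by simp
    have gm: "(\<lambda>x. g x * indicator S x) \<in> borel_measurable M" if "sets M = sets borel" "S \<in> sets borel" for S M
      unfolding measurable_cong_sets[OF that(1) refl]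
      by (rule borel_measurable_times_ennreal[OF g borel_measurable_indicator[OF that(2)]])
    define Y where "Y k = {x \<in> J. e x \<in> C k}" for k
    define N where "N = {x \<in> J. B.\<eta> x \<in> Z}"
    have pre: "{x \<in> J. h x \<in> S} \<in> sets borel" if "h \<in> restrict_space borel J \<rightarrow>\<^sub>M K" "S \<in> sets K" for h S and K :: "complex set measure"
    proof -
      have "h -` S \<inter> space (restrict_space borel J) \<in> sets (restrict_space borel J)"
        by (rule measurable_sets[OF that])
      then have "h -` S \<inter> space (restrict_space borel J) \<in> sets borel"
        using JI(2) by (simp add: sets_restrict_space_iff)
      also have "h -` S \<inter> space (restrict_space borel J) = {x \<in> J. h x \<in> S}"
        by (auto simp: space_restrict_space)
      finally show ?thesis .
    qed
    have Y: "Y k \<in> sets borel" "Y k \<subseteq> J" for k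
      unfolding Y_def using pre[OF me C(1)] by auto
    have N: "N \<in> sets borel"
      unfolding N_def by (rule pre[OF mBJ Z(1)])
    show "(\<integral>\<^sup>+s\<in>{p'..q'}. \<rho> (A.\<eta> s) \<partial>lborel) \<le> R"
    proof (cases "R = \<infinity>")
      case True
      then show ?thesis by simp
    next
      case False
      \<comment> \<open>Positive length in Z would make R infinite, contrary to the present
        case.\<close>
      have N0: "emeasure lborel N = 0"
      proof (rule ccontr)
        assume "emeasure lborel N \<noteq> 0"
        then have "\<infinity> = \<infinity> * emeasure lborel N"
          by (simp add: ennreal_top_mult)
        also have "\<dots> = (\<integral>\<^sup>+x. \<infinity> * indicator N x \<partial>lborel)"
          by (rule nn_integral_cmult_indicator[symmetric]) (use N in simp)
        also have "\<dots> \<le> R"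
          unfolding R_def using JI(1) Z(3) by (intro nn_integral_mono) (auto simp: indicator_def N_def)
        finally show False using False by (simp add: top_unique)
      qed
      have mN: "N \<in> null_sets (m p q)"
        using emeasure_m_null[OF pqs ACpq N N0] N by (simp add: null_sets_def)
      have "(\<integral>\<^sup>+s\<in>{p'..q'}. \<rho> (A.\<eta> s) \<partial>lborel) = (\<integral>\<^sup>+s\<in>{\<phi> p..\<phi> q}. g (L s) \<partial>lborel)"
      proof (rule nn_integral_cong)
        fix s
        show "\<rho> (A.\<eta> s) * indicator {p'..q'} s = g (L s) * indicator {\<phi> p..\<phi> q} s"
        proof (cases "s \<in> {\<phi> p..\<phi> q}")
          case True
          then have sI: "s \<in> A.I" using subsetD[OF segI(2)[OF pqs]] by blast
          then have "L s \<in> J"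
            using \<phi>_le_iff[OF p(1) L_in_I[OF sI]] \<phi>_le_iff[OF L_in_I[OF sI] p(2)] True \<phi>_L[OF sI]
            by (simp add: J_def)
          then show ?thesis using True \<phi>_L[OF sI] by (simp add: g_def e_def \<phi>p)
        next
          case False
          then show ?thesis by (simp add: \<phi>p)
        qed
      qed
      also have "\<dots> = (\<integral>\<^sup>+x. g x \<partial>m p q)"
        by (rule nn_integral_m[OF pqs g, symmetric])
      also have "\<dots> \<le> (\<integral>\<^sup>+x. (\<Sum>k. g x * indicator (Y k) x) + g x * indicator N x \<partial>m p q)"
      proof (rule nn_integral_mono)
        fix x
        show "g x \<le> (\<Sum>k. g x * indicator (Y k) x) + g x * indicator N x"
        proof (cases "x \<in> J")
          case True
          obtain t where t: "t \<in> \<Delta>" "e x = \<gamma> t" using e_im[OF True] by auto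
          show ?thesis
          proof (cases "\<exists>k. e x \<in> C k")
            case ex: True
            then obtain k where "x \<in> Y k" using True by (auto simp: Y_def)
            then have "g x = g x * indicator (Y k) x" by simp
            also have "\<dots> \<le> (\<Sum>k. g x * indicator (Y k) x)" by (rule ennreal_le_suminf)
            finally show ?thesis by (rule add_increasing2[OF zero_le])
          next
            case False
            then have "x \<in> N" using Z(2)[OF t(1)] t True fe[OF True] by (simp add: N_def)
            then show ?thesis by (simp add: add_increasing)
          qed
        qed (simp add: g_def)
      qed
      also have "\<dots> = (\<integral>\<^sup>+x. (\<Sum>k. g x * indicator (Y k) x) \<partial>m p q) + (\<integral>\<^sup>+x\<in>N. g x \<partial>m p q)"
        using N Y(1) by (intro nn_integral_add borel_measurable_suminf_order gm) auto
      also have "(\<integral>\<^sup>+x\<in>N. g x \<partial>m p q) = 0"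
        by (rule nn_integral_null_set[OF mN])
      also have "(\<integral>\<^sup>+x. (\<Sum>k. g x * indicator (Y k) x) \<partial>m p q) = (\<Sum>k. \<integral>\<^sup>+x\<in>Y k. g x \<partial>m p q)"
        using Y(1) by (intro nn_integral_suminf gm) auto
      also have "\<dots> \<le> (\<Sum>k. \<integral>\<^sup>+x\<in>Y k. \<rho>' (B.\<eta> x) \<partial>lborel)"
      proof (rule suminf_le)
        fix k
        have "(\<integral>\<^sup>+x\<in>Y k. g x \<partial>m p q) \<le> ennreal (1 / r k) * (\<integral>\<^sup>+x\<in>Y k. g x \<partial>lborel)"
        proof (rule nn_integral_le_of_emeasure_le)
          fix B assume B: "B \<in> sets (m p q)" "B \<subseteq> Y k"
          show "emeasure (m p q) B \<le> ennreal (1 / r k) * emeasure lborel B"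
          proof (rule emeasure_m_le[OF pqs cont Y(1) Y(2)[unfolded J_def] r \<delta>[of k] _ _ B(2)])
            fix x y assume x: "x \<in> Y k" and y: "y \<in> {p..q}" and d: "\<bar>\<phi> x - \<phi> y\<bar> < \<delta> k"
            have xy: "x \<in> J" "y \<in> J" using x y by (auto simp: Y_def J_def)
            obtain t u where t: "t \<in> \<Delta>" "e x = \<gamma> t" and u: "u \<in> \<Delta>" "e y = \<gamma> u"
              using e_im[OF xy(1)] e_im[OF xy(2)] by auto
            have "surf_dist (e x) (e y) \<le> \<bar>\<phi> x - \<phi> y\<bar>"
              unfolding e_def using xy JI by (intro A.arc_param_dist \<phi>_in_I) auto
            then have "r k * surf_dist (e x) (e y) \<le> surf_dist (f (e x)) (f (e y))"
              using expand[OF t(1) u(1), of k] x d t u by (simp add: Y_def)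
            also have "\<dots> \<le> \<bar>x - y\<bar>"
              unfolding fe[OF xy(1)] fe[OF xy(2)] using xy JI by (intro B.arc_param_dist) auto
            finally show "r k * surf_dist (A.\<eta> (\<phi> x)) (A.\<eta> (\<phi> y)) \<le> \<bar>x - y\<bar>"
              by (simp add: e_def)
          qed (use B in simp)
        qed (use Y g in \<open>simp_all add: sets_m cong: measurable_cong_sets\<close>)
        also have "\<dots> = (\<integral>\<^sup>+x. ennreal (1 / r k) * (g x * indicator (Y k) x) \<partial>lborel)"
          using Y(1) by (intro nn_integral_cmult[symmetric] gm) auto
        also have "\<dots> \<le> (\<integral>\<^sup>+x\<in>Y k. \<rho>' (B.\<eta> x) \<partial>lborel)"
        proof (rule nn_integral_mono)
          fix x
          show "ennreal (1 / r k) * (g x * indicator (Y k) x) \<le> \<rho>' (B.\<eta> x) * indicator (Y k) x"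
          proof (cases "x \<in> Y k")
            case True
            then have x: "x \<in> J" "e x \<in> C k" by (auto simp: Y_def)
            then obtain t where t: "t \<in> \<Delta>" "e x = \<gamma> t" using e_im[OF x(1)] by auto
            show ?thesis using le[OF t(1), of k] t x True fe[OF x(1)] by (simp add: g_def)
          qed simp
        qed
        finally show "(\<integral>\<^sup>+x\<in>Y k. g x \<partial>m p q) \<le> (\<integral>\<^sup>+x\<in>Y k. \<rho>' (B.\<eta> x) \<partial>lborel)" .
      qed auto
      also have "\<dots> = (\<Sum>k. \<integral>\<^sup>+x. (\<rho>' (B.\<eta> x) * indicator B.I x) * indicator (Y k) x \<partial>lborel)"
        using Y(2) JI(1) by (intro suminf_cong nn_integral_cong) (auto simp: indicator_def)
      also have "\<dots> = (\<integral>\<^sup>+x. (\<Sum>k. (\<rho>' (B.\<eta> x) * indicator B.I x) * indicator (Y k) x) \<partial>lborel)"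
        by (intro nn_integral_suminf[symmetric] borel_measurable_times_ennreal[OF gB] borel_measurable_indicator)
           (use Y(1) in simp)
      also have "\<dots> = (\<integral>\<^sup>+x. (\<rho>' (B.\<eta> x) * indicator B.I x) * (\<Sum>k. indicator (Y k) x) \<partial>lborel)"
        by simp
      \<comment> \<open>Since the sets \<open>C k\<close> are disjoint, no part of the image curve
        is counted twice.\<close>
      also have "\<dots> = (\<integral>\<^sup>+x. (\<rho>' (B.\<eta> x) * indicator B.I x) * indicator (\<Union>k. Y k) x \<partial>lborel)"
      proof -
        have "disjoint_family Y"
          using C(2) unfolding disjoint_family_on_def Y_def by blast
        then show ?thesis by (simp add: suminf_indicator)
      qed
      also have "\<dots> \<le> R"
        unfolding R_def by (intro nn_integral_mono) (auto simp: indicator_def)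
      finally show ?thesis by simp
    qed
  qed
  then show ?thesis
    by (simp add: R_def line_integral_def image_curve_def)
qed

end

subsection \<open>Images of plane sets under differentiable maps\<close>

text \<open>Jacobian determinants and the measure estimates for differentiable images are formulated
  on real^n, so the plane is identified with \<open>real ^ 2\<close>.\<close>

definition vec_of_complex :: "complex \<Rightarrow> real ^ 2" where
  "vec_of_complex z = vector [Re z, Im z]"

definition complex_of_vec :: "real ^ 2 \<Rightarrow> complex" where
  "complex_of_vec v = Complex (v $ 1) (v $ 2)"

lemma complex_of_vec_inverse [simp]: "complex_of_vec (vec_of_complex z) = z"
  by (simp add: complex_of_vec_def vec_of_complex_def)

lemma vec_of_complex_inverse [simp]: "vec_of_complex (complex_of_vec v) = v"
  by (simp add: complex_of_vec_def vec_of_complex_def vec_eq_iff forall_2)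

lemma bounded_linear_vec_of_complex: "bounded_linear vec_of_complex"
  unfolding linear_conv_bounded_linear[symmetric]
  by (intro linearI) (simp_all add: vec_of_complex_def vec_eq_iff forall_2)

lemma bounded_linear_complex_of_vec: "bounded_linear complex_of_vec"
  unfolding linear_conv_bounded_linear[symmetric]
  by (intro linearI) (simp_all add: complex_of_vec_def complex_eq_iff)

lemma vec_of_complex_measurable [measurable]: "vec_of_complex \<in> borel_measurable borel"
  by (intro borel_measurable_continuous_onI linear_continuous_on bounded_linear_vec_of_complex)

lemma complex_of_vec_measurable [measurable]: "complex_of_vec \<in> borel_measurable borel"
  by (intro borel_measurable_continuous_onI linear_continuous_on bounded_linear_complex_of_vec)

lemma Basis_vec_2: "(Basis :: (real ^ 2) set) = {axis 1 1, axis 2 1}"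
  by (auto simp: Basis_vec_def exhaust_2 UNIV_2)

lemma axis_12_neq: "axis 1 (1::real) \<noteq> (axis 2 1 :: real ^ 2)"
  by (simp add: axis_eq_axis)

text \<open>Boxes correspond to boxes with the same side lengths, and this determines Lebesgue
  measure.\<close>

lemma distr_vec_of_complex: "distr lborel borel vec_of_complex = lborel"
proof (rule lborel_eqI[symmetric])
  fix l u :: "real ^ 2"
  assume lu: "\<And>b. b \<in> Basis \<Longrightarrow> l \<bullet> b \<le> u \<bullet> b"
  have le: "l $ 1 \<le> u $ 1" "l $ 2 \<le> u $ 2"
    using lu[of "axis 1 1"] lu[of "axis 2 1"] by (simp_all add: Basis_vec_2 inner_axis)
  have "vec_of_complex -` box l u = box (complex_of_vec l) (complex_of_vec u)"
    by (auto simp: box_def Basis_vec_2 Basis_complex_def inner_axis vec_of_complex_def complex_of_vec_def)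
  then have "emeasure (distr lborel borel vec_of_complex) (box l u) = emeasure lborel (box (complex_of_vec l) (complex_of_vec u))"
    by (simp add: emeasure_distr)
  also have "\<dots> = ennreal (\<Prod>b\<in>Basis. (complex_of_vec u - complex_of_vec l) \<bullet> b)"
    by (rule emeasure_lborel_box) (use le in \<open>auto simp: Basis_complex_def complex_of_vec_def\<close>)
  also have "(\<Prod>b\<in>Basis. (complex_of_vec u - complex_of_vec l) \<bullet> b) = (\<Prod>b\<in>Basis. (u - l) \<bullet> b)"
    by (simp add: Basis_vec_2 Basis_complex_def inner_axis complex_of_vec_def axis_12_neq)
  finally show "emeasure (distr lborel borel vec_of_complex) (box l u) = (\<Prod>b\<in>Basis. (u - l) \<bullet> b)" .
qed simp

lemma vec_image_eq: "vec_of_complex ` S = complex_of_vec -` S"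
  by (auto simp: image_iff) (metis vec_of_complex_inverse)

lemma vec_image_borel: "S \<in> sets borel \<Longrightarrow> vec_of_complex ` S \<in> sets borel"
  unfolding vec_image_eq using measurable_sets[OF complex_of_vec_measurable, of S] by simp

lemma emeasure_vec_image:
  assumes S: "S \<in> sets borel"
  shows "emeasure lborel (vec_of_complex ` S) = emeasure lborel S"
proof -
  have "emeasure lborel (vec_of_complex ` S) = emeasure (distr lborel borel vec_of_complex) (vec_of_complex ` S)"
    by (simp add: distr_vec_of_complex)
  also have "\<dots> = emeasure lborel (vec_of_complex -` (vec_of_complex ` S))"
    using vec_image_borel[OF S] by (simp add: emeasure_distr)
  also have "vec_of_complex -` (vec_of_complex ` S) = S"
    by (auto simp: image_iff) (metis complex_of_vec_inverse)
  finally show ?thesis .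
qed

lemma null_vec_image:
  assumes "vec_of_complex ` S \<in> null_sets lebesgue"
  shows "S \<in> null_sets lebesgue"
proof -
  obtain N where N: "N \<in> null_sets lborel" "vec_of_complex ` S \<subseteq> N"
    using assms by (auto simp: null_sets_completion_iff2)
  have "N \<in> sets borel" "emeasure lborel N = 0"
    using N(1) by auto
  moreover have "vec_of_complex ` (vec_of_complex -` N) = N"
    by (auto simp: image_iff) (metis vec_of_complex_inverse)
  moreover have "vec_of_complex -` N \<in> sets borel"
    using measurable_sets[OF vec_of_complex_measurable \<open>N \<in> sets borel\<close>] by simp
  ultimately have "vec_of_complex -` N \<in> null_sets lborel"
    using emeasure_vec_image[of "vec_of_complex -` N"] by (auto simp: null_sets_def)
  then show ?thesis
    using N(2) by (auto simp: null_sets_completion_iff2 image_subset_iff_subset_vimage)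
qed

text \<open>The general real-linear map of the plane; for a differential, a and b are the Wirtinger
  derivatives.\<close>

definition real_linear :: "complex \<Rightarrow> complex \<Rightarrow> complex \<Rightarrow> complex" where
  "real_linear a b v = a * v + b * cnj v"

lemma det_real_linear:
  "det (matrix (vec_of_complex \<circ> real_linear a b \<circ> complex_of_vec)) = (cmod a)\<^sup>2 - (cmod b)\<^sup>2"
  unfolding det_2 matrix_def cmod_power2
  by (simp add: vec_of_complex_def complex_of_vec_def real_linear_def axis_def)
     (simp add: power2_eq_square algebra_simps)

text \<open>The measure of an image is at most the integral of the absolute Jacobian. This
  inequality holds for pointwise differentiable maps, injective or not, and the Jacobian is
  integrable because it is measurable and bounded by B.\<close>

lemma differentiable_image_vec:
  fixes f :: "complex \<Rightarrow> complex"
  assumes S: "S \<in> sets borel" "bounded S"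
    and deriv: "\<And>z. z \<in> S \<Longrightarrow> (f has_derivative real_linear (a z) (b z)) (at z)"
    and B: "\<And>z. z \<in> S \<Longrightarrow> \<bar>(cmod (a z))\<^sup>2 - (cmod (b z))\<^sup>2\<bar> \<le> B"
  shows "vec_of_complex ` f ` S \<in> lmeasurable"
    "measure lebesgue (vec_of_complex ` f ` S) \<le> B * measure lebesgue (vec_of_complex ` S)"
proof -
  define g where "g = vec_of_complex \<circ> f \<circ> complex_of_vec"
  define g' where "g' x = vec_of_complex \<circ> real_linear (a (complex_of_vec x)) (b (complex_of_vec x)) \<circ> complex_of_vec" for x
  have img: "g ` (vec_of_complex ` S) = vec_of_complex ` f ` S"
    by (simp add: g_def image_comp comp_def)
  have bS: "bounded (vec_of_complex ` S)"
    using S(2) bounded_linear_vec_of_complex by (rule bounded_linear_image)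
  have lS: "vec_of_complex ` S \<in> sets lebesgue"
    using vec_image_borel[OF S(1)] by simp
  have mS: "vec_of_complex ` S \<in> lmeasurable"
    using bS lS by (rule bounded_set_imp_lmeasurable)
  have g': "(g has_derivative g' x) (at x within vec_of_complex ` S)" if x: "x \<in> vec_of_complex ` S" for x
  proof -
    obtain z where z: "z \<in> S" "x = vec_of_complex z"
      using x by auto
    have 1: "(complex_of_vec has_derivative complex_of_vec) (at x)"
      by (rule bounded_linear_imp_has_derivative[OF bounded_linear_complex_of_vec])
    have 2: "(f has_derivative real_linear (a z) (b z)) (at (complex_of_vec x))"
      using deriv[OF z(1)] z(2) by simp
    have 3: "(vec_of_complex has_derivative vec_of_complex) (at (f (complex_of_vec x)))"
      by (rule bounded_linear_imp_has_derivative[OF bounded_linear_vec_of_complex])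
    have "(g has_derivative (vec_of_complex \<circ> (real_linear (a z) (b z) \<circ> complex_of_vec))) (at x)"
      unfolding g_def comp_assoc using diff_chain_at[OF diff_chain_at[OF 1 2], of vec_of_complex vec_of_complex] 3 by simp
    then show ?thesis
      using z by (auto simp: g'_def comp_assoc intro: has_derivative_at_withinI)
  qed
  have det: "det (matrix (g' x)) = (cmod (a (complex_of_vec x)))\<^sup>2 - (cmod (b (complex_of_vec x)))\<^sup>2" for x
    unfolding g'_def by (rule det_real_linear)
  have bd: "\<bar>det (matrix (g' x))\<bar> \<le> B" if "x \<in> vec_of_complex ` S" for x
    using that B by (auto simp: det)
  have int: "(\<lambda>x. \<bar>det (matrix (g' x))\<bar>) integrable_on vec_of_complex ` S"
  proof (rule measurable_bounded_by_integrable_imp_integrable)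
    have "(\<lambda>x. det (matrix (g' x))) \<in> borel_measurable (lebesgue_on (vec_of_complex ` S))"
      using lS g' by (intro borel_measurable_det_Jacobian)
    then show "(\<lambda>x. \<bar>det (matrix (g' x))\<bar>) \<in> borel_measurable (lebesgue_on (vec_of_complex ` S))"
      by measurable
    show "(\<lambda>x. B) integrable_on vec_of_complex ` S"
      using mS integrable_on_const by blast
  qed (use bd lS in auto)
  show "vec_of_complex ` f ` S \<in> lmeasurable"
    using measurable_bounded_differentiable_image[OF mS g' int bd] img by simp
  show "measure lebesgue (vec_of_complex ` f ` S) \<le> B * measure lebesgue (vec_of_complex ` S)"
    using measure_bounded_differentiable_image[OF mS g' int bd] img by simp
qed

lemma emeasure_differentiable_image_le:
  fixes f :: "complex \<Rightarrow> complex"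
  assumes S: "S \<in> sets borel" "bounded S"
    and deriv: "\<And>z. z \<in> S \<Longrightarrow> (f has_derivative real_linear (a z) (b z)) (at z)"
    and B: "\<And>z. z \<in> S \<Longrightarrow> \<bar>(cmod (a z))\<^sup>2 - (cmod (b z))\<^sup>2\<bar> \<le> B"
    and "0 \<le> B" and fS: "f ` S \<in> sets borel"
  shows "emeasure lborel (f ` S) \<le> ennreal B * emeasure lborel S"
proof -
  note vec = differentiable_image_vec[OF S deriv B]
  have "emeasure lborel S = emeasure lebesgue (vec_of_complex ` S)"
    using emeasure_vec_image[OF S(1)] vec_image_borel[OF S(1)] by simp
  also have "\<dots> = ennreal (measure lebesgue (vec_of_complex ` S))"
  proof (rule emeasure_eq_measure2)
    show "vec_of_complex ` S \<in> lmeasurable"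
      using bounded_linear_image[OF S(2) bounded_linear_vec_of_complex] vec_image_borel[OF S(1)]
      by (intro bounded_set_imp_lmeasurable) auto
  qed
  finally have 1: "emeasure lborel S = ennreal (measure lebesgue (vec_of_complex ` S))" .
  have "emeasure lborel (f ` S) = emeasure lebesgue (vec_of_complex ` f ` S)"
    using emeasure_vec_image[OF fS] vec_image_borel[OF fS] by simp
  also have "\<dots> = ennreal (measure lebesgue (vec_of_complex ` f ` S))"
    by (rule emeasure_eq_measure2[OF vec(1)])
  also have "\<dots> \<le> ennreal (B * measure lebesgue (vec_of_complex ` S))"
    by (rule ennreal_leI[OF vec(2)])
  also have "\<dots> = ennreal B * emeasure lborel S"
    using 1 \<open>0 \<le> B\<close> by (simp add: ennreal_mult)
  finally show ?thesis .
qed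

text \<open>Sard's theorem in equal dimensions, as the case B = 0 of the area estimate.\<close>

lemma null_image_of_singular_points:
  fixes f :: "complex \<Rightarrow> complex"
  assumes S: "S \<in> sets borel" "bounded S"
    and deriv: "\<And>z. z \<in> S \<Longrightarrow> (f has_derivative real_linear (a z) (b z)) (at z)"
    and sing: "\<And>z. z \<in> S \<Longrightarrow> cmod (a z) = cmod (b z)"
  shows "f ` S \<in> null_sets lebesgue"
proof (rule null_vec_image)
  note vec = differentiable_image_vec[OF S deriv, of 0]
  have "vec_of_complex ` f ` S \<in> lmeasurable" "measure lebesgue (vec_of_complex ` f ` S) = 0"
    using vec sing measure_nonneg[of lebesgue "vec_of_complex ` f ` S"] by auto
  then show "vec_of_complex ` f ` S \<in> null_sets lebesgue"
    by (auto simp: null_sets_def emeasure_eq_measure2)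
qed

subsection \<open>Integration on the surface\<close>

definition hyp_density :: "complex \<Rightarrow> real" where
  "hyp_density z = 4 / (1 - (cmod z)\<^sup>2)\<^sup>2"

lemma hyp_density_measurable [measurable]: "hyp_density \<in> borel_measurable borel"
  unfolding hyp_density_def by measurable

text \<open>\<open>D0\<close> is a chart of full measure: it is open, the projection is injective on
  it, and it exhausts F up to a null set.\<close>

locale fundamental_domain = deck_group +
  fixes F D0 :: "complex set"
  assumes fundamental: "fundamental_set G F"
    and open_D0: "open D0" and D0_F: "D0 \<subseteq> F" and null_F_D0: "F - D0 \<in> null_sets lebesgue"

lemma (in deck_group) fundamental_domain_exists:
  assumes "fundamental_set G F"
  obtains D0 where "fundamental_domain G F D0"
proof -
  obtain D where D: "F \<subseteq> unit_disc" "open D" "D \<subseteq> F" "F \<subseteq> closure D"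
      "emeasure hyp_area (frontier D \<inter> unit_disc) = 0"
    using assms unfolding fundamental_set_def by auto
  have "frontier D \<inter> unit_disc \<in> sets hyp_area"
    by (auto simp: sets_hyp_area)
  then have "frontier D \<inter> unit_disc \<in> null_sets lebesgue"
    using null_sets_hyp_area D(5) by blast
  moreover have "F - D \<subseteq> frontier D \<inter> unit_disc"
    using D by (auto simp: frontier_def interior_open)
  ultimately have "F - D \<in> null_sets lebesgue"
    by (rule null_sets_completion_subset[rotated])
  then show ?thesis
    by (intro that[of D]) (unfold_locales, use D assms in auto)
qed

context fundamental_domain
begin

lemma F_disc: "F \<subseteq> unit_disc"
  using fundamental by (simp add: fundamental_set_def)

lemma D0_disc: "D0 \<subseteq> unit_disc"
  using F_disc D0_F by blast

lemma in_D0: "z \<in> D0 \<Longrightarrow> cmod z < 1"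
  using D0_disc by auto

lemma orbit_inj_F:
  assumes "z \<in> F" "w \<in> F" "orbit G z = orbit G w"
  shows "z = w"
proof -
  have zw: "cmod z < 1" "cmod w < 1"
    using assms F_disc by auto
  have "\<forall>p\<in>surf G. \<exists>!z. z \<in> p \<and> z \<in> F"
    using fundamental by (simp add: fundamental_set_def)
  then have "\<exists>!x. x \<in> orbit G z \<and> x \<in> F"
    using orbit_in_surf[OF zw(1)] by blast
  moreover have "z \<in> orbit G z" "w \<in> orbit G z"
    using orbit_self[OF zw(1)] orbit_self[OF zw(2)] assms(3) by auto
  ultimately show ?thesis
    using assms by blast
qed

lemma orbit_inj: "inj_on (orbit G) D0"
  using orbit_inj_F D0_F by (auto intro!: inj_onI)

abbreviation "\<Omega> \<equiv> orbit G ` D0"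
abbreviation "sheet \<equiv> inv_into D0 (orbit G)"

lemma sheet_orbit: "z \<in> D0 \<Longrightarrow> sheet (orbit G z) = z"
  using inv_into_f_f[OF orbit_inj] .

lemma open_\<Omega>: "openin (surf_topology G) \<Omega>"
  by (intro openin_orbit_image open_D0 D0_disc)

lemma space_surf_borel: "space (surf_borel G) = surf G"
  by (auto simp: surf_borel_def intro!: space_measure_of) (auto simp: openin_surf_topology)

lemma openin_surf_borel: "openin (surf_topology G) U \<Longrightarrow> U \<in> sets (surf_borel G)"
  unfolding surf_borel_def by (subst sets_measure_of) (auto simp: openin_surf_topology)

lemma \<Omega>_borel: "\<Omega> \<in> sets (surf_borel G)"
  by (rule openin_surf_borel[OF open_\<Omega>])

text \<open>The inverse of the projection on \<open>D0\<close>; the value 0 elsewhere makes it a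
  total Borel function on the surface.\<close>

definition sheet_ext :: "complex set \<Rightarrow> complex" where
  "sheet_ext p = (if p \<in> \<Omega> then sheet p else 0)"

lemma sheet_ext_orbit: "z \<in> D0 \<Longrightarrow> sheet_ext (orbit G z) = z"
  by (simp add: sheet_ext_def sheet_orbit)

lemma orbit_mem_image_iff: "A \<subseteq> D0 \<Longrightarrow> z \<in> D0 \<Longrightarrow> orbit G z \<in> orbit G ` A \<longleftrightarrow> z \<in> A"
  using orbit_inj by (auto dest: inj_onD)

lemma sheet_measurable [measurable]: "sheet_ext \<in> surf_borel G \<rightarrow>\<^sub>M borel"
proof (rule borel_measurableI)
  fix U :: "complex set" assume U: "open U"
  have 1: "orbit G ` (U \<inter> D0) \<in> sets (surf_borel G)"
    using U open_D0 D0_disc by (intro openin_surf_borel openin_orbit_image) auto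
  have 2: "space (surf_borel G) - \<Omega> \<in> sets (surf_borel G)"
    using \<Omega>_borel by blast
  have "sheet_ext -` U \<inter> space (surf_borel G)
      = orbit G ` (U \<inter> D0) \<union> (if 0 \<in> U then space (surf_borel G) - \<Omega> else {})"
  proof (rule Set.set_eqI)
    fix p
    show "p \<in> sheet_ext -` U \<inter> space (surf_borel G) \<longleftrightarrow>
        p \<in> orbit G ` (U \<inter> D0) \<union> (if 0 \<in> U then space (surf_borel G) - \<Omega> else {})"
    proof (cases "p \<in> \<Omega>")
      case True
      then obtain z where z: "z \<in> D0" "p = orbit G z" by auto
      then show ?thesis
        using orbit_mem_image_iff[of "U \<inter> D0" z] orbit_in_surf[OF in_D0[OF z(1)]]
        by (simp add: sheet_ext_orbit space_surf_borel)
    next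
      case False
      then show ?thesis
        by (auto simp: sheet_ext_def)
    qed
  qed
  then show "sheet_ext -` U \<inter> space (surf_borel G) \<in> sets (surf_borel G)"
    using 1 2 by auto
qed

lemma orbit_image_borel:
  assumes A: "A \<in> sets borel" "A \<subseteq> D0"
  shows "orbit G ` A \<in> sets (surf_borel G)"
proof -
  have "orbit G ` A = (sheet_ext -` A \<inter> space (surf_borel G)) \<inter> \<Omega>"
  proof (intro Set.set_eqI iffI)
    fix p assume "p \<in> orbit G ` A"
    then obtain z where "z \<in> A" "p = orbit G z" by auto
    then show "p \<in> (sheet_ext -` A \<inter> space (surf_borel G)) \<inter> \<Omega>"
      using A(2) orbit_in_surf[of z] in_D0[of z] by (auto simp: sheet_ext_orbit space_surf_borel)
  next
    fix p assume p: "p \<in> (sheet_ext -` A \<inter> space (surf_borel G)) \<inter> \<Omega>"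
    then obtain z where "z \<in> D0" "p = orbit G z" by auto
    then show "p \<in> orbit G ` A"
      using p by (auto simp: sheet_ext_orbit)
  qed
  then show ?thesis
    using measurable_sets[OF sheet_measurable A(1)] \<Omega>_borel by auto
qed

lemma orbit_continuous: "continuous_map (top_of_set unit_disc) (surf_topology G) (orbit G)"
proof (rule continuous_map_surfI)
  show "orbit G ` unit_disc \<subseteq> surf G"
    by (auto simp: surf_def)
  fix z :: complex and e :: real assume z: "z \<in> unit_disc" and e: "e > 0"
  then obtain r where r: "r > 0" "ball z r \<subseteq> unit_disc" "\<And>w. w \<in> ball z r \<Longrightarrow> hyp_dist z w < e"
    using hyp_dist_small[of z e] by auto
  have "surf_dist (orbit G z) (orbit G w) < e" if "w \<in> unit_disc" "dist w z < r" for w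
    using surf_dist_orbit_le[of z w] r(3)[of w] that z by (simp add: dist_commute)
  then show "\<exists>d>0. \<forall>w\<in>unit_disc. dist w z < d \<longrightarrow> surf_dist (orbit G z) (orbit G w) < e"
    using r(1) by blast
qed

lemma orbit_measurable: "orbit G \<in> restrict_space borel unit_disc \<rightarrow>\<^sub>M surf_borel G"
  by (intro measurable_surf_borel_continuous orbit_continuous) auto

lemma preim_borel:
  assumes "E \<in> sets (surf_borel G)" shows "preim G E \<in> sets borel"
proof -
  have "orbit G -` E \<inter> space (restrict_space borel unit_disc) \<in> sets (restrict_space borel unit_disc)"
    by (rule measurable_sets[OF orbit_measurable assms])
  then have "orbit G -` E \<inter> space (restrict_space borel unit_disc) \<in> sets borel"
    by (simp add: sets_restrict_space_iff)
  moreover have "orbit G -` E \<inter> space (restrict_space borel unit_disc) = preim G E"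
    by (auto simp: space_restrict_space preim_def)
  ultimately show ?thesis by simp
qed

lemma preim_subset: "preim G E \<subseteq> unit_disc"
  by (auto simp: preim_def)

lemma surf_borel_subset: "E \<in> sets (surf_borel G) \<Longrightarrow> E \<in> sets (surf_measure G F')"
  using preim_borel[of E] sets.sets_into_space[of E "surf_borel G"]
  by (auto simp: sets_surf_measure sets_hyp_area preim_subset space_surf_borel)

lemma surf_borel_measurable_imp:
  assumes "h \<in> surf_borel G \<rightarrow>\<^sub>M N" shows "h \<in> surf_measure G F' \<rightarrow>\<^sub>M N"
proof (rule measurableI)
  show "h x \<in> space N" if "x \<in> space (surf_measure G F')" for x
    using measurable_space[OF assms] that by (simp add: space_surf_measure space_surf_borel)
  show "h -` A \<inter> space (surf_measure G F') \<in> sets (surf_measure G F')" if "A \<in> sets N" for A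
    using surf_borel_subset[OF measurable_sets[OF assms that]] by (simp add: space_surf_measure space_surf_borel)
qed

lemma null_sets_surf_measure_iff:
  "E \<in> null_sets (surf_measure G F) \<longleftrightarrow>
    E \<subseteq> surf G \<and> preim G E \<in> sets hyp_area \<and> preim G E \<inter> F \<in> null_sets lebesgue"
proof -
  have "E \<in> null_sets (surf_measure G F) \<longleftrightarrow> E \<in> sets (surf_measure G F) \<and> emeasure hyp_area (preim G E \<inter> F) = 0"
    using emeasure_surf_measure[OF fundamental, of E] by (auto simp: null_sets_def)
  also have "\<dots> \<longleftrightarrow> E \<in> sets (surf_measure G F) \<and> preim G E \<inter> F \<in> null_sets lebesgue"
    using sets_fundamental_set[OF fundamental] null_sets_hyp_area[of "preim G E \<inter> F"]
    by (auto simp: sets_surf_measure)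
  finally show ?thesis
    by (auto simp: sets_surf_measure)
qed

lemma null_sets_surf_borelI:
  assumes E: "E \<in> sets (surf_borel G)" and "preim G E \<inter> D0 \<in> null_sets lebesgue"
  shows "E \<in> null_sets (surf_measure G F)"
proof -
  have "preim G E \<inter> F \<in> null_sets lebesgue"
    using assms(2) null_F_D0 by (rule null_sets_completion_subset[OF _ null_sets.Un, rotated]) auto
  then show ?thesis
    unfolding null_sets_surf_measure_iff using surf_borel_subset[OF E] by (auto simp: sets_surf_measure)
qed

lemma orbit_measurable_surf_measure: "orbit G \<in> density hyp_area (indicator F') \<rightarrow>\<^sub>M surf_measure G F"
proof (rule measurableI)
  fix A assume "A \<in> sets (surf_measure G F)"
  then have "preim G A \<in> sets hyp_area" by (simp add: sets_surf_measure)
  moreover have "orbit G -` A \<inter> unit_disc = preim G A" by (auto simp: preim_def)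
  ultimately show "orbit G -` A \<inter> space (density hyp_area (indicator F')) \<in> sets (density hyp_area (indicator F'))"
    by (simp add: space_hyp_area)
qed (auto simp: space_hyp_area space_surf_measure orbit_in_surf)

lemma surf_measure_eq_distr:
  "surf_measure G F = distr (density hyp_area (indicator F)) (surf_measure G F) (orbit G)"
proof (rule measure_eqI)
  fix E assume E: "E \<in> sets (surf_measure G F)"
  have "emeasure (distr (density hyp_area (indicator F)) (surf_measure G F) (orbit G)) E
      = emeasure (density hyp_area (indicator F)) (orbit G -` E \<inter> unit_disc)"
    using orbit_measurable_surf_measure E by (simp add: emeasure_distr space_hyp_area)
  also have "orbit G -` E \<inter> unit_disc = preim G E" by (auto simp: preim_def)
  also have "emeasure (density hyp_area (indicator F)) (preim G E) = emeasure hyp_area (F \<inter> preim G E)"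
    by (rule emeasure_restricted[OF sets_fundamental_set[OF fundamental]])
       (use E in \<open>simp add: sets_surf_measure\<close>)
  also have "\<dots> = emeasure (surf_measure G F) E"
    using emeasure_surf_measure[OF fundamental E] by (simp add: Int_commute)
  finally show "emeasure (surf_measure G F) E = emeasure (distr (density hyp_area (indicator F)) (surf_measure G F) (orbit G)) E"
    by simp
qed simp

text \<open>The surface measure is the image of the hyperbolic area on F, and F is cut down to
  \<open>D0\<close> at the cost of a null set. For Borel integrands this gives an ordinary plane
  integral.\<close>

lemma nn_integral_surf_measure:
  assumes h: "h \<in> surf_borel G \<rightarrow>\<^sub>M borel"
  shows "(\<integral>\<^sup>+p. h p \<partial>surf_measure G F) = (\<integral>\<^sup>+z\<in>D0. ennreal (hyp_density z) * h (orbit G z) \<partial>lborel)"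
proof -
  have F: "F \<in> sets hyp_area" by (rule sets_fundamental_set[OF fundamental])
  have m: "orbit G \<in> hyp_area \<rightarrow>\<^sub>M surf_borel G"
  proof (rule measurableI)
    fix A assume "A \<in> sets (surf_borel G)"
    then have "preim G A \<in> sets hyp_area" by (simp add: preim_borel preim_subset sets_hyp_area)
    moreover have "orbit G -` A \<inter> unit_disc = preim G A" by (auto simp: preim_def)
    ultimately show "orbit G -` A \<inter> space hyp_area \<in> sets hyp_area"
      by (simp add: space_hyp_area)
  qed (auto simp: space_hyp_area space_surf_borel orbit_in_surf)
  have ho: "(\<lambda>z. h (orbit G z)) \<in> borel_measurable hyp_area"
    using measurable_compose[OF m h] .
  have w: "(\<lambda>z. ennreal (4 / (1 - (cmod z)\<^sup>2)\<^sup>2)) \<in> borel_measurable (restrict_space lebesgue unit_disc)"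
    by (intro measurable_restrict_space1 measurable_completion) measurable
  have "(\<integral>\<^sup>+p. h p \<partial>surf_measure G F) = (\<integral>\<^sup>+z. h (orbit G z) \<partial>density hyp_area (indicator F))"
    by (subst surf_measure_eq_distr) (simp add: nn_integral_distr[OF orbit_measurable_surf_measure] surf_borel_measurable_imp[OF h])
  also have "\<dots> = (\<integral>\<^sup>+z. indicator F z * h (orbit G z) \<partial>hyp_area)"
    using F ho by (intro nn_integral_density) auto
  also have "\<dots> = (\<integral>\<^sup>+z. ennreal (4 / (1 - (cmod z)\<^sup>2)\<^sup>2) * (indicator F z * h (orbit G z)) \<partial>restrict_space lebesgue unit_disc)"
  proof -
    have "(\<lambda>z. indicator F z * h (orbit G z)) \<in> borel_measurable hyp_area"
      using F ho by (intro borel_measurable_times_ennreal) auto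
    then have "(\<lambda>z. indicator F z * h (orbit G z)) \<in> borel_measurable (restrict_space lebesgue unit_disc)"
      unfolding hyp_area_def by simp
    then show ?thesis
      unfolding hyp_area_def by (rule nn_integral_density[OF w])
  qed
  also have "\<dots> = (\<integral>\<^sup>+z. ennreal (4 / (1 - (cmod z)\<^sup>2)\<^sup>2) * (indicator F z * h (orbit G z)) * indicator unit_disc z \<partial>lebesgue)"
    by (rule nn_integral_restrict_space) auto
  also have "\<dots> = (\<integral>\<^sup>+z\<in>D0. ennreal (hyp_density z) * h (orbit G z) \<partial>lebesgue)"
  proof (rule nn_integral_cong_AE)
    have "AE z in lebesgue. z \<notin> F - D0"
      using null_F_D0 by (rule AE_not_in)
    then show "AE z in lebesgue. ennreal (4 / (1 - (cmod z)\<^sup>2)\<^sup>2) * (indicator F z * h (orbit G z)) * indicator unit_disc z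
        = ennreal (hyp_density z) * h (orbit G z) * indicator D0 z"
    proof (rule AE_mp, intro AE_I2 impI)
      fix z assume "z \<notin> F - D0"
      then show "ennreal (4 / (1 - (cmod z)\<^sup>2)\<^sup>2) * (indicator F z * h (orbit G z)) * indicator unit_disc z
        = ennreal (hyp_density z) * h (orbit G z) * indicator D0 z"
        using D0_F F_disc by (cases "z \<in> D0") (auto simp: hyp_density_def indicator_def subset_iff)
    qed
  qed
  also have "\<dots> = (\<integral>\<^sup>+z\<in>D0. ennreal (hyp_density z) * h (orbit G z) \<partial>lborel)"
    by (rule nn_integral_completion)
  finally show ?thesis .
qed

end

subsection \<open>Dilatation in coordinates\<close>

lemma real_linear_decomposition:
  assumes "bounded_linear A"
  shows "A = real_linear ((A 1 - \<i> * A \<i>) / 2) ((A 1 + \<i> * A \<i>) / 2)"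
proof
  fix v
  interpret bounded_linear A by fact
  have "v = Re v *\<^sub>R 1 + Im v *\<^sub>R \<i>"
    by (simp add: complex_eq_iff)
  then have "A v = Re v *\<^sub>R A 1 + Im v *\<^sub>R A \<i>"
    by (metis add scaleR)
  then show "A v = real_linear ((A 1 - \<i> * A \<i>) / 2) ((A 1 + \<i> * A \<i>) / 2) v"
    by (simp add: real_linear_def complex_eq_iff field_simps)
qed

lemma linear_dilatation_real_linear:
  "linear_dilatation (real_linear a b) =
     (if (cmod a)\<^sup>2 - (cmod b)\<^sup>2 \<noteq> 0 then ennreal ((cmod a + cmod b) / \<bar>cmod a - cmod b\<bar>)
      else if cmod a + cmod b = 0 then 1 else \<infinity>)"
proof -
  have "(real_linear a b 1 - \<i> * real_linear a b \<i>) / 2 = a" "(real_linear a b 1 + \<i> * real_linear a b \<i>) / 2 = b"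
    by (simp_all add: real_linear_def algebra_simps)
  then show ?thesis
    unfolding linear_dilatation_def Let_def by simp
qed

text \<open>Conformal changes of coordinates in source and target multiply both Wirtinger
  derivatives by numbers of the same modulus, and the dilatation is homogeneous of degree 0.\<close>

lemma linear_dilatation_scale:
  assumes "\<alpha> \<noteq> 0" "\<beta> \<noteq> 0"
  shows "linear_dilatation (real_linear (\<beta> * a * \<alpha>) (\<beta> * b * cnj \<alpha>)) = linear_dilatation (real_linear a b)"
proof -
  define c where "c = cmod \<alpha> * cmod \<beta>"
  have c: "c > 0" using assms by (simp add: c_def)
  have ab: "cmod (\<beta> * a * \<alpha>) = c * cmod a" "cmod (\<beta> * b * cnj \<alpha>) = c * cmod b"
    by (simp_all add: c_def norm_mult)
  have "(c * cmod a)\<^sup>2 - (c * cmod b)\<^sup>2 = c\<^sup>2 * ((cmod a)\<^sup>2 - (cmod b)\<^sup>2)"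
    by (simp add: power_mult_distrib algebra_simps)
  moreover have "c * cmod a + c * cmod b = c * (cmod a + cmod b)" by (simp add: algebra_simps)
  moreover have "\<bar>c * cmod a - c * cmod b\<bar> = c * \<bar>cmod a - cmod b\<bar>"
    using c by (simp add: right_diff_distrib[symmetric] abs_mult)
  ultimately show ?thesis
    unfolding linear_dilatation_real_linear ab using c by simp
qed

section \<open>The map in the coordinates of the two fundamental domains\<close>

locale surface_map = S: fundamental_domain G F D0 + T: fundamental_domain H FH E0
  for G F D0 H FH E0 +
  fixes D Ds :: "complex set set" and f :: "complex set \<Rightarrow> complex set"
  assumes open_D: "openin (surf_topology G) D" and open_Ds: "openin (surf_topology H) Ds"
    and cont: "continuous_map (subtopology (surf_topology G) D) (subtopology (surf_topology H) Ds) f"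
    and image: "f ` D = Ds"
begin

lemma D_surf: "D \<subseteq> surf G" and Ds_surf: "Ds \<subseteq> surf H"
  using open_D open_Ds by (auto simp: openin_surf_topology)

lemma f_surf: "p \<in> D \<Longrightarrow> f p \<in> surf H"
  using image Ds_surf by auto

lemma open_f_vimage:
  assumes "openin (surf_topology H) V"
  shows "openin (surf_topology G) {p \<in> D. f p \<in> V}"
proof -
  have "openin (subtopology (surf_topology H) Ds) (V \<inter> Ds)"
    using assms by (auto simp: openin_subtopology)
  then have "openin (subtopology (surf_topology G) D) {p \<in> topspace (subtopology (surf_topology G) D). f p \<in> V \<inter> Ds}"
    using cont by (rule openin_continuous_map_preimage[rotated])
  moreover have "{p \<in> topspace (subtopology (surf_topology G) D). f p \<in> V \<inter> Ds} = {p \<in> D. f p \<in> V}"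
    using D_surf image by (auto simp: topspace_subtopology topspace_surf_topology)
  ultimately show ?thesis
    using open_D openin_trans_full by fastforce
qed

text \<open>In the coordinates given by the two fundamental domains the map \<open>f\<close> is \<open>\<Phi>\<close>, defined on the
  open set \<open>W\<close>.\<close>

definition W :: "complex set" where
  "W = {z \<in> D0. orbit G z \<in> D \<and> f (orbit G z) \<in> T.\<Omega>}"

definition \<Phi> :: "complex \<Rightarrow> complex" where
  "\<Phi> z = (if z \<in> W then T.sheet (f (orbit G z)) else 0)"

lemma W_D0: "W \<subseteq> D0" and W_disc: "z \<in> W \<Longrightarrow> cmod z < 1" and W_D: "z \<in> W \<Longrightarrow> orbit G z \<in> D"
  using S.in_D0 by (auto simp: W_def)

lemma \<Phi>_E0: "z \<in> W \<Longrightarrow> \<Phi> z \<in> E0" and orbit_\<Phi>: "z \<in> W \<Longrightarrow> orbit H (\<Phi> z) = f (orbit G z)"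
  by (auto simp: W_def \<Phi>_def inv_into_into f_inv_into_f)

lemma \<Phi>_disc: "z \<in> W \<Longrightarrow> cmod (\<Phi> z) < 1"
  using \<Phi>_E0 T.in_D0 by auto

lemma \<Phi>_eqI: "z \<in> W \<Longrightarrow> v \<in> E0 \<Longrightarrow> orbit H v = f (orbit G z) \<Longrightarrow> \<Phi> z = v"
  using T.orbit_inj \<Phi>_E0 orbit_\<Phi> by (metis inj_onD)

lemma open_W_vimage:
  assumes "openin (surf_topology H) V"
  shows "open {z \<in> D0. orbit G z \<in> D \<and> f (orbit G z) \<in> V}"
proof -
  have "open (preim G {p \<in> D. f p \<in> V})"
    using open_f_vimage[OF assms] by (simp add: openin_surf_topology)
  moreover have "{z \<in> D0. orbit G z \<in> D \<and> f (orbit G z) \<in> V} = D0 \<inter> preim G {p \<in> D. f p \<in> V}"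
    using S.D0_disc by (auto simp: preim_def)
  ultimately show ?thesis
    using S.open_D0 by auto
qed

lemma open_W: "open W"
  unfolding W_def by (rule open_W_vimage[OF T.open_\<Omega>])

lemma continuous_\<Phi>: "continuous_on W \<Phi>"
  unfolding continuous_on_open_vimage[OF open_W]
proof (intro allI impI)
  fix B :: "complex set" assume B: "open B"
  have "\<Phi> -` B \<inter> W = {z \<in> D0. orbit G z \<in> D \<and> f (orbit G z) \<in> orbit H ` (B \<inter> E0)}"
  proof (intro subset_antisym subsetI)
    fix z assume "z \<in> \<Phi> -` B \<inter> W"
    then show "z \<in> {z \<in> D0. orbit G z \<in> D \<and> f (orbit G z) \<in> orbit H ` (B \<inter> E0)}"
      using \<Phi>_E0[of z] orbit_\<Phi>[of z] by (auto simp: W_def intro!: image_eqI[of _ _ "\<Phi> z"])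
  next
    fix z assume z: "z \<in> {z \<in> D0. orbit G z \<in> D \<and> f (orbit G z) \<in> orbit H ` (B \<inter> E0)}"
    then obtain v where v: "v \<in> B" "v \<in> E0" "f (orbit G z) = orbit H v" by auto
    then have "z \<in> W" using z by (auto simp: W_def)
    then show "z \<in> \<Phi> -` B \<inter> W"
      using \<Phi>_eqI[of z v] v by simp
  qed
  then show "open (\<Phi> -` B \<inter> W)"
    using B T.open_D0 T.D0_disc by (simp only:) (intro open_W_vimage T.openin_orbit_image; auto)
qed

lemma \<Phi>_isCont: "z \<in> W \<Longrightarrow> isCont \<Phi> z"
  using continuous_\<Phi> open_W by (simp add: continuous_on_eq_continuous_at)

lemma \<Phi>_measurable [measurable]: "\<Phi> \<in> borel_measurable borel"
proof -
  have "\<Phi> \<in> borel_measurable (restrict_space borel W)"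
    by (rule borel_measurable_continuous_on_restrict[OF continuous_\<Phi>])
  then have "(\<lambda>z. if z \<in> W then \<Phi> z else 0) \<in> borel_measurable borel"
    using open_W by (subst (asm) measurable_restrict_space_iff[where c=0]) auto
  moreover have "(\<lambda>z. if z \<in> W then \<Phi> z else 0) = \<Phi>"
    by (auto simp: \<Phi>_def)
  ultimately show ?thesis by simp
qed

text \<open>Any other local expression of f agrees near z with \<Phi> up to a deck transformation on
  either side; \<alpha> and \<beta> are the derivatives of these transformations.\<close>

lemma chart_derivative:
  assumes z: "z \<in> W" and A: "has_local_derivative G H f (orbit G z) A"
  obtains \<alpha> \<beta> where "\<alpha> \<noteq> 0" "\<beta> \<noteq> 0" "(\<Phi> has_derivative (\<lambda>v. \<beta> * A (\<alpha> * v))) (at z)"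
proof -
  obtain U V \<phi> z1 where loc: "local_expression G H f U V \<phi>" and z1: "z1 \<in> U" "orbit G z1 = orbit G z"
    and deriv: "(\<phi> has_derivative A) (at z1)"
    using A unfolding has_local_derivative_def by blast
  have U: "open U" "U \<subseteq> unit_disc" and V: "V \<subseteq> unit_disc" and \<phi>: "\<phi> ` U \<subseteq> V" "\<forall>w\<in>U. orbit H (\<phi> w) = f (orbit G w)"
    using loc by (auto simp: local_expression_def)
  have zd: "cmod z < 1" "cmod z1 < 1" "cmod (\<phi> z1) < 1" "cmod (\<Phi> z) < 1"
    using W_disc[OF z] z1 U V \<phi> \<Phi>_disc[OF z] by (auto simp: image_subset_iff subset_iff)
  obtain g where g: "g \<in> G" "z1 = g z"
    using S.orbit_eq_iff[OF zd(1,2)] z1(2) by blast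
  have "orbit H (\<Phi> z) = orbit H (\<phi> z1)"
    using orbit_\<Phi>[OF z] \<phi>(2) z1 by simp
  then obtain h where h: "h \<in> H" "\<Phi> z = h (\<phi> z1)"
    using T.orbit_eq_iff[OF zd(3,4)] by blast
  obtain \<alpha> where \<alpha>: "\<alpha> \<noteq> 0" "(g has_field_derivative \<alpha>) (at z)"
    using S.has_nonzero_derivative[OF g(1) zd(1)] .
  obtain \<beta> where \<beta>: "\<beta> \<noteq> 0" "(h has_field_derivative \<beta>) (at (\<phi> z1))"
    using T.has_nonzero_derivative[OF h(1) zd(3)] .
  have dg: "(g has_derivative (*) \<alpha>) (at z)" and dh: "(h has_derivative (*) \<beta>) (at (\<phi> (g z)))"
    using \<alpha>(2) \<beta>(2) by (auto simp: has_field_derivative_def g(2))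
  have "((h \<circ> (\<phi> \<circ> g)) has_derivative ((*) \<beta> \<circ> (A \<circ> (*) \<alpha>))) (at z)"
    using deriv dh by (intro diff_chain_at dg) (auto simp: g(2))
  then have comp: "((\<lambda>w. h (\<phi> (g w))) has_derivative (\<lambda>v. \<beta> * A (\<alpha> * v))) (at z)"
    by (simp add: comp_def)
  have c1: "isCont (\<lambda>w. h (\<phi> (g w))) z" and c2: "isCont g z"
    using has_derivative_continuous[OF comp] has_derivative_continuous[OF dg] by auto
  have "\<forall>\<^sub>F w in at z. g w \<in> U"
    using topological_tendstoD[OF c2[unfolded isCont_def] U(1)] z1 g by auto
  moreover have "\<forall>\<^sub>F w in at z. h (\<phi> (g w)) \<in> E0"
    using topological_tendstoD[OF c1[unfolded isCont_def] T.open_D0] \<Phi>_E0[OF z] h g by auto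
  moreover have "\<forall>\<^sub>F w in at z. w \<in> W"
    using z open_W by (rule eventually_at_in_open'[rotated])
  \<comment> \<open>Both sides are points of \<open>E0\<close> in the same orbit, where the
    projection is injective.\<close>
  ultimately have "\<forall>\<^sub>F w in at z. h (\<phi> (g w)) = \<Phi> w"
  proof eventually_elim
    case (elim w)
    have d: "cmod w < 1" "cmod (\<phi> (g w)) < 1"
      using W_disc[OF elim(3)] elim(1) \<phi>(1) V by (auto simp: image_subset_iff subset_iff)
    have "h (\<phi> (g w)) \<in> orbit H (\<phi> (g w))"
      using h(1) by (auto simp: orbit_def)
    then have "orbit H (h (\<phi> (g w))) = orbit H (\<phi> (g w))"
      by (rule T.orbit_eq[OF d(2)])
    also have "\<dots> = f (orbit G (g w))"
      using \<phi>(2) elim(1) by blast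
    also have "orbit G (g w) = orbit G w"
      using S.orbit_eq[OF d(1), of "g w"] g(1) by (auto simp: orbit_def)
    finally show ?case
      using \<Phi>_eqI[OF elim(3,2)] by simp
  qed
  then have "(\<Phi> has_derivative (\<lambda>v. \<beta> * A (\<alpha> * v))) (at z)"
    by (rule has_derivative_transform_eventually[OF comp]) (use h g in auto)
  then show ?thesis
    using that \<alpha> \<beta> by blast
qed

text \<open>\<open>dilatation\<close> is computed from an arbitrarily chosen local derivative;
  \<open>linear_dilatation_scale\<close> shows that the choice agrees with the derivative of
  \<Phi>.\<close>

lemma derivative_exists:
  assumes z: "z \<in> W" and diff: "surf_differentiable G H f (orbit G z)"
  obtains a b where "(\<Phi> has_derivative real_linear a b) (at z)"
    "dilatation G H f (orbit G z) = linear_dilatation (real_linear a b)"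
proof -
  define A where "A = (SOME A. has_local_derivative G H f (orbit G z) A)"
  obtain A0 where "has_local_derivative G H f (orbit G z) A0"
    using diff unfolding surf_differentiable_def by blast
  then have A: "has_local_derivative G H f (orbit G z) A"
    unfolding A_def by (rule someI[of "has_local_derivative G H f (orbit G z)"])
  then have "bounded_linear A"
    unfolding has_local_derivative_def by (auto dest: has_derivative_bounded_linear)
  then obtain a b where ab: "A = real_linear a b"
    using real_linear_decomposition by blast
  obtain \<alpha> \<beta> where \<alpha>\<beta>: "\<alpha> \<noteq> 0" "\<beta> \<noteq> 0" "(\<Phi> has_derivative (\<lambda>v. \<beta> * A (\<alpha> * v))) (at z)"
    using chart_derivative[OF z A] .
  have "(\<lambda>v. \<beta> * A (\<alpha> * v)) = real_linear (\<beta> * a * \<alpha>) (\<beta> * b * cnj \<alpha>)"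
    by (simp add: ab real_linear_def fun_eq_iff algebra_simps)
  with \<alpha>\<beta>(3) have "(\<Phi> has_derivative real_linear (\<beta> * a * \<alpha>) (\<beta> * b * cnj \<alpha>)) (at z)"
    by simp
  moreover have "dilatation G H f (orbit G z) = linear_dilatation (real_linear (\<beta> * a * \<alpha>) (\<beta> * b * cnj \<alpha>))"
    using diff linear_dilatation_scale[OF \<alpha>\<beta>(1,2), of a b]
    by (simp add: dilatation_def A_def[symmetric] ab)
  ultimately show ?thesis by (rule that)
qed

text \<open>Difference quotients along a fixed sequence of steps: their limits are Borel functions
  on the whole plane, and they are the directional derivatives wherever \<Phi> is
  differentiable.\<close>

definition diff_quot :: "complex \<Rightarrow> complex \<Rightarrow> nat \<Rightarrow> complex" where
  "diff_quot v z n = of_nat (Suc n) * (\<Phi> (z + v / of_nat (Suc n)) - \<Phi> z)"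

definition coeff_a :: "complex \<Rightarrow> complex" where
  "coeff_a z = (lim (diff_quot 1 z) - \<i> * lim (diff_quot \<i> z)) / 2"

definition coeff_b :: "complex \<Rightarrow> complex" where
  "coeff_b z = (lim (diff_quot 1 z) + \<i> * lim (diff_quot \<i> z)) / 2"

lemma lim_diff_quot_measurable: "(\<lambda>z. lim (diff_quot v z)) \<in> borel_measurable borel"
proof (rule borel_measurable_lim_metric)
  fix n
  have "(\<lambda>z. \<Phi> (z + v / of_nat (Suc n))) \<in> borel_measurable borel"
    by (rule measurable_compose[OF _ \<Phi>_measurable]) measurable
  then show "(\<lambda>z. diff_quot v z n) \<in> borel_measurable borel"
    unfolding diff_quot_def by measurable
qed

lemma coeff_measurable [measurable]:
  "coeff_a \<in> borel_measurable borel" "coeff_b \<in> borel_measurable borel"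
  unfolding coeff_a_def coeff_b_def using lim_diff_quot_measurable by measurable

lemma lim_diff_quot:
  assumes A: "(\<Phi> has_derivative A) (at z)" and v: "v \<noteq> 0"
  shows "lim (diff_quot v z) = A v"
proof (rule limI)
  interpret A: bounded_linear A using has_derivative_bounded_linear[OF A] .
  define h where "h n = v / of_nat (Suc n)" for n
  have hs: "h n = (1 / real (Suc n)) *\<^sub>R v" for n
    by (simp add: h_def scaleR_conv_of_real)
  have "(\<lambda>n. (1 / real (Suc n)) *\<^sub>R v) \<longlonglongrightarrow> 0 *\<^sub>R v"
    by (intro tendsto_intros LIMSEQ_Suc lim_1_over_n)
  then have "filterlim h (at 0) sequentially"
    using v by (auto simp: filterlim_at hs[abs_def])
  moreover have "((\<lambda>y. norm (\<Phi> (z + y) - \<Phi> z - A y) / norm y) \<longlongrightarrow> 0) (at 0)"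
    using A by (simp add: has_derivative_at)
  ultimately have "(\<lambda>n. norm (\<Phi> (z + h n) - \<Phi> z - A (h n)) / norm (h n)) \<longlonglongrightarrow> 0"
    by (rule filterlim_compose[rotated])
  then have "(\<lambda>n. norm v * (norm (\<Phi> (z + h n) - \<Phi> z - A (h n)) / norm (h n))) \<longlonglongrightarrow> norm v * 0"
    by (intro tendsto_intros)
  moreover have "norm v * (norm (\<Phi> (z + h n) - \<Phi> z - A (h n)) / norm (h n)) = norm (diff_quot v z n - A v)" for n
  proof -
    have "diff_quot v z n - A v = real (Suc n) *\<^sub>R (\<Phi> (z + h n) - \<Phi> z - A (h n))"
    proof -
      have "real (Suc n) *\<^sub>R A (h n) = A v"
        by (simp add: hs A.scaleR del: of_nat_Suc)
      moreover have "diff_quot v z n = real (Suc n) *\<^sub>R (\<Phi> (z + h n) - \<Phi> z)"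
        by (simp add: diff_quot_def h_def scaleR_conv_of_real)
      ultimately show ?thesis
        by (simp only: scaleR_diff_right)
    qed
    then have 1: "norm (diff_quot v z n - A v) = real (Suc n) * norm (\<Phi> (z + h n) - \<Phi> z - A (h n))"
      by simp
    have 2: "norm (h n) = norm v / real (Suc n)"
      by (simp add: hs)
    show ?thesis
      unfolding 1 2 using v by (simp del: of_nat_Suc)
  qed
  ultimately have "(\<lambda>n. norm (diff_quot v z n - A v)) \<longlonglongrightarrow> 0" by simp
  then show "diff_quot v z \<longlonglongrightarrow> A v"
    by (metis LIM_zero_iff tendsto_norm_zero_iff)
qed

lemma coeff_eq:
  assumes "(\<Phi> has_derivative real_linear a b) (at z)"
  shows "coeff_a z = a" "coeff_b z = b"
proof -
  have 1: "lim (diff_quot 1 z) = a + b" and 2: "lim (diff_quot \<i> z) = \<i> * (a - b)"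
    using lim_diff_quot[OF assms, of 1] lim_diff_quot[OF assms, of \<i>]
    by (simp_all add: real_linear_def algebra_simps)
  show "coeff_a z = a" "coeff_b z = b"
    unfolding coeff_a_def coeff_b_def 1 2 by simp_all
qed

lemma real_linear_lower_bound: "\<bar>cmod a - cmod b\<bar> * cmod v \<le> cmod (real_linear a b v)"
proof -
  have "\<bar>cmod (a * v) - cmod (b * cnj v)\<bar> \<le> cmod (a * v + b * cnj v)"
    using norm_triangle_ineq3[of "a * v" "- (b * cnj v)"] by simp
  then show ?thesis
    by (simp add: real_linear_def norm_mult left_diff_distrib[symmetric] abs_mult)
qed

text \<open>The second condition on r says that r is below the minimal stretch of f at z in the
  hyperbolic metrics. The gap absorbs three errors: Euclidean against hyperbolic distance in the
  source, the differential against \<Phi>, and the two distances in the target.\<close>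

lemma local_expansion:
  assumes z: "z \<in> W" and deriv: "(\<Phi> has_derivative real_linear a b) (at z)"
    and r: "0 < r" "r * (2 / (1 - (cmod z)\<^sup>2)) < \<bar>cmod a - cmod b\<bar> * (2 / (1 - (cmod (\<Phi> z))\<^sup>2))"
  obtains \<delta> where "\<delta> > 0" "\<And>q. q \<in> D \<Longrightarrow> surf_dist (orbit G z) q < \<delta> \<Longrightarrow>
    r * surf_dist (orbit G z) q \<le> surf_dist (f (orbit G z)) (f q)"
proof -
  define \<omega> where "\<omega> = 2 / (1 - (cmod z)\<^sup>2)"
  define \<omega>' where "\<omega>' = 2 / (1 - (cmod (\<Phi> z))\<^sup>2)"
  define l where "l = \<bar>cmod a - cmod b\<bar>"
  have zd: "cmod z < 1" "cmod (\<Phi> z) < 1"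
    using W_disc[OF z] \<Phi>_disc[OF z] by auto
  have pos: "\<omega> > 0" "\<omega>' > 0"
    using zd by (auto simp: \<omega>_def \<omega>'_def abs_square_less_1)
  have rl: "r * \<omega> < l * \<omega>'" using r(2) by (simp add: \<omega>_def \<omega>'_def l_def)
  have "l > 0"
    using rl pos r(1) mult_pos_pos[OF r(1) pos(1)] by (metis less_trans zero_less_mult_pos2)
  \<comment> \<open>One factor t for each of the three errors.\<close>
  obtain t where t: "t > 1" "t ^ 3 * (r * \<omega>) \<le> l * \<omega>'"
  proof -
    have q: "l * \<omega>' / (r * \<omega>) > 1" using rl pos r(1) by (simp add: field_simps)
    define t where "t = root 3 (l * \<omega>' / (r * \<omega>))"
    have "t > 1" unfolding t_def using q by simp
    moreover have "t ^ 3 = l * \<omega>' / (r * \<omega>)" unfolding t_def using q by (intro real_root_pow_pos2) auto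
    then have "t ^ 3 * (r * \<omega>) = l * \<omega>'" using pos r(1) by simp
    ultimately show ?thesis using that[of t] by simp
  qed
  have E1: "\<forall>\<^sub>F w in at z. hyp_dist z w \<le> t * \<omega> * cmod (z - w)"
  proof -
    have "\<omega> < t * \<omega>" using t pos by simp
    then have "\<forall>\<^sub>F w in at z. hyp_dist z w / cmod (z - w) < t * \<omega>"
      using order_tendstoD(2)[OF hyp_dist_quotient[OF zd(1)]] by (simp add: \<omega>_def)
    moreover have "\<forall>\<^sub>F w in at z. w \<noteq> z" by (auto simp: eventually_at_filter)
    ultimately show ?thesis
    proof eventually_elim
      case (elim w)
      then have "cmod (z - w) > 0" by simp
      with elim(1) show ?case by (simp add: field_simps)
    qed
  qed
  have E2: "\<forall>\<^sub>F w in at z. l / t * cmod (w - z) \<le> cmod (\<Phi> w - \<Phi> z)"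
  proof -
    have "l - l / t > 0" using t \<open>l > 0\<close> by (simp add: field_simps)
    then obtain d where d: "d > 0" "\<And>y. norm (y - z) < d \<Longrightarrow> norm (\<Phi> y - \<Phi> z - real_linear a b (y - z)) \<le> (l - l / t) * norm (y - z)"
      using deriv unfolding has_derivative_at_alt by blast
    have "l / t * cmod (w - z) \<le> cmod (\<Phi> w - \<Phi> z)" if "norm (w - z) < d" for w
    proof -
      have "l * cmod (w - z) \<le> cmod (real_linear a b (w - z))"
        unfolding l_def by (rule real_linear_lower_bound)
      also have "\<dots> \<le> cmod (\<Phi> w - \<Phi> z) + cmod (\<Phi> w - \<Phi> z - real_linear a b (w - z))"
        using norm_triangle_ineq4[of "\<Phi> w - \<Phi> z" "\<Phi> w - \<Phi> z - real_linear a b (w - z)"] by simp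
      also have "\<dots> \<le> cmod (\<Phi> w - \<Phi> z) + (l - l / t) * cmod (w - z)"
        using d(2)[OF that] by simp
      finally show ?thesis by (simp add: algebra_simps)
    qed
    then show ?thesis
      unfolding eventually_at using d(1) by (auto simp: dist_norm)
  qed
  have lim: "(\<Phi> \<longlongrightarrow> \<Phi> z) (at z)"
    using \<Phi>_isCont[OF z] by (simp add: isCont_def)
  have E3: "\<forall>\<^sub>F w in at z. \<omega>' / t * cmod (\<Phi> z - \<Phi> w) \<le> hyp_dist (\<Phi> z) (\<Phi> w)"
  proof -
    have "\<omega>' / t < \<omega>'" using t pos by (simp add: field_simps)
    then have "\<forall>\<^sub>F y in at (\<Phi> z). \<omega>' / t < hyp_dist (\<Phi> z) y / cmod (\<Phi> z - y)"
      using order_tendstoD(1)[OF hyp_dist_quotient[OF zd(2)]] by (simp add: \<omega>'_def)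
    then have "\<forall>\<^sub>F y in nhds (\<Phi> z). y \<noteq> \<Phi> z \<longrightarrow> \<omega>' / t < hyp_dist (\<Phi> z) y / cmod (\<Phi> z - y)"
      by (simp add: eventually_at_filter)
    then have "\<forall>\<^sub>F w in at z. \<Phi> w \<noteq> \<Phi> z \<longrightarrow> \<omega>' / t < hyp_dist (\<Phi> z) (\<Phi> w) / cmod (\<Phi> z - \<Phi> w)"
      by (rule eventually_compose_filterlim[OF _ lim])
    then show ?thesis
    proof eventually_elim
      case (elim w)
      show ?case
      proof (cases "\<Phi> w = \<Phi> z")
        case False
        then have "cmod (\<Phi> z - \<Phi> w) > 0" by simp
        with elim False show ?thesis by (simp add: field_simps)
      qed simp
    qed
  qed
  \<comment> \<open>In the source the distance on the surface is bounded above by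
    \<open>hyp_dist\<close>. In the target a lower bound is wanted, so the two distances have to
    agree near \<Phi> z.\<close>
  obtain r0 where r0: "r0 > 0" "\<And>w. cmod w < 1 \<Longrightarrow> hyp_dist (\<Phi> z) w < r0 \<Longrightarrow>
      surf_dist (orbit H (\<Phi> z)) (orbit H w) = hyp_dist (\<Phi> z) w"
    using T.surf_dist_eq_hyp_dist[OF zd(2)] by blast
  have E4: "\<forall>\<^sub>F w in at z. hyp_dist (\<Phi> z) (\<Phi> w) < r0"
  proof -
    obtain s where s: "s > 0" "ball (\<Phi> z) s \<subseteq> unit_disc" "\<And>w. w \<in> ball (\<Phi> z) s \<Longrightarrow> hyp_dist (\<Phi> z) w < r0"
      using hyp_dist_small[OF zd(2) r0(1)] by blast
    have "\<forall>\<^sub>F w in at z. \<Phi> w \<in> ball (\<Phi> z) s"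
      using topological_tendstoD[OF lim, of "ball (\<Phi> z) s"] s(1) by simp
    then show ?thesis by eventually_elim (rule s(3))
  qed
  have E5: "\<forall>\<^sub>F w in at z. w \<in> W"
    using z open_W by (rule eventually_at_in_open'[rotated])
  have "\<forall>\<^sub>F w in at z. w \<in> W \<and> r * hyp_dist z w \<le> surf_dist (orbit H (\<Phi> z)) (orbit H (\<Phi> w))"
    using E1 E2 E3 E4 E5
  proof eventually_elim
    case (elim w)
    have "r * hyp_dist z w \<le> r * (t * \<omega> * cmod (z - w))"
      using elim(1) r(1) by simp
    also have "\<dots> = (t ^ 3 * (r * \<omega>)) / (t * t) * cmod (z - w)"
      using t by (simp add: field_simps power3_eq_cube)
    also have "\<dots> \<le> (l * \<omega>') / (t * t) * cmod (z - w)"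
      using t by (intro mult_right_mono divide_right_mono) auto
    also have "\<dots> = \<omega>' / t * (l / t * cmod (w - z))"
      by (simp add: norm_minus_commute)
    also have "\<dots> \<le> \<omega>' / t * cmod (\<Phi> w - \<Phi> z)"
      using elim(2) t pos by (intro mult_left_mono) auto
    also have "\<dots> \<le> hyp_dist (\<Phi> z) (\<Phi> w)"
      using elim(3) by (simp add: norm_minus_commute)
    also have "\<dots> = surf_dist (orbit H (\<Phi> z)) (orbit H (\<Phi> w))"
      using r0(2)[OF \<Phi>_disc[OF elim(5)] elim(4)] by simp
    finally show ?case using elim(5) by simp
  qed
  then obtain d where d: "d > 0" "\<And>w. w \<noteq> z \<Longrightarrow> dist w z < d \<Longrightarrow>
      w \<in> W \<and> r * hyp_dist z w \<le> surf_dist (orbit H (\<Phi> z)) (orbit H (\<Phi> w))"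
    unfolding eventually_at by auto
  show ?thesis
  \<comment> \<open>Half of d, again for the factor 2 in
    \<open>norm_diff_le_hyp_dist\<close>.\<close>
  proof (rule that[of "d/2"])
    fix q assume q: "q \<in> D" and less: "surf_dist (orbit G z) q < d/2"
    have qs: "q \<in> surf G" using q D_surf by auto
    obtain w where w: "w \<in> q" "hyp_dist z w < d/2"
      using S.surf_dist_lessE[OF S.orbit_in_surf[OF zd(1)] qs S.orbit_self[OF zd(1)] less] .
    have wd: "cmod w < 1" "q = orbit G w"
      using S.surf_element[OF qs w(1)] by auto
    show "r * surf_dist (orbit G z) q \<le> surf_dist (f (orbit G z)) (f q)"
    proof (cases "w = z")
      case True
      then show ?thesis
        using wd S.surf_dist_refl[OF qs] T.surf_dist_refl[OF f_surf[OF q]] by simp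
    next
      case False
      have "dist w z < d"
        using norm_diff_le_hyp_dist[OF zd(1) wd(1)] w(2) by (simp add: dist_norm norm_minus_commute)
      from d(2)[OF False this] have w': "w \<in> W" "r * hyp_dist z w \<le> surf_dist (orbit H (\<Phi> z)) (orbit H (\<Phi> w))"
        by auto
      have "r * surf_dist (orbit G z) q \<le> r * hyp_dist z w"
        using S.surf_dist_orbit_le[OF zd(1) wd(1)] r(1) wd(2) by simp
      also note w'(2)
      finally show ?thesis
        using orbit_\<Phi>[OF z] orbit_\<Phi>[OF w'(1)] wd(2) by simp
    qed
  qed (use d in auto)
qed

end

section \<open>Cutting the regular points into compact pieces\<close>

lemma (in deck_group) surf_dist_continuous:
  assumes q: "q \<in> surf G"
  shows "continuous_on unit_disc (\<lambda>z. surf_dist (orbit G z) q)"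
proof (rule continuous_onI)
  fix z :: complex and e :: real assume z: "z \<in> unit_disc" and e: "e > 0"
  then obtain s where s: "s > 0" "ball z s \<subseteq> unit_disc" "\<And>w. w \<in> ball z s \<Longrightarrow> hyp_dist z w < e"
    using hyp_dist_small[of z e] by auto
  have "dist (surf_dist (orbit G w) q) (surf_dist (orbit G z) q) \<le> e" if w: "w \<in> unit_disc" "dist w z < s" for w
  proof -
    have zw: "orbit G z \<in> surf G" "orbit G w \<in> surf G"
      using z w by (auto intro: orbit_in_surf)
    have "surf_dist (orbit G z) (orbit G w) \<le> hyp_dist z w"
      using z w by (intro surf_dist_orbit_le) auto
    moreover have "hyp_dist z w < e"
      using w by (intro s(3)) (simp add: dist_commute)
    moreover have "surf_dist (orbit G z) q \<le> surf_dist (orbit G z) (orbit G w) + surf_dist (orbit G w) q"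
      by (rule surf_dist_triangle[OF zw q])
    moreover have "surf_dist (orbit G w) q \<le> surf_dist (orbit G w) (orbit G z) + surf_dist (orbit G z) q"
      by (rule surf_dist_triangle[OF zw(2,1) q])
    ultimately show ?thesis
      using surf_dist_sym[of "orbit G w" "orbit G z"] by (simp add: dist_real_def)
  qed
  then show "\<exists>d>0. \<forall>w\<in>unit_disc. dist w z < d \<longrightarrow> dist (surf_dist (orbit G w) q) (surf_dist (orbit G z) q) \<le> e"
    using s(1) by blast
qed

text \<open>Compactness will make the images of the pieces Borel and the inverse of \<Phi> on them
  continuous. It comes from inner regularity of Lebesgue measure.\<close>

lemma compact_exhaustion_ae:
  fixes Q :: "complex set"
  assumes Q: "Q \<in> sets borel" "bounded Q"
  obtains \<K> where "countable \<K>" "\<And>K. K \<in> \<K> \<Longrightarrow> compact K \<and> K \<subseteq> Q" "Q - \<Union>\<K> \<in> null_sets lebesgue"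
proof -
  have "\<exists>T. closed T \<and> T \<subseteq> Q \<and> emeasure lebesgue (Q - T) < ennreal (1 / real (Suc n))" for n
    using sets_lebesgue_inner_closed[of Q "1 / real (Suc n)"] Q(1) by (metis sets_completionI_sets sets_lborel zero_less_divide_1_iff of_nat_0_less_iff zero_less_Suc)
  then obtain T where T: "\<And>n. closed (T n)" "\<And>n. T n \<subseteq> Q" "\<And>n. emeasure lebesgue (Q - T n) < ennreal (1 / real (Suc n))"
    by metis
  show ?thesis
  proof (rule that[of "range T"])
    show "compact K \<and> K \<subseteq> Q" if K: "K \<in> range T" for K
    proof -
      obtain n where "K = T n" using K by auto
      then show ?thesis
        using T(1,2)[of n] bounded_subset[OF Q(2) T(2)[of n]] by (simp add: compact_eq_bounded_closed)
    qed
    have m: "Q - \<Union>(range T) \<in> sets lebesgue"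
      using Q(1) T(1) by auto
    have "emeasure lebesgue (Q - \<Union>(range T)) \<le> 0"
    proof (rule ennreal_le_epsilon)
      fix e :: real assume "e > 0"
      then obtain n where n: "1 / real (Suc n) < e"
        using nat_approx_posE by (metis of_nat_Suc)
      have "emeasure lebesgue (Q - \<Union>(range T)) \<le> emeasure lebesgue (Q - T n)"
        using Q(1) T(1)[of n] by (intro emeasure_mono) auto
      also have "\<dots> \<le> ennreal e"
        using T(3)[of n] n by (meson ennreal_leI less_imp_le order_trans)
      finally show "emeasure lebesgue (Q - \<Union>(range T)) \<le> 0 + ennreal e" by simp
    qed
    then show "Q - \<Union>(range T) \<in> null_sets lebesgue"
      using m by (auto simp: null_sets_def)
  qed auto
qed

lemma null_lebesgue_subset: "A \<subseteq> B \<Longrightarrow> B \<in> null_sets lebesgue \<Longrightarrow> A \<in> null_sets lebesgue"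
  by (rule null_sets_completion_subset)

context surface_map
begin

definition expands :: "real \<Rightarrow> real \<Rightarrow> complex \<Rightarrow> bool" where
  "expands r \<delta> z \<longleftrightarrow> (\<forall>q\<in>D. surf_dist (orbit G z) q < \<delta> \<longrightarrow>
     r * surf_dist (orbit G z) q \<le> surf_dist (f (orbit G z)) (f q))"

text \<open>Failure is witnessed by some q in D, and for fixed q it is an open condition on z. The
  uncountable union over q is therefore harmless.\<close>

lemma expands_borel: "{z \<in> W. expands r \<delta> z} \<in> sets borel"
proof -
  have "open {z \<in> W. surf_dist (orbit G z) q < \<delta> \<and> r * surf_dist (orbit G z) q > surf_dist (f (orbit G z)) (f q)}"
    if q: "q \<in> D" for q
  proof -
    have qs: "q \<in> surf G" "f q \<in> surf H" using q D_surf f_surf by auto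
    have 1: "continuous_on W (\<lambda>z. surf_dist (orbit G z) q)"
      by (rule continuous_on_subset[OF S.surf_dist_continuous[OF qs(1)]]) (use W_disc in auto)
    have "continuous_on W (\<lambda>z. surf_dist (orbit H (\<Phi> z)) (f q))"
      by (rule continuous_on_compose2[OF T.surf_dist_continuous[OF qs(2)] continuous_\<Phi>]) (use \<Phi>_disc in auto)
    then have 2: "continuous_on W (\<lambda>z. surf_dist (f (orbit G z)) (f q))"
      by (rule continuous_on_eq) (simp add: orbit_\<Phi>)
    have "open ((\<lambda>z. surf_dist (orbit G z) q) -` {..<\<delta>} \<inter> W)"
      using 1 open_W by (simp add: continuous_on_open_vimage)
    moreover have "open ((\<lambda>z. r * surf_dist (orbit G z) q - surf_dist (f (orbit G z)) (f q)) -` {0<..} \<inter> W)"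
    proof -
      have "continuous_on W (\<lambda>z. r * surf_dist (orbit G z) q - surf_dist (f (orbit G z)) (f q))"
        by (intro continuous_intros 1 2)
      then show ?thesis
        using open_W by (simp add: continuous_on_open_vimage)
    qed
    moreover have "{z \<in> W. surf_dist (orbit G z) q < \<delta> \<and> r * surf_dist (orbit G z) q > surf_dist (f (orbit G z)) (f q)}
        = ((\<lambda>z. surf_dist (orbit G z) q) -` {..<\<delta>} \<inter> W) \<inter>
          ((\<lambda>z. r * surf_dist (orbit G z) q - surf_dist (f (orbit G z)) (f q)) -` {0<..} \<inter> W)"
      by auto
    ultimately show ?thesis by (simp only: open_Int)
  qed
  then have "open (\<Union>q\<in>D. {z \<in> W. surf_dist (orbit G z) q < \<delta> \<and> r * surf_dist (orbit G z) q > surf_dist (f (orbit G z)) (f q)})"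
    by blast
  moreover have "{z \<in> W. expands r \<delta> z} = W - (\<Union>q\<in>D. {z \<in> W. surf_dist (orbit G z) q < \<delta> \<and> r * surf_dist (orbit G z) q > surf_dist (f (orbit G z)) (f q)})"
    by (auto simp: expands_def not_less)
  ultimately show ?thesis
    using open_W by auto
qed

text \<open>With \<open>l\<close>, \<open>J\<close> and \<open>K\<close> the hyperbolic minimal stretch, the Euclidean Jacobian and the dilatation
  at \<open>z\<close>, one has \<open>J * hyp_density (\<Phi> z) = K * hyp_density z * l\<^sup>2\<close>. On a piece these five quantities are
  replaced by constants at the cost of a factor \<open>\<tau>\<close>.\<close>

definition piece :: "real \<Rightarrow> real \<Rightarrow> real \<Rightarrow> real \<Rightarrow> real \<Rightarrow> real \<Rightarrow> real \<Rightarrow> complex set \<Rightarrow> bool" where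
  "piece \<tau> r \<delta> \<kappa> j A B P \<longleftrightarrow>
     0 < r \<and> 0 < \<delta> \<and> 0 < \<kappa> \<and> 0 \<le> j \<and> 0 \<le> A \<and> 0 < B \<and> j * A \<le> \<tau> * \<kappa> * B * r\<^sup>2 \<and>
     P \<subseteq> W \<and> inj_on \<Phi> P \<and>
     (\<forall>z\<in>P. (\<Phi> has_derivative real_linear (coeff_a z) (coeff_b z)) (at z) \<and>
        \<bar>(cmod (coeff_a z))\<^sup>2 - (cmod (coeff_b z))\<^sup>2\<bar> \<le> j \<and>
        hyp_density (\<Phi> z) \<le> A \<and> B \<le> hyp_density z \<and>
        ennreal \<kappa> \<le> dilatation G H f (orbit G z) \<and> expands r \<delta> z)"

lemma piece_subset: "piece \<tau> r \<delta> \<kappa> j A B P \<Longrightarrow> P' \<subseteq> P \<Longrightarrow> piece \<tau> r \<delta> \<kappa> j A B P'"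
  unfolding piece_def by (auto intro: inj_on_subset)

lemma piece_empty: "0 \<le> \<tau> \<Longrightarrow> piece \<tau> 1 1 1 0 0 1 {}"
  by (simp add: piece_def)

definition regular_set :: "complex set \<Rightarrow> bool" where
  "regular_set R \<longleftrightarrow> R \<in> sets borel \<and> R \<subseteq> W \<and>
     (\<forall>z\<in>R. (\<Phi> has_derivative real_linear (coeff_a z) (coeff_b z)) (at z) \<and>
        cmod (coeff_a z) \<noteq> cmod (coeff_b z) \<and>
        dilatation G H f (orbit G z) =
          ennreal ((cmod (coeff_a z) + cmod (coeff_b z)) / \<bar>cmod (coeff_a z) - cmod (coeff_b z)\<bar>))"

text \<open>If f has equal values at the two points, the expansion at z forces their distance to be
  0.\<close>

lemma injective_nearby:
  assumes z: "z \<in> W" and w: "w \<in> W" and r: "r > 0" "expands r \<delta> z"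
    and less: "surf_dist (orbit G z) (orbit G w) < \<delta>" and eq: "\<Phi> z = \<Phi> w"
  shows "z = w"
proof -
  have "f (orbit G z) = f (orbit G w)"
    using orbit_\<Phi>[OF z] orbit_\<Phi>[OF w] eq by simp
  then have "surf_dist (f (orbit G z)) (f (orbit G w)) = 0"
    using T.surf_dist_refl[OF f_surf[OF W_D[OF w]]] by simp
  then have "r * surf_dist (orbit G z) (orbit G w) \<le> 0"
    using r(2) W_D[OF w] less unfolding expands_def by fastforce
  moreover have s: "orbit G z \<in> surf G" "orbit G w \<in> surf G"
    using W_D z w D_surf by auto
  ultimately have "surf_dist (orbit G z) (orbit G w) = 0"
    using r(1) S.surf_dist_nonneg[OF s] by (simp add: mult_le_0_iff)
  then have "orbit G z = orbit G w"
    by (rule S.surf_dist_eq_0[OF s])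
  then show ?thesis
    using S.orbit_inj z w W_D0 by (auto dest: inj_onD)
qed

text \<open>All parameters will be rationals or natural numbers, so that there are only countably
  many candidates. The small ball is there to make \<Phi> injective by way of
  \<open>expands\<close>.\<close>

definition candidate :: "complex set \<Rightarrow> real \<Rightarrow> nat \<Rightarrow> real \<Rightarrow> real \<Rightarrow> real \<Rightarrow> real \<Rightarrow> complex \<Rightarrow> nat \<Rightarrow> complex set" where
  "candidate R r n \<kappa> j A B c s =
     {z. \<bar>(cmod (coeff_a z))\<^sup>2 - (cmod (coeff_b z))\<^sup>2\<bar> \<le> j \<and> hyp_density (\<Phi> z) \<le> A \<and> B \<le> hyp_density z \<and>
        \<kappa> \<le> (cmod (coeff_a z) + cmod (coeff_b z)) / \<bar>cmod (coeff_a z) - cmod (coeff_b z)\<bar>} \<inter>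
     R \<inter> ball c (1 / real (Suc s)) \<inter> {z \<in> W. expands r (1 / real (Suc n)) z}"

lemma candidate_borel: "R \<in> sets borel \<Longrightarrow> candidate R r n \<kappa> j A B c s \<in> sets borel"
proof -
  assume R: "R \<in> sets borel"
  have [measurable]: "(\<lambda>z. hyp_density (\<Phi> z)) \<in> borel_measurable borel"
    by (rule measurable_compose[OF \<Phi>_measurable hyp_density_measurable])
  have "{z \<in> space borel. \<bar>(cmod (coeff_a z))\<^sup>2 - (cmod (coeff_b z))\<^sup>2\<bar> \<le> j \<and> hyp_density (\<Phi> z) \<le> A \<and> B \<le> hyp_density z \<and>
        \<kappa> \<le> (cmod (coeff_a z) + cmod (coeff_b z)) / \<bar>cmod (coeff_a z) - cmod (coeff_b z)\<bar>} \<in> sets borel"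
    by measurable
  then show ?thesis
    unfolding candidate_def using R expands_borel by (intro sets.Int) simp_all
qed

lemma candidate_piece:
  assumes R: "regular_set R"
    and pos: "0 < r" "0 < \<kappa>" "0 \<le> j" "0 \<le> A" "0 < B" "j * A \<le> \<tau> * \<kappa> * B * r\<^sup>2"
    and small: "\<And>z w. z \<in> ball c (1 / real (Suc s)) \<inter> W \<Longrightarrow> w \<in> ball c (1 / real (Suc s)) \<inter> W \<Longrightarrow>
      surf_dist (orbit G z) (orbit G w) < 1 / real (Suc n)"
  shows "piece \<tau> r (1 / real (Suc n)) \<kappa> j A B (candidate R r n \<kappa> j A B c s)"
  unfolding piece_def
proof (intro conjI ballI)
  let ?P = "candidate R r n \<kappa> j A B c s"
  show "?P \<subseteq> W" by (auto simp: candidate_def)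
  show "inj_on \<Phi> ?P"
  proof (rule inj_onI)
    fix z w assume zw: "z \<in> ?P" "w \<in> ?P" and eq: "\<Phi> z = \<Phi> w"
    then have W: "z \<in> W" "w \<in> W" and ex: "expands r (1 / real (Suc n)) z"
      and "z \<in> ball c (1 / real (Suc s)) \<inter> W" "w \<in> ball c (1 / real (Suc s)) \<inter> W"
      unfolding candidate_def by blast+
    then show "z = w"
      using injective_nearby[OF W pos(1) ex small eq] by blast
  qed
  fix z assume z: "z \<in> ?P"
  then have zR: "z \<in> R" by (simp add: candidate_def)
  show "(\<Phi> has_derivative real_linear (coeff_a z) (coeff_b z)) (at z)"
    using R zR by (simp add: regular_set_def)
  have "dilatation G H f (orbit G z) =
          ennreal ((cmod (coeff_a z) + cmod (coeff_b z)) / \<bar>cmod (coeff_a z) - cmod (coeff_b z)\<bar>)"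
    using R zR by (simp add: regular_set_def)
  then show "ennreal \<kappa> \<le> dilatation G H f (orbit G z)"
    using z by (simp add: candidate_def ennreal_leI)
  show "\<bar>(cmod (coeff_a z))\<^sup>2 - (cmod (coeff_b z))\<^sup>2\<bar> \<le> j" "hyp_density (\<Phi> z) \<le> A" "B \<le> hyp_density z"
    "expands r (1 / real (Suc n)) z"
    using z by (simp_all add: candidate_def)
qed (use pos in auto)

lemma orbit_ball_small:
  assumes z: "z \<in> W" and e: "e > 0"
  obtains x y :: rat and s where "z \<in> ball (Complex (of_rat x) (of_rat y)) (1 / real (Suc s))"
    "\<And>u v. u \<in> ball (Complex (of_rat x) (of_rat y)) (1 / real (Suc s)) \<inter> W \<Longrightarrow>
      v \<in> ball (Complex (of_rat x) (of_rat y)) (1 / real (Suc s)) \<inter> W \<Longrightarrow> surf_dist (orbit G u) (orbit G v) < e"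
proof -
  have zd: "cmod z < 1" using W_disc[OF z] .
  obtain d where d: "d > 0" "ball z d \<subseteq> unit_disc" "\<And>w. w \<in> ball z d \<Longrightarrow> hyp_dist z w < e/2"
    using hyp_dist_small[OF zd half_gt_zero[OF e]] by blast
  obtain s where s: "1 / real (Suc s) < d / 2"
    using nat_approx_posE[of "d/2"] d(1) by auto
  define t where "t = 1 / real (Suc s)"
  have t: "t > 0" "t < d/2" using s by (auto simp: t_def)
  \<comment> \<open>Each coordinate is met within t/2, which puts the centre within t of z.\<close>
  obtain x y where xy: "Re z - t/2 < real_of_rat x" "real_of_rat x < Re z + t/2"
    "Im z - t/2 < real_of_rat y" "real_of_rat y < Im z + t/2"
    using of_rat_dense[of "Re z - t/2" "Re z + t/2"] of_rat_dense[of "Im z - t/2" "Im z + t/2"] t(1) by auto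
  define c where "c = Complex (of_rat x) (of_rat y)"
  have zc: "dist c z < t"
  proof -
    have "dist c z \<le> \<bar>Re (c - z)\<bar> + \<bar>Im (c - z)\<bar>"
      unfolding dist_norm by (rule cmod_le)
    also have "\<dots> < t" using xy by (auto simp: c_def abs_less_iff)
    finally show ?thesis .
  qed
  have "surf_dist (orbit G u) (orbit G v) < e" if uv: "u \<in> ball c t \<inter> W" "v \<in> ball c t \<inter> W" for u v
  proof -
    have h: "hyp_dist z w < e/2" "orbit G w \<in> surf G" "surf_dist (orbit G z) (orbit G w) < e/2" if w: "w \<in> ball c t \<inter> W" for w
    proof -
      have "dist z w \<le> dist c z + dist c w" by (rule dist_triangle3)
      then have "w \<in> ball z d" using w zc t by auto
      then show 1: "hyp_dist z w < e/2" by (rule d(3))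
      show "orbit G w \<in> surf G" using w W_D D_surf by auto
      show "surf_dist (orbit G z) (orbit G w) < e/2"
        using S.surf_dist_orbit_le[OF zd W_disc[of w]] w 1 by auto
    qed
    have "surf_dist (orbit G u) (orbit G v) \<le> surf_dist (orbit G u) (orbit G z) + surf_dist (orbit G z) (orbit G v)"
      by (rule S.surf_dist_triangle[OF h(2)[OF uv(1)] S.orbit_in_surf[OF zd] h(2)[OF uv(2)]])
    then show ?thesis
      using h(3)[OF uv(1)] h(3)[OF uv(2)] S.surf_dist_sym[of "orbit G u" "orbit G z"] by linarith
  qed
  then show ?thesis
    using that[of x y s] zc by (auto simp: c_def t_def)
qed

end

lemma rat_approx_above:
  fixes x t :: real assumes "0 < x" "1 < t"
  obtains q :: rat where "x < of_rat q" "of_rat q < t * x"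
  using of_rat_dense[of x "t * x"] assms by (auto simp: mult.commute)

lemma rat_approx_below:
  fixes x t :: real assumes "0 < x" "1 < t"
  obtains q :: rat where "x / t < of_rat q" "of_rat q < x"
  using of_rat_dense[of "x / t" x] assms by (auto simp: field_simps)

context surface_map
begin

text \<open>The constants are rational approximations of the exact values at z within a factor
  \<tau>: j and A from above, r, \<kappa> and B from below. The exponent 6 counts one factor for
  each of j, A, \<kappa>, B and two for the square of r.\<close>

lemma regular_point_in_candidate:
  assumes R: "regular_set R" and z: "z \<in> R" and \<tau>: "\<tau> > 1"
  obtains r \<kappa> j A B x y :: rat and n s where
    "z \<in> candidate R (of_rat r) n (of_rat \<kappa>) (of_rat j) (of_rat A) (of_rat B) (Complex (of_rat x) (of_rat y)) s"
    "piece (\<tau> ^ 6) (of_rat r) (1 / real (Suc n)) (of_rat \<kappa>) (of_rat j) (of_rat A) (of_rat B)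
      (candidate R (of_rat r) n (of_rat \<kappa>) (of_rat j) (of_rat A) (of_rat B) (Complex (of_rat x) (of_rat y)) s)"
proof -
  have zW: "z \<in> W" using R z by (auto simp: regular_set_def)
  have deriv: "(\<Phi> has_derivative real_linear (coeff_a z) (coeff_b z)) (at z)"
    and ne: "cmod (coeff_a z) \<noteq> cmod (coeff_b z)"
    using R z by (auto simp: regular_set_def)
  define a where "a = cmod (coeff_a z)"
  define b where "b = cmod (coeff_b z)"
  define le where "le = \<bar>a - b\<bar>"
  define \<omega> where "\<omega> = 2 / (1 - (cmod z)\<^sup>2)"
  define \<omega>' where "\<omega>' = 2 / (1 - (cmod (\<Phi> z))\<^sup>2)"
  have zd: "cmod z < 1" "cmod (\<Phi> z) < 1"
    using W_disc[OF zW] \<Phi>_disc[OF zW] by auto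
  have \<omega>: "\<omega> > 0" "\<omega>' > 0"
    using zd by (auto simp: \<omega>_def \<omega>'_def abs_square_less_1)
  have dens: "hyp_density z = \<omega>\<^sup>2" "hyp_density (\<Phi> z) = \<omega>'\<^sup>2"
    by (simp_all add: hyp_density_def \<omega>_def \<omega>'_def power_divide)
  have ab: "a \<ge> 0" "b \<ge> 0" "a + b > 0" "le > 0"
    using ne by (auto simp: a_def b_def le_def) (metis add_nonneg_eq_0_iff norm_ge_zero not_le_imp_less order_antisym_conv add_nonneg_nonneg)
  define l where "l = le * \<omega>' / \<omega>"
  define K where "K = (a + b) / le"
  define J where "J = (a + b) * le"
  have pos: "l > 0" "K > 0" "J > 0" using ab \<omega> by (auto simp: l_def K_def J_def)
  have J: "\<bar>a\<^sup>2 - b\<^sup>2\<bar> = J"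
    unfolding J_def le_def power2_eq_square square_diff_square_factored abs_mult using ab by (simp add: mult.commute)
  \<comment> \<open>With the exact values the inequality in \<open>piece\<close> is an equality
    without the factor.\<close>
  have key: "J * \<omega>'\<^sup>2 = K * \<omega>\<^sup>2 * l\<^sup>2"
    using ab \<omega> by (simp add: J_def K_def l_def power2_eq_square field_simps)
  obtain r where r: "l / \<tau> < of_rat r" "of_rat r < l" by (rule rat_approx_below[OF pos(1) \<tau>])
  obtain \<kappa> where \<kappa>: "K / \<tau> < of_rat \<kappa>" "of_rat \<kappa> < K" by (rule rat_approx_below[OF pos(2) \<tau>])
  obtain j where j: "J < of_rat j" "of_rat j < \<tau> * J" by (rule rat_approx_above[OF pos(3) \<tau>])
  obtain A where A: "\<omega>'\<^sup>2 < of_rat A" "of_rat A < \<tau> * \<omega>'\<^sup>2" by (rule rat_approx_above[of "\<omega>'\<^sup>2", OF _ \<tau>]) (use \<omega> in auto)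
  obtain B where B: "\<omega>\<^sup>2 / \<tau> < of_rat B" "of_rat B < \<omega>\<^sup>2" by (rule rat_approx_below[of "\<omega>\<^sup>2", OF _ \<tau>]) (use \<omega> in auto)
  have p: "0 < real_of_rat r" "0 < real_of_rat \<kappa>" "0 < real_of_rat j" "0 < real_of_rat A" "0 < real_of_rat B"
  proof -
    have "0 < l / \<tau>" "0 < K / \<tau>" "0 < \<omega>\<^sup>2 / \<tau>" "0 < \<omega>'\<^sup>2" using pos \<omega> \<tau> by auto
    then show "0 < real_of_rat r" "0 < real_of_rat \<kappa>" "0 < real_of_rat j" "0 < real_of_rat A" "0 < real_of_rat B"
      using r \<kappa> j A B pos by linarith+
  qed
  have ineq: "real_of_rat j * of_rat A \<le> \<tau> ^ 6 * of_rat \<kappa> * of_rat B * (of_rat r)\<^sup>2"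
  proof -
    have "real_of_rat j * of_rat A \<le> (\<tau> * J) * (\<tau> * \<omega>'\<^sup>2)"
      using j A p \<tau> pos by (intro mult_mono) auto
    also have "\<dots> = \<tau>\<^sup>2 * (K * \<omega>\<^sup>2 * l\<^sup>2)"
      unfolding key[symmetric] by (simp add: power2_eq_square)
    also have "\<dots> \<le> \<tau>\<^sup>2 * ((\<tau> * of_rat \<kappa>) * (\<tau> * of_rat B) * (\<tau> * of_rat r)\<^sup>2)"
    proof (intro mult_left_mono mult_mono power_mono)
      show "K \<le> \<tau> * of_rat \<kappa>" "\<omega>\<^sup>2 \<le> \<tau> * of_rat B" "l \<le> \<tau> * of_rat r"
        using \<kappa> B r \<tau> by (simp_all add: field_simps)
    qed (use pos p \<tau> in auto)
    also have "\<dots> = \<tau> ^ 6 * of_rat \<kappa> * of_rat B * (of_rat r)\<^sup>2"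
      by (simp add: power_mult_distrib eval_nat_numeral mult_ac)
    finally show ?thesis .
  qed
  have "real_of_rat r * \<omega> < le * \<omega>'"
    using r(2) \<omega> by (simp add: l_def field_simps)
  then obtain \<delta> where \<delta>: "\<delta> > 0" "\<And>q. q \<in> D \<Longrightarrow> surf_dist (orbit G z) q < \<delta> \<Longrightarrow>
      of_rat r * surf_dist (orbit G z) q \<le> surf_dist (f (orbit G z)) (f q)"
    using local_expansion[OF zW deriv p(1)] unfolding \<omega>_def \<omega>'_def le_def a_def b_def by blast
  obtain n where n: "1 / real (Suc n) < \<delta>"
    using nat_approx_posE[OF \<delta>(1)] by auto
  have ex: "expands (of_rat r) (1 / real (Suc n)) z"
    unfolding expands_def using \<delta>(2) n by (meson less_trans)
  \<comment> \<open>The ball is chosen after n, so small that any two of its points are within the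
    range in which \<open>expands\<close> applies.\<close>
  have "0 < 1 / real (Suc n)" by simp
  from orbit_ball_small[OF zW this]
  obtain x y :: rat and s where c: "z \<in> ball (Complex (of_rat x) (of_rat y)) (1 / real (Suc s))"
    "\<And>u v. u \<in> ball (Complex (of_rat x) (of_rat y)) (1 / real (Suc s)) \<inter> W \<Longrightarrow>
      v \<in> ball (Complex (of_rat x) (of_rat y)) (1 / real (Suc s)) \<inter> W \<Longrightarrow> surf_dist (orbit G u) (orbit G v) < 1 / real (Suc n)"
    by blast
  show ?thesis
  proof (rule that)
    show "z \<in> candidate R (of_rat r) n (of_rat \<kappa>) (of_rat j) (of_rat A) (of_rat B) (Complex (of_rat x) (of_rat y)) s"
      unfolding candidate_def using z zW c(1) ex j(1) A(1) B(2) \<kappa>(2) J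
      by (simp add: dens K_def le_def a_def b_def less_imp_le)
    show "piece (\<tau> ^ 6) (of_rat r) (1 / real (Suc n)) (of_rat \<kappa>) (of_rat j) (of_rat A) (of_rat B)
        (candidate R (of_rat r) n (of_rat \<kappa>) (of_rat j) (of_rat A) (of_rat B) (Complex (of_rat x) (of_rat y)) s)"
      by (rule candidate_piece[OF R p(1,2) less_imp_le[OF p(3)] less_imp_le[OF p(4)] p(5) ineq c(2)])
  qed
qed

text \<open>The candidates that are pieces form a countable cover of R; each is exhausted by compact
  sets up to a null set, and a subset of a piece is a piece.\<close>

lemma compact_pieces:
  assumes R: "regular_set R" and \<tau>: "\<tau> > 1"
  obtains K :: "nat \<Rightarrow> complex set" and r \<delta> \<kappa> j A B where
    "\<And>k. compact (K k)" "\<And>k. piece (\<tau> ^ 6) (r k) (\<delta> k) (\<kappa> k) (j k) (A k) (B k) (K k)"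
    "R - (\<Union>k. K k) \<in> null_sets lebesgue"
proof -
  define cand where "cand = (\<lambda>(r::rat, n, \<kappa>::rat, j::rat, A::rat, B::rat, x::rat, y::rat, s).
    candidate R (of_rat r) n (of_rat \<kappa>) (of_rat j) (of_rat A) (of_rat B) (Complex (of_rat x) (of_rat y)) s)"
  define isp where "isp P \<longleftrightarrow> (\<exists>r \<delta> \<kappa> j A B. piece (\<tau> ^ 6) r \<delta> \<kappa> j A B P)" for P
  define \<Q> where "\<Q> = {Q \<in> range cand. isp Q}"
  have "countable \<Q>"
    unfolding \<Q>_def by (rule countable_subset[of _ "range cand"]) auto
  have Q: "Q \<in> sets borel" "bounded Q" "isp Q" if QQ: "Q \<in> \<Q>" for Q
  proof -
    obtain i where i: "Q = cand i" using QQ unfolding \<Q>_def by blast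
    have "R \<in> sets borel" using R by (simp add: regular_set_def)
    then show "Q \<in> sets borel"
      unfolding i cand_def by (auto simp: case_prod_beta intro: candidate_borel)
    show "isp Q" using QQ by (simp add: \<Q>_def)
    then have "Q \<subseteq> W" by (auto simp: isp_def piece_def)
    then show "bounded Q"
      by (rule bounded_subset[OF bounded_subset[OF bounded_ball[of 0 1]], rotated]) (use W_disc in auto)
  qed
  have cover: "R \<subseteq> \<Union>\<Q>"
  proof
    fix z assume z: "z \<in> R"
    obtain r \<kappa> j A B x y :: rat and n s where
      1: "z \<in> candidate R (of_rat r) n (of_rat \<kappa>) (of_rat j) (of_rat A) (of_rat B) (Complex (of_rat x) (of_rat y)) s"
      "piece (\<tau> ^ 6) (of_rat r) (1 / real (Suc n)) (of_rat \<kappa>) (of_rat j) (of_rat A) (of_rat B)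
      (candidate R (of_rat r) n (of_rat \<kappa>) (of_rat j) (of_rat A) (of_rat B) (Complex (of_rat x) (of_rat y)) s)"
      by (rule regular_point_in_candidate[OF R z \<tau>])
    then have "isp (cand (r, n, \<kappa>, j, A, B, x, y, s))" "z \<in> cand (r, n, \<kappa>, j, A, B, x, y, s)"
      unfolding isp_def cand_def case_prod_conv by blast+
    then show "z \<in> \<Union>\<Q>" unfolding \<Q>_def by blast
  qed
  have "\<exists>\<K>. countable \<K> \<and> (\<forall>K\<in>\<K>. compact K \<and> K \<subseteq> Q) \<and> Q - \<Union>\<K> \<in> null_sets lebesgue" if "Q \<in> \<Q>" for Q
    by (rule compact_exhaustion_ae[OF Q(1,2)[OF that]], rule exI, intro conjI ballI; simp)
  then obtain \<K> where \<K>: "\<And>Q. Q \<in> \<Q> \<Longrightarrow> countable (\<K> Q)"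
    "\<And>Q K. Q \<in> \<Q> \<Longrightarrow> K \<in> \<K> Q \<Longrightarrow> compact K \<and> K \<subseteq> Q" "\<And>Q. Q \<in> \<Q> \<Longrightarrow> Q - \<Union>(\<K> Q) \<in> null_sets lebesgue"
    by metis
  \<comment> \<open>The empty set guarantees that there is something to enumerate.\<close>
  define \<C> where "\<C> = insert {} (\<Union>Q\<in>\<Q>. \<K> Q)"
  have \<C>: "countable \<C>" "\<C> \<noteq> {}"
    using \<K>(1) \<open>countable \<Q>\<close> by (auto simp: \<C>_def)
  have isp_C: "compact K \<and> isp K" if KK: "K \<in> \<C>" for K
  proof (cases "K = {}")
    case True
    have "piece (\<tau> ^ 6) 1 1 1 0 0 1 {}"
      by (rule piece_empty) (use \<tau> in simp)
    then have "isp {}" unfolding isp_def by blast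
    then show ?thesis using True by simp
  next
    case False
    then obtain P where P: "P \<in> \<Q>" "K \<in> \<K> P" using KK by (auto simp: \<C>_def)
    obtain r \<delta> \<kappa> j A B where "piece (\<tau> ^ 6) r \<delta> \<kappa> j A B P"
      using Q(3)[OF P(1)] unfolding isp_def by blast
    then have "isp K"
      unfolding isp_def using piece_subset[of _ _ _ _ _ _ _ P K] \<K>(2)[OF P] by blast
    then show ?thesis using \<K>(2)[OF P] by simp
  qed
  define K where "K = from_nat_into \<C>"
  have rK: "range K = \<C>" unfolding K_def by (rule range_from_nat_into[OF \<C>(2,1)])
  then have KC: "K k \<in> \<C>" for k by auto
  have "\<exists>r \<delta> \<kappa> j A B. piece (\<tau> ^ 6) r \<delta> \<kappa> j A B (K k)" for k
    using isp_C[OF KC[of k]] by (simp add: isp_def)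
  then obtain r \<delta> \<kappa> j A B where pieces: "\<And>k. piece (\<tau> ^ 6) (r k) (\<delta> k) (\<kappa> k) (j k) (A k) (B k) (K k)"
    by metis
  have null: "R - (\<Union>k. K k) \<in> null_sets lebesgue"
  proof (rule null_lebesgue_subset)
    show "R - (\<Union>k. K k) \<subseteq> (\<Union>Q\<in>\<Q>. Q - \<Union>(\<K> Q))"
    proof
      fix z assume z: "z \<in> R - (\<Union>k. K k)"
      then obtain P where P: "P \<in> \<Q>" "z \<in> P" using cover by blast
      have "z \<notin> L" if "L \<in> \<K> P" for L
      proof -
        have "L \<in> range K" unfolding rK \<C>_def using P(1) that by blast
        then show ?thesis using z by blast
      qed
      then show "z \<in> (\<Union>Q\<in>\<Q>. Q - \<Union>(\<K> Q))" using P by blast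
    qed
    show "(\<Union>Q\<in>\<Q>. Q - \<Union>(\<K> Q)) \<in> null_sets lebesgue"
      using \<open>countable \<Q>\<close> \<K>(3) by (intro null_sets_UN') auto
  qed
  show ?thesis
  proof (rule that[OF _ pieces null])
    show "compact (K k)" for k
      using isp_C[OF KC] by blast
  qed
qed

end

section \<open>Exceptional null sets and the Luzin properties\<close>

locale luzin_map = surface_map +
  assumes diff: "AE p in surf_measure G F. p \<in> D \<longrightarrow> surf_differentiable G H f p"
    and N: "luzin_N (surf_measure G F) (surf_measure H FH) D f"
    and Ninv: "luzin_N_inv (surf_measure G F) (surf_measure H FH) D Ds f"
begin

text \<open>Nullity in the chart \<open>E0\<close> suffices because \<open>FH - E0\<close> is null;
  the \<open>N\<close>-inverse property does the rest.\<close>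

lemma null_pullback:
  assumes E: "E \<in> sets (surf_borel H)" "E \<subseteq> Ds" "preim H E \<inter> E0 \<in> null_sets lebesgue"
  shows "preim G {p \<in> D. f p \<in> E} \<inter> F \<in> null_sets lebesgue"
proof -
  have "E \<in> null_sets (surf_measure H FH)"
    by (rule T.null_sets_surf_borelI[OF E(1,3)])
  then have "{p \<in> D. f p \<in> E} \<in> null_sets (surf_measure G F)"
    using Ninv E(2) by (auto simp: luzin_N_inv_def)
  then show ?thesis
    by (simp add: S.null_sets_surf_measure_iff)
qed

text \<open>Apart from \<open>F - D0\<close> there are three exceptional sets: the points that f
  sends outside the chart \<open>E0\<close> (\<open>M1\<close>), the points of nondifferentiability
  (\<open>M2\<close>) and the zeros of the Jacobian (contained in \<open>M4\<close>). The first and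
  the last have null images, so the \<open>N\<close>-inverse property makes them null.\<close>

lemma regular_set_exists:
  obtains R where "regular_set R" "preim G D \<inter> F - R \<in> null_sets lebesgue"
proof -
  define M1 where "M1 = preim G {p \<in> D. f p \<in> Ds - T.\<Omega>} \<inter> F"
  have M1: "M1 \<in> null_sets lebesgue"
    unfolding M1_def
  proof (rule null_pullback)
    show "Ds - T.\<Omega> \<in> sets (surf_borel H)"
      using T.openin_surf_borel[OF open_Ds] T.\<Omega>_borel by blast
    have "preim H (Ds - T.\<Omega>) \<inter> E0 = {}"
      by (auto simp: preim_def)
    then show "preim H (Ds - T.\<Omega>) \<inter> E0 \<in> null_sets lebesgue" by simp
  qed auto
  obtain N1 where N1: "{p \<in> space (surf_measure G F). \<not> (p \<in> D \<longrightarrow> surf_differentiable G H f p)} \<subseteq> N1"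
    "N1 \<in> null_sets (surf_measure G F)"
    using diff by (auto elim: AE_E3 simp: eventually_ae_filter)
  have "preim G N1 \<inter> F \<in> null_sets lebesgue"
    using N1(2) by (simp add: S.null_sets_surf_measure_iff)
  then obtain M2 where M2: "M2 \<in> null_sets lborel" "preim G N1 \<inter> F \<subseteq> M2"
    by (auto simp: null_sets_completion_iff2)
  define R1 where "R1 = W - M2"
  have R1: "R1 \<in> sets borel" "R1 \<subseteq> W"
    using open_W M2(1) by (auto simp: R1_def)
  have deriv: "(\<Phi> has_derivative real_linear (coeff_a z) (coeff_b z)) (at z) \<and>
      dilatation G H f (orbit G z) = linear_dilatation (real_linear (coeff_a z) (coeff_b z))" if z: "z \<in> R1" for z
  proof -
    have zW: "z \<in> W" "z \<notin> M2" using z by (auto simp: R1_def)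
    have "z \<in> F" "cmod z < 1" "orbit G z \<in> D"
      using zW W_D0 S.D0_F W_disc W_D by auto
    then have "orbit G z \<notin> N1"
      using zW(2) M2(2) by (auto simp: preim_def)
    then have "surf_differentiable G H f (orbit G z)"
      using N1(1) \<open>orbit G z \<in> D\<close> D_surf by (auto simp: space_surf_measure)
    then obtain a b where "(\<Phi> has_derivative real_linear a b) (at z)"
      "dilatation G H f (orbit G z) = linear_dilatation (real_linear a b)"
      using derivative_exists[OF zW(1)] by blast
    then show ?thesis using coeff_eq[of a b z] by simp
  qed
  define R2 where "R2 = {z \<in> R1. cmod (coeff_a z) = cmod (coeff_b z)}"
  have R2: "R2 \<in> sets borel"
  proof -
    have "{z \<in> space borel. cmod (coeff_a z) = cmod (coeff_b z)} \<in> sets borel" by measurable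
    moreover have "R2 = R1 \<inter> {z \<in> space borel. cmod (coeff_a z) = cmod (coeff_b z)}" by (auto simp: R2_def)
    ultimately show ?thesis using R1 by auto
  qed
  have R2W: "R2 \<subseteq> W" using R1 by (auto simp: R2_def)
  have "bounded R2"
    by (rule bounded_subset[OF bounded_ball[of 0 1]]) (use R2W W_disc in auto)
  then have "\<Phi> ` R2 \<in> null_sets lebesgue"
    by (rule null_image_of_singular_points[OF R2, where a=coeff_a and b=coeff_b]) (use deriv in \<open>auto simp: R2_def\<close>)
  then obtain M3 where M3: "M3 \<in> null_sets lborel" "\<Phi> ` R2 \<subseteq> M3"
    by (auto simp: null_sets_completion_iff2)
  define E2 where "E2 = orbit H ` (M3 \<inter> E0) \<inter> Ds"
  define M4 where "M4 = preim G {p \<in> D. f p \<in> E2} \<inter> F"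
  have M4: "M4 \<in> null_sets lebesgue"
    unfolding M4_def
  proof (rule null_pullback)
    have "M3 \<inter> E0 \<in> sets borel" using M3(1) T.open_D0 by auto
    then have "orbit H ` (M3 \<inter> E0) \<in> sets (surf_borel H)"
      by (rule T.orbit_image_borel) auto
    then show "E2 \<in> sets (surf_borel H)"
      unfolding E2_def using T.openin_surf_borel[OF open_Ds] by blast
    show "preim H E2 \<inter> E0 \<in> null_sets lebesgue"
    proof (rule null_lebesgue_subset)
      show "preim H E2 \<inter> E0 \<subseteq> M3"
        using T.orbit_mem_image_iff[of "M3 \<inter> E0"] by (auto simp: E2_def preim_def)
      show "M3 \<in> null_sets lebesgue" using M3(1) by (auto simp: null_sets_completion_iff2)
    qed
  qed (auto simp: E2_def)
  have R2M4: "R2 \<subseteq> M4"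
  proof
    fix z assume z: "z \<in> R2"
    then have zW: "z \<in> W" using R2W by auto
    have "\<Phi> z \<in> M3 \<inter> E0" using M3(2) z \<Phi>_E0[OF zW] by auto
    then have "f (orbit G z) \<in> E2"
      using orbit_\<Phi>[OF zW] image W_D[OF zW] by (auto simp: E2_def)
    then show "z \<in> M4"
      using zW W_D0 S.D0_F W_disc W_D by (auto simp: M4_def preim_def)
  qed
  have "regular_set (R1 - R2)"
    unfolding regular_set_def
  proof (intro conjI ballI)
    show "R1 - R2 \<in> sets borel" using R1 R2 by auto
    show "R1 - R2 \<subseteq> W" using R1 by auto
    fix z assume z: "z \<in> R1 - R2"
    then show "(\<Phi> has_derivative real_linear (coeff_a z) (coeff_b z)) (at z)"
      using deriv by auto
    show ne: "cmod (coeff_a z) \<noteq> cmod (coeff_b z)" using z by (auto simp: R2_def)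
    then have "(cmod (coeff_a z))\<^sup>2 - (cmod (coeff_b z))\<^sup>2 \<noteq> 0" by simp
    then show "dilatation G H f (orbit G z) =
          ennreal ((cmod (coeff_a z) + cmod (coeff_b z)) / \<bar>cmod (coeff_a z) - cmod (coeff_b z)\<bar>)"
      using deriv z by (simp add: linear_dilatation_real_linear)
  qed
  moreover have "preim G D \<inter> F - (R1 - R2) \<in> null_sets lebesgue"
  proof (rule null_lebesgue_subset)
    show "preim G D \<inter> F - (R1 - R2) \<subseteq> (F - D0) \<union> M1 \<union> M2 \<union> M4"
    proof
      fix z assume z: "z \<in> preim G D \<inter> F - (R1 - R2)"
      show "z \<in> (F - D0) \<union> M1 \<union> M2 \<union> M4"
      proof (cases "z \<in> W")
        case True
        then show ?thesis using z R2M4 by (auto simp: R1_def)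
      next
        case False
        then show ?thesis using z image by (auto simp: W_def M1_def preim_def)
      qed
    qed
    have "M2 \<in> null_sets lebesgue" using M2(1) by (auto simp: null_sets_completion_iff2)
    then show "(F - D0) \<union> M1 \<union> M2 \<union> M4 \<in> null_sets lebesgue"
      using S.null_F_D0 M1 M4 by (intro null_sets.Un)
  qed
  ultimately show ?thesis by (rule that)
qed

end

section \<open>Transport of densities and their energy\<close>

lemma nn_integral_image_le:
  fixes f :: "complex \<Rightarrow> complex"
  assumes K: "compact K" and inj: "inj_on f K"
    and deriv: "\<And>z. z \<in> K \<Longrightarrow> (f has_derivative real_linear (a z) (b z)) (at z)"
    and j: "\<And>z. z \<in> K \<Longrightarrow> \<bar>(cmod (a z))\<^sup>2 - (cmod (b z))\<^sup>2\<bar> \<le> j" "0 \<le> j"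
    and g: "g \<in> borel_measurable borel"
  shows "(\<lambda>w. if w \<in> f ` K then inv_into K f w else 0) \<in> borel_measurable borel"
    and "(\<integral>\<^sup>+w\<in>f ` K. g (inv_into K f w) \<partial>lborel) \<le> ennreal j * (\<integral>\<^sup>+z\<in>K. g z \<partial>lborel)"
proof -
  define \<psi> where "\<psi> w = (if w \<in> f ` K then inv_into K f w else 0)" for w
  have contf: "continuous_on K f"
    using deriv by (intro continuous_at_imp_continuous_on ballI has_derivative_continuous)
  have cK: "compact (f ` K)"
    by (rule compact_continuous_image[OF contf K])
  then have fK: "f ` K \<in> sets borel"
    by (intro borel_closed compact_imp_closed)
  have KB: "K \<in> sets borel" using K by (intro borel_closed compact_imp_closed)
  have "continuous_on (f ` K) (inv_into K f)"
    by (rule continuous_on_inv[OF contf K]) (simp add: inj)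
  then have "inv_into K f \<in> borel_measurable (restrict_space borel (f ` K))"
    by (rule borel_measurable_continuous_on_restrict)
  then have m\<psi>: "\<psi> \<in> borel_measurable borel"
    unfolding \<psi>_def[abs_def] by (rule measurable_restrict_space_iff[THEN iffD1, rotated 2]) (use fK in auto)
  then show "(\<lambda>w. if w \<in> f ` K then inv_into K f w else 0) \<in> borel_measurable borel"
    by (simp add: \<psi>_def[abs_def])
  \<comment> \<open>Lebesgue measure on the image, carried back to K by the inverse. The area
    estimate, applied to every Borel subset of K, bounds this measure by j times Lebesgue
    measure.\<close>
  define M where "M = distr (density lborel (indicator (f ` K))) borel \<psi>"
  have sM: "sets M = sets lborel" by (simp add: M_def)
  have intM: "(\<integral>\<^sup>+z. h z \<partial>M) = (\<integral>\<^sup>+w\<in>f ` K. h (\<psi> w) \<partial>lborel)" if h: "h \<in> borel_measurable borel" for h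
  proof -
    have "(\<integral>\<^sup>+z. h z \<partial>M) = (\<integral>\<^sup>+w. h (\<psi> w) \<partial>density lborel (indicator (f ` K)))"
      unfolding M_def using m\<psi> h by (intro nn_integral_distr) auto
    also have "\<dots> = (\<integral>\<^sup>+w. indicator (f ` K) w * h (\<psi> w) \<partial>lborel)"
      using measurable_compose[OF m\<psi> h] fK by (intro nn_integral_density) auto
    finally show ?thesis by (simp add: mult.commute)
  qed
  have "(\<integral>\<^sup>+z\<in>K. g z \<partial>M) \<le> ennreal j * (\<integral>\<^sup>+z\<in>K. g z \<partial>lborel)"
  proof (rule nn_integral_le_of_emeasure_le[OF sM])
    fix B assume B: "B \<in> sets M" "B \<subseteq> K"
    have BB: "B \<in> sets borel" using B sM by simp
    have eq: "f ` B = \<psi> -` B \<inter> f ` K"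
      using B(2) inv_into_f_f[OF inj] by (auto simp: \<psi>_def)
    have fB: "f ` B \<in> sets borel"
      unfolding eq using measurable_sets[OF m\<psi> BB] fK by auto
    have "emeasure M B = (\<integral>\<^sup>+z. indicator B z \<partial>M)"
      using B by (intro nn_integral_indicator[symmetric]) auto
    also have "\<dots> = (\<integral>\<^sup>+w\<in>f ` K. indicator B (\<psi> w) \<partial>lborel)"
      using BB by (intro intM) auto
    also have "\<dots> = (\<integral>\<^sup>+w. indicator (f ` B) w \<partial>lborel)"
      unfolding eq by (intro nn_integral_cong) (auto simp: indicator_def)
    also have "\<dots> = emeasure lborel (f ` B)"
      using fB by (intro nn_integral_indicator) auto
    also have "\<dots> \<le> ennreal j * emeasure lborel B"
      by (rule emeasure_differentiable_image_le[OF BB bounded_subset[OF compact_imp_bounded[OF K] B(2)], where a=a and b=b])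
         (use B(2) deriv j fB in auto)
    finally show "emeasure M B \<le> ennreal j * emeasure lborel B" .
  qed (use KB g in \<open>auto simp: sM measurable_cong_sets[OF sM refl]\<close>)
  also have "(\<integral>\<^sup>+z\<in>K. g z \<partial>M) = (\<integral>\<^sup>+w\<in>f ` K. g (\<psi> w) * indicator K (\<psi> w) \<partial>lborel)"
    using g KB by (intro intM) auto
  also have "\<dots> = (\<integral>\<^sup>+w\<in>f ` K. g (inv_into K f w) \<partial>lborel)"
    by (intro nn_integral_cong) (auto simp: \<psi>_def indicator_def inv_into_into inv_into_f_f[OF inj])
  finally show "(\<integral>\<^sup>+w\<in>f ` K. g (inv_into K f w) \<partial>lborel) \<le> ennreal j * (\<integral>\<^sup>+z\<in>K. g z \<partial>lborel)" .
qed

text \<open>The square is the supremum of the products \<open>x k * x l\<close>, and such a product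
  is at most the square of its larger factor.\<close>

lemma SUP_square_le:
  fixes x :: "nat \<Rightarrow> ennreal"
  assumes "\<And>k. (x k)\<^sup>2 \<le> S"
  shows "(SUP k. x k)\<^sup>2 \<le> S"
proof -
  have "x k * x l \<le> S" for k l
  proof (cases "x k \<le> x l")
    case True
    then have "x k * x l \<le> x l * x l" by (rule mult_right_mono) simp
    then show ?thesis using assms[of l] by (simp add: power2_eq_square)
  next
    case False
    then have "x k * x l \<le> x k * x k" by (intro mult_left_mono) auto
    then show ?thesis using assms[of k] by (simp add: power2_eq_square)
  qed
  then show ?thesis
    unfolding power2_eq_square SUP_mult_right_ennreal SUP_mult_left_ennreal by (intro SUP_least)
qed

context luzin_map
begin

text \<open>The value \<open>\<infinity>\<close> on the null set \<open>Z\<close> costs no energy, and it makes admissible every curve that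
  spends positive length in the image of the points outside all pieces.\<close>

lemma transported_density:
  assumes \<rho>: "\<rho> \<in> surf_borel G \<rightarrow>\<^sub>M borel" and \<tau>: "\<tau> > 1"
  obtains \<rho>' :: "complex set \<Rightarrow> ennreal" and C :: "nat \<Rightarrow> complex set set" and r \<delta> :: "nat \<Rightarrow> real" and Z where
    "\<rho>' \<in> surf_borel H \<rightarrow>\<^sub>M borel" "\<And>k. C k \<in> sets (surf_borel G)" "disjoint_family C"
    "\<And>k. 0 < r k" "\<And>k. 0 < \<delta> k"
    "\<And>k p q. p \<in> C k \<Longrightarrow> q \<in> D \<Longrightarrow> surf_dist p q < \<delta> k \<Longrightarrow> r k * surf_dist p q \<le> surf_dist (f p) (f q)"
    "\<And>k p. p \<in> C k \<Longrightarrow> ennreal (1 / r k) * \<rho> p \<le> \<rho>' (f p)"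
    "Z \<in> sets (surf_borel H)" "\<And>p. p \<in> D \<Longrightarrow> \<forall>k. p \<notin> C k \<Longrightarrow> f p \<in> Z" "\<And>q. q \<in> Z \<Longrightarrow> \<rho>' q = \<infinity>"
    "(\<integral>\<^sup>+q. (\<rho>' q)\<^sup>2 \<partial>surf_measure H FH) \<le> ennreal (\<tau> ^ 6) * (\<integral>\<^sup>+p\<in>D. dilatation G H f p * (\<rho> p)\<^sup>2 \<partial>surf_measure G F)"
proof -
  obtain R where R: "regular_set R" "preim G D \<inter> F - R \<in> null_sets lebesgue"
    using regular_set_exists .
  obtain K :: "nat \<Rightarrow> complex set" and r \<delta> \<kappa> j A B where
    K: "\<And>k. compact (K k)" "\<And>k. piece (\<tau> ^ 6) (r k) (\<delta> k) (\<kappa> k) (j k) (A k) (B k) (K k)"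
    "R - (\<Union>k. K k) \<in> null_sets lebesgue"
    using compact_pieces[OF R(1) \<tau>] by blast
  have pos: "0 < r k" "0 < \<delta> k" "0 < \<kappa> k" "0 \<le> j k" "0 \<le> A k" "0 < B k"
    and ineq: "j k * A k \<le> \<tau> ^ 6 * \<kappa> k * B k * (r k)\<^sup>2"
    and KW: "K k \<subseteq> W" and inj: "inj_on \<Phi> (K k)" for k
    using K(2)[of k] by (simp_all add: piece_def)
  have Kz: "(\<Phi> has_derivative real_linear (coeff_a z) (coeff_b z)) (at z)"
    "\<bar>(cmod (coeff_a z))\<^sup>2 - (cmod (coeff_b z))\<^sup>2\<bar> \<le> j k"
    "hyp_density (\<Phi> z) \<le> A k" "B k \<le> hyp_density z"
    "ennreal (\<kappa> k) \<le> dilatation G H f (orbit G z)" "expands (r k) (\<delta> k) z" if "z \<in> K k" for k z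
    using K(2)[of k] that by (simp_all add: piece_def)
  have KB: "K k \<in> sets borel" for k
    using K(1)[of k] by (intro borel_closed compact_imp_closed)
  \<comment> \<open>Disjointness is bought at the price of compactness. The inverse of \<Phi> is
    therefore still taken on the compact \<open>K k\<close>, and the density \<open>u k\<close> is
    cut down to \<open>c k\<close>.\<close>
  define c where "c = disjointed K"
  have c: "c k \<subseteq> K k" "c k \<in> sets borel" "disjoint_family c" "(\<Union>k. c k) = (\<Union>k. K k)" for k
    using KB disjoint_family_disjointed[of K] UN_disjointed_eq[of K]
    by (auto simp: c_def disjointed_def)
  have cD0: "c k \<subseteq> D0" for k using c(1) KW W_D0 by blast
  define C where "C k = orbit G ` c k" for k
  have CB: "C k \<in> sets (surf_borel G)" for k
    unfolding C_def by (rule S.orbit_image_borel[OF c(2) cD0])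
  have Cdisj: "disjoint_family C"
    unfolding disjoint_family_on_def
  proof (intro ballI impI)
    fix m n :: nat assume "m \<noteq> n"
    then have "c m \<inter> c n = {}" using c(3) by (auto simp: disjoint_family_on_def)
    then show "C m \<inter> C n = {}"
      unfolding C_def using inj_on_image_Int[OF S.orbit_inj cD0 cD0, of m n] by simp
  qed
  have CE: "\<exists>z\<in>c k. p = orbit G z \<and> z \<in> K k \<and> z \<in> W \<and> p \<in> D \<and> f p = orbit H (\<Phi> z)" if p: "p \<in> C k" for k p
  proof -
    obtain z where z: "z \<in> c k" "p = orbit G z"
      using p unfolding C_def by blast
    then have "z \<in> K k" "z \<in> W"
      using c(1) KW by blast+
    then show ?thesis
      using z W_D orbit_\<Phi> by (intro bexI[of _ z]) simp_all
  qed
  define u where "u k z = \<rho> (orbit G z) * indicator (c k) z" for k z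
  have u: "u k \<in> borel_measurable borel" for k
  proof -
    have "(\<lambda>z. \<rho> (orbit G z) * indicator unit_disc z) \<in> borel_measurable borel"
      using borel_measurable_restrict_space_iff_ennreal[of unit_disc borel "\<lambda>z. \<rho> (orbit G z)"]
        measurable_compose[OF S.orbit_measurable \<rho>] by simp
    then have "(\<lambda>z. (\<rho> (orbit G z) * indicator unit_disc z) * indicator (c k) z) \<in> borel_measurable borel"
      by (rule borel_measurable_times_ennreal) (use c(2) in simp)
    also have "(\<lambda>z. (\<rho> (orbit G z) * indicator unit_disc z) * indicator (c k) z) = u k"
      using cD0[of k] S.D0_disc by (auto simp: u_def indicator_def fun_eq_iff)
    finally show ?thesis .
  qed
  define \<psi> where "\<psi> k w = (if w \<in> \<Phi> ` K k then inv_into (K k) \<Phi> w else 0)" for k w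
  have \<psi>: "\<psi> k \<in> borel_measurable borel" for k
    unfolding \<psi>_def[abs_def]
    by (rule nn_integral_image_le(1)[OF K(1) inj Kz(1,2) pos(4) borel_measurable_const]) auto
  have \<Phi>K: "\<Phi> ` K k \<in> sets borel" for k
    using compact_continuous_image[OF continuous_on_subset[OF continuous_\<Phi> KW] K(1)]
    by (intro borel_closed compact_imp_closed)
  define h where "h k w = u k (\<psi> k w) * indicator (\<Phi> ` K k) w" for k w
  have h: "h k \<in> borel_measurable borel" for k
    unfolding h_def by (intro borel_measurable_times_ennreal measurable_compose[OF \<psi> u] borel_measurable_indicator \<Phi>K)
  have h\<Phi>: "h k (\<Phi> z) = u k z" if "z \<in> K k" for k z
    using that inv_into_f_f[OF inj that] by (simp add: h_def \<psi>_def)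
  \<comment> \<open>This remainder is null and so is its image, by the \<open>N\<close>-property.
    The image need not be Borel; \<open>M5\<close> is a Borel null set that covers it in the
    plane.\<close>
  define NN where "NN = D - (\<Union>k. C k)"
  have NNB: "NN \<in> sets (surf_borel G)"
    unfolding NN_def using S.openin_surf_borel[OF open_D] CB by (intro sets.Diff sets.countable_UN) auto
  have "NN \<in> null_sets (surf_measure G F)"
    unfolding S.null_sets_surf_measure_iff
  proof (intro conjI)
    show "NN \<subseteq> surf G" using D_surf by (auto simp: NN_def)
    show "preim G NN \<in> sets hyp_area"
      using S.surf_borel_subset[OF NNB] by (simp add: sets_surf_measure)
    show "preim G NN \<inter> F \<in> null_sets lebesgue"
    proof (rule null_lebesgue_subset)
      show "preim G NN \<inter> F \<subseteq> (preim G D \<inter> F - R) \<union> (R - (\<Union>k. K k))"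
        unfolding c(4)[symmetric] by (auto simp: preim_def NN_def C_def)
      show "(preim G D \<inter> F - R) \<union> (R - (\<Union>k. K k)) \<in> null_sets lebesgue"
        using R(2) K(3) by (rule null_sets.Un)
    qed
  qed
  then have "f ` NN \<in> null_sets (surf_measure H FH)"
    using N unfolding luzin_N_def NN_def by blast
  then have "preim H (f ` NN) \<inter> FH \<in> null_sets lebesgue"
    by (simp add: T.null_sets_surf_measure_iff)
  then obtain M5 where M5: "M5 \<in> null_sets lborel" "preim H (f ` NN) \<inter> FH \<subseteq> M5"
    by (auto simp: null_sets_completion_iff2)
  \<comment> \<open>The points outside the chart are included, since \<rho>' is computed through the
    chart; they carry no area.\<close>
  define Z where "Z = (surf H - T.\<Omega>) \<union> orbit H ` (M5 \<inter> E0)"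
  have ZB: "Z \<in> sets (surf_borel H)"
  proof -
    have "surf H - T.\<Omega> \<in> sets (surf_borel H)"
      using T.\<Omega>_borel T.space_surf_borel by (metis sets.compl_sets)
    moreover have "M5 \<inter> E0 \<in> sets borel" using M5(1) T.open_D0 by auto
    then have "orbit H ` (M5 \<inter> E0) \<in> sets (surf_borel H)"
      by (rule T.orbit_image_borel) auto
    ultimately show ?thesis unfolding Z_def by blast
  qed
  have ZN: "f p \<in> Z" if p: "p \<in> D" "\<forall>k. p \<notin> C k" for p
  proof (cases "f p \<in> T.\<Omega>")
    case True
    then obtain v where v: "v \<in> E0" "f p = orbit H v" by auto
    have "p \<in> NN" using p by (auto simp: NN_def)
    then have "orbit H v \<in> f ` NN" using v(2) by (metis imageI)
    then have "v \<in> preim H (f ` NN) \<inter> FH"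
      using v(1) T.in_D0 T.D0_F by (auto simp: preim_def)
    then show ?thesis using M5(2) v by (auto simp: Z_def)
  next
    case False
    then show ?thesis using f_surf[OF p(1)] by (simp add: Z_def)
  qed
  \<comment> \<open>\<open>h k\<close> vanishes off the image of \<open>K k\<close>, so at q only
    those pieces contribute whose image contains q.\<close>
  define \<rho>' where "\<rho>' q = (if q \<in> Z then \<infinity> else (SUP k. ennreal (1 / r k) * h k (T.sheet_ext q)))" for q
  have \<rho>'m: "\<rho>' \<in> surf_borel H \<rightarrow>\<^sub>M borel"
    unfolding \<rho>'_def[abs_def]
  proof (rule measurable_If_set)
    show "(\<lambda>q. SUP k. ennreal (1 / r k) * h k (T.sheet_ext q)) \<in> surf_borel H \<rightarrow>\<^sub>M borel"
      by (intro borel_measurable_SUP borel_measurable_times_ennreal borel_measurable_const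
          measurable_compose[OF T.sheet_measurable h]) auto
  qed (use ZB in auto)
  have le: "ennreal (1 / r k) * \<rho> p \<le> \<rho>' (f p)" if p: "p \<in> C k" for k p
  proof (cases "f p \<in> Z")
    case False
    obtain z where z: "z \<in> c k" "p = orbit G z" "z \<in> K k" "z \<in> W" "f p = orbit H (\<Phi> z)"
      using CE[OF p] by blast
    have "ennreal (1 / r k) * \<rho> p = ennreal (1 / r k) * h k (T.sheet_ext (f p))"
      using z h\<Phi>[OF z(3)] T.sheet_ext_orbit[OF \<Phi>_E0[OF z(4)]] by (simp add: u_def)
    also have "\<dots> \<le> \<rho>' (f p)"
      using False by (simp add: \<rho>'_def) (rule SUP_upper, simp)
    finally show ?thesis .
  qed (simp add: \<rho>'_def)
  have ex: "r k * surf_dist p q \<le> surf_dist (f p) (f q)"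
    if p: "p \<in> C k" and q: "q \<in> D" "surf_dist p q < \<delta> k" for k p q
  proof -
    obtain z where z: "p = orbit G z" "z \<in> K k"
      using CE[OF p] by blast
    show ?thesis using Kz(6)[OF z(2)] q unfolding expands_def z(1) by blast
  qed
  let ?w = "\<lambda>z. ennreal (hyp_density z)"
  define U where "U k = (\<integral>\<^sup>+z. ?w z * (u k z)\<^sup>2 \<partial>lborel)" for k
  have u2: "(\<lambda>z. (u k z)\<^sup>2) \<in> borel_measurable borel" for k
    using u[of k] by (rule borel_measurable_power_ennreal)
  have h2: "(\<lambda>z. (h k z)\<^sup>2) \<in> borel_measurable borel" for k
    using h[of k] by (rule borel_measurable_power_ennreal)
  \<comment> \<open>The target density is at most A, the Jacobian at most j and the source density
    at least B. The resulting constant jA/(B r^2) is controlled by the inequality in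
    \<open>piece\<close>.\<close>
  have step: "(\<integral>\<^sup>+w. ?w w * (ennreal (1 / r k) * h k w)\<^sup>2 \<partial>lborel) \<le> ennreal (\<tau> ^ 6 * \<kappa> k) * U k" for k
  proof -
    have "(\<integral>\<^sup>+w. ?w w * (ennreal (1 / r k) * h k w)\<^sup>2 \<partial>lborel)
        \<le> (\<integral>\<^sup>+w. ennreal (A k / (r k)\<^sup>2) * ((u k (inv_into (K k) \<Phi> w))\<^sup>2 * indicator (\<Phi> ` K k) w) \<partial>lborel)"
    proof (rule nn_integral_mono)
      fix w
      show "?w w * (ennreal (1 / r k) * h k w)\<^sup>2
          \<le> ennreal (A k / (r k)\<^sup>2) * ((u k (inv_into (K k) \<Phi> w))\<^sup>2 * indicator (\<Phi> ` K k) w)"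
      proof (cases "w \<in> \<Phi> ` K k")
        case True
        then have "hyp_density w \<le> A k" using Kz(3) by auto
        moreover have "(ennreal (1 / r k))\<^sup>2 = ennreal (1 / (r k)\<^sup>2)"
          using pos(1)[of k] by (simp add: ennreal_power power_one_over)
        moreover have "ennreal (A k) * ennreal (1 / (r k)\<^sup>2) = ennreal (A k / (r k)\<^sup>2)"
          using pos[of k] by (simp add: ennreal_mult[symmetric])
        ultimately show ?thesis
          using True by (simp add: h_def \<psi>_def power_mult_distrib mult.assoc[symmetric])
            (metis ennreal_leI mult_right_mono zero_le)
      qed (simp add: h_def)
    qed
    also have "\<dots> = ennreal (A k / (r k)\<^sup>2) * (\<integral>\<^sup>+w\<in>\<Phi> ` K k. (u k (inv_into (K k) \<Phi> w))\<^sup>2 \<partial>lborel)"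
    proof (rule nn_integral_cmult)
      have "(\<lambda>w. (u k (\<psi> k w))\<^sup>2 * indicator (\<Phi> ` K k) w) \<in> borel_measurable lborel"
        using measurable_compose[OF \<psi> u2] \<Phi>K by (intro borel_measurable_times_ennreal) auto
      also have "(\<lambda>w. (u k (\<psi> k w))\<^sup>2 * indicator (\<Phi> ` K k) w) = (\<lambda>w. (u k (inv_into (K k) \<Phi> w))\<^sup>2 * indicator (\<Phi> ` K k) w)"
        by (auto simp: \<psi>_def indicator_def fun_eq_iff)
      finally show "(\<lambda>w. (u k (inv_into (K k) \<Phi> w))\<^sup>2 * indicator (\<Phi> ` K k) w) \<in> borel_measurable lborel" .
    qed
    also have "\<dots> \<le> ennreal (A k / (r k)\<^sup>2) * (ennreal (j k) * (\<integral>\<^sup>+z\<in>K k. (u k z)\<^sup>2 \<partial>lborel))"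
      by (intro mult_left_mono nn_integral_image_le(2)[OF K(1) inj Kz(1,2) pos(4) u2]) auto
    also have "\<dots> \<le> ennreal (A k / (r k)\<^sup>2) * (ennreal (j k) * (ennreal (1 / B k) * U k))"
    proof (intro mult_left_mono)
      have "(\<integral>\<^sup>+z\<in>K k. (u k z)\<^sup>2 \<partial>lborel) \<le> (\<integral>\<^sup>+z. ennreal (1 / B k) * (?w z * (u k z)\<^sup>2) \<partial>lborel)"
      proof (rule nn_integral_mono)
        fix z
        show "(u k z)\<^sup>2 * indicator (K k) z \<le> ennreal (1 / B k) * (?w z * (u k z)\<^sup>2)"
        proof (cases "z \<in> K k")
          case True
          have "1 \<le> 1 / B k * hyp_density z"
            using Kz(4)[OF True] pos(6)[of k] by (simp add: field_simps)
          then have "ennreal 1 \<le> ennreal (1 / B k) * ?w z"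
            using pos(6)[of k] Kz(4)[OF True] by (subst ennreal_mult[symmetric]) (auto intro!: ennreal_leI)
          then have "1 * (u k z)\<^sup>2 \<le> (ennreal (1 / B k) * ?w z) * (u k z)\<^sup>2"
            by (intro mult_right_mono) auto
          then show ?thesis using True by (simp add: mult.assoc)
        qed simp
      qed
      also have "\<dots> = ennreal (1 / B k) * U k"
        unfolding U_def using u2 by (intro nn_integral_cmult borel_measurable_times_ennreal) auto
      finally show "(\<integral>\<^sup>+z\<in>K k. (u k z)\<^sup>2 \<partial>lborel) \<le> ennreal (1 / B k) * U k" .
    qed auto
    also have "\<dots> = ennreal (A k / (r k)\<^sup>2 * (j k * (1 / B k))) * U k"
    proof -
      have 1: "ennreal (j k * (1 / B k)) = ennreal (j k) * ennreal (1 / B k)"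
        by (rule ennreal_mult) (use pos[of k] in auto)
      have 2: "ennreal (A k / (r k)\<^sup>2 * (j k * (1 / B k))) = ennreal (A k / (r k)\<^sup>2) * ennreal (j k * (1 / B k))"
        by (rule ennreal_mult) (use pos[of k] in auto)
      show ?thesis
        unfolding 1 2 by (simp only: mult.assoc)
    qed
    also have "\<dots> \<le> ennreal (\<tau> ^ 6 * \<kappa> k) * U k"
    proof (intro mult_right_mono ennreal_leI)
      have "A k / (r k)\<^sup>2 * (j k * (1 / B k)) = (j k * A k) / (B k * (r k)\<^sup>2)"
        by (simp add: mult.commute)
      also have "\<dots> \<le> (\<tau> ^ 6 * \<kappa> k * B k * (r k)\<^sup>2) / (B k * (r k)\<^sup>2)"
        using ineq[of k] pos(6)[of k] by (intro divide_right_mono) auto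
      also have "\<dots> = \<tau> ^ 6 * \<kappa> k"
        using pos[of k] by simp
      finally show "A k / (r k)\<^sup>2 * (j k * (1 / B k)) \<le> \<tau> ^ 6 * \<kappa> k" .
    qed simp
    finally show ?thesis .
  qed
  have "(\<integral>\<^sup>+q. (\<rho>' q)\<^sup>2 \<partial>surf_measure H FH) = (\<integral>\<^sup>+w\<in>E0. ?w w * (\<rho>' (orbit H w))\<^sup>2 \<partial>lborel)"
    by (rule T.nn_integral_surf_measure) (rule borel_measurable_power_ennreal[OF \<rho>'m])
  also have "\<dots> \<le> (\<integral>\<^sup>+w. (\<Sum>k. ?w w * (ennreal (1 / r k) * h k w)\<^sup>2) \<partial>lborel)"
  proof (rule nn_integral_mono_AE)
    have "AE w in lborel. w \<notin> M5" using M5(1) by (rule AE_not_in)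
    then show "AE w in lborel. ?w w * (\<rho>' (orbit H w))\<^sup>2 * indicator E0 w \<le> (\<Sum>k. ?w w * (ennreal (1 / r k) * h k w)\<^sup>2)"
    proof (rule AE_mp, intro AE_I2 impI)
      fix w assume w: "w \<notin> M5"
      show "?w w * (\<rho>' (orbit H w))\<^sup>2 * indicator E0 w \<le> (\<Sum>k. ?w w * (ennreal (1 / r k) * h k w)\<^sup>2)"
      proof (cases "w \<in> E0")
        case True
        \<comment> \<open>Points of \<open>E0\<close> lie in the chart, so only \<open>M5\<close>
          could bring their orbits into Z.\<close>
        have "orbit H w \<notin> Z"
          using w True T.orbit_mem_image_iff[of "M5 \<inter> E0" w] by (auto simp: Z_def)
        then have "(\<rho>' (orbit H w))\<^sup>2 = (SUP k. ennreal (1 / r k) * h k w)\<^sup>2"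
          using True by (simp add: \<rho>'_def T.sheet_ext_orbit)
        also have "\<dots> \<le> (\<Sum>k. (ennreal (1 / r k) * h k w)\<^sup>2)"
          by (rule SUP_square_le) (rule ennreal_le_suminf)
        finally have "?w w * (\<rho>' (orbit H w))\<^sup>2 \<le> ?w w * (\<Sum>k. (ennreal (1 / r k) * h k w)\<^sup>2)"
          by (intro mult_left_mono) auto
        then show ?thesis using True by simp
      qed simp
    qed
  qed
  also have "\<dots> = (\<Sum>k. \<integral>\<^sup>+w. ?w w * (ennreal (1 / r k) * h k w)\<^sup>2 \<partial>lborel)"
    using h by (intro nn_integral_suminf borel_measurable_times_ennreal borel_measurable_power_ennreal) auto
  also have "\<dots> \<le> (\<Sum>k. ennreal (\<tau> ^ 6) * (ennreal (\<kappa> k) * U k))"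
  proof (rule suminf_le)
    show "(\<integral>\<^sup>+w. ?w w * (ennreal (1 / r k) * h k w)\<^sup>2 \<partial>lborel) \<le> ennreal (\<tau> ^ 6) * (ennreal (\<kappa> k) * U k)" for k
      using step[of k] pos(3)[of k] \<tau> by (simp add: ennreal_mult mult.assoc)
  qed auto
  also have "\<dots> = ennreal (\<tau> ^ 6) * (\<Sum>k. ennreal (\<kappa> k) * U k)" by simp
  also have "(\<Sum>k. ennreal (\<kappa> k) * U k) = (\<Sum>k. \<integral>\<^sup>+p. ennreal (\<kappa> k) * (\<rho> p)\<^sup>2 * indicator (C k) p \<partial>surf_measure G F)"
  proof (rule suminf_cong)
    fix k
    have m: "(\<lambda>p. ennreal (\<kappa> k) * (\<rho> p)\<^sup>2 * indicator (C k) p) \<in> surf_borel G \<rightarrow>\<^sub>M borel"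
      using \<rho> CB by (intro borel_measurable_times_ennreal borel_measurable_power_ennreal) auto
    have "(\<integral>\<^sup>+p. ennreal (\<kappa> k) * (\<rho> p)\<^sup>2 * indicator (C k) p \<partial>surf_measure G F)
        = (\<integral>\<^sup>+z\<in>D0. ?w z * (ennreal (\<kappa> k) * (\<rho> (orbit G z))\<^sup>2 * indicator (C k) (orbit G z)) \<partial>lborel)"
      by (rule S.nn_integral_surf_measure[OF m])
    also have "\<dots> = (\<integral>\<^sup>+z. ennreal (\<kappa> k) * (?w z * (u k z)\<^sup>2) \<partial>lborel)"
    proof (rule nn_integral_cong)
      fix z
      show "?w z * (ennreal (\<kappa> k) * (\<rho> (orbit G z))\<^sup>2 * indicator (C k) (orbit G z)) * indicator D0 z
          = ennreal (\<kappa> k) * (?w z * (u k z)\<^sup>2)"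
      proof (cases "z \<in> D0")
        case True
        then show ?thesis
          using S.orbit_mem_image_iff[OF cD0 True, of k]
          by (cases "z \<in> c k") (simp_all add: C_def u_def mult_ac)
      next
        case False
        then have "z \<notin> c k" using cD0 by blast
        then show ?thesis using False by (simp add: u_def)
      qed
    qed
    also have "\<dots> = ennreal (\<kappa> k) * U k"
      unfolding U_def using u2 by (intro nn_integral_cmult borel_measurable_times_ennreal) auto
    finally show "ennreal (\<kappa> k) * U k = (\<integral>\<^sup>+p. ennreal (\<kappa> k) * (\<rho> p)\<^sup>2 * indicator (C k) p \<partial>surf_measure G F)" by simp
  qed
  also have "\<dots> = (\<integral>\<^sup>+p. (\<Sum>k. ennreal (\<kappa> k) * (\<rho> p)\<^sup>2 * indicator (C k) p) \<partial>surf_measure G F)"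
  proof (rule nn_integral_suminf[symmetric])
    show "(\<lambda>p. ennreal (\<kappa> k) * (\<rho> p)\<^sup>2 * indicator (C k) p) \<in> borel_measurable (surf_measure G F)" for k
      by (rule S.surf_borel_measurable_imp) (use \<rho> CB in \<open>intro borel_measurable_times_ennreal borel_measurable_power_ennreal; auto\<close>)
  qed
  also have "\<dots> \<le> (\<integral>\<^sup>+p\<in>D. dilatation G H f p * (\<rho> p)\<^sup>2 \<partial>surf_measure G F)"
  proof (rule nn_integral_mono)
    fix p
    show "(\<Sum>k. ennreal (\<kappa> k) * (\<rho> p)\<^sup>2 * indicator (C k) p) \<le> dilatation G H f p * (\<rho> p)\<^sup>2 * indicator D p"
    proof (cases "\<exists>k. p \<in> C k")
      case True
      then obtain k where k: "p \<in> C k" by auto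
      \<comment> \<open>At most one piece contains p, so the sum reduces to a single term, where
        \<kappa> is below the dilatation.\<close>
      have uniq: "i = k" if "p \<in> C i" for i
        using that k Cdisj by (auto simp: disjoint_family_on_def)
      have "(\<lambda>i. ennreal (\<kappa> i) * (\<rho> p)\<^sup>2 * indicator (C i) p) = (\<lambda>i. if i = k then ennreal (\<kappa> k) * (\<rho> p)\<^sup>2 else 0)"
      proof
        fix i
        show "ennreal (\<kappa> i) * (\<rho> p)\<^sup>2 * indicator (C i) p = (if i = k then ennreal (\<kappa> k) * (\<rho> p)\<^sup>2 else 0)"
          using k uniq[of i] by (cases "i = k") (auto simp: indicator_def)
      qed
      then have "(\<Sum>i. ennreal (\<kappa> i) * (\<rho> p)\<^sup>2 * indicator (C i) p) = ennreal (\<kappa> k) * (\<rho> p)\<^sup>2"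
        by (simp add: sums_unique[OF sums_single, symmetric])
      also have "\<dots> \<le> dilatation G H f p * (\<rho> p)\<^sup>2 * indicator D p"
      proof -
        obtain z where "p = orbit G z" "z \<in> K k" "p \<in> D" using CE[OF k] by blast
        then show ?thesis using Kz(5)[of z k] by (simp add: mult_right_mono)
      qed
      finally show ?thesis .
    qed simp
  qed
  finally have energy: "(\<integral>\<^sup>+q. (\<rho>' q)\<^sup>2 \<partial>surf_measure H FH) \<le> ennreal (\<tau> ^ 6) * (\<integral>\<^sup>+p\<in>D. dilatation G H f p * (\<rho> p)\<^sup>2 \<partial>surf_measure G F)"
    by (simp add: mult_left_mono)
  show ?thesis
    by (rule that[OF \<rho>'m CB Cdisj pos(1,2) ex le ZB ZN _ energy]) (simp_all add: \<rho>'_def)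
qed

end

section \<open>Exceptional curves and the limit of \<tau> towards 1\<close>

lemma nn_integral_max_square_le:
  fixes u v :: "'a \<Rightarrow> ennreal"
  assumes "u \<in> borel_measurable M" "v \<in> borel_measurable M"
  shows "(\<integral>\<^sup>+x. (max (u x) (v x))\<^sup>2 \<partial>M) \<le> (\<integral>\<^sup>+x. (u x)\<^sup>2 \<partial>M) + (\<integral>\<^sup>+x. (v x)\<^sup>2 \<partial>M)"
proof -
  have "(\<integral>\<^sup>+x. (max (u x) (v x))\<^sup>2 \<partial>M) \<le> (\<integral>\<^sup>+x. (u x)\<^sup>2 + (v x)\<^sup>2 \<partial>M)"
    by (intro nn_integral_mono) (auto simp: max_def)
  also have "\<dots> = (\<integral>\<^sup>+x. (u x)\<^sup>2 \<partial>M) + (\<integral>\<^sup>+x. (v x)\<^sup>2 \<partial>M)"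
    using assms by (intro nn_integral_add borel_measurable_power_ennreal)
  finally show ?thesis .
qed

lemma line_integral_mono: "(\<And>p. \<rho> p \<le> \<rho>' p) \<Longrightarrow> line_integral c \<rho> \<le> line_integral c \<rho>'"
  unfolding line_integral_def by (intro nn_integral_mono mult_right_mono) auto

lemma le_of_le_power_mult:
  fixes x y :: ennreal
  assumes le: "\<And>\<tau>. \<tau> > 1 \<Longrightarrow> x \<le> ennreal (\<tau> ^ 6) * y"
  shows "x \<le> y"
proof (cases y)
  case (real Y)
  show ?thesis
  proof (rule ennreal_le_epsilon)
    fix e :: real assume e: "e > 0"
    \<comment> \<open>Chosen so that the sixth power exceeds 1 by e/(Y + 1); the added 1 covers Y =
      0.\<close>
    define \<tau> where "\<tau> = root 6 (1 + e / (Y + 1))"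
    have "1 + e / (Y + 1) > 1" using e real by simp
    then have \<tau>: "\<tau> > 1" "\<tau> ^ 6 = 1 + e / (Y + 1)"
      unfolding \<tau>_def by (auto intro: real_root_pow_pos2)
    have "x \<le> ennreal ((1 + e / (Y + 1)) * Y)"
      using le[OF \<tau>(1)] real e unfolding \<tau>(2) by (simp add: ennreal_mult)
    also have "\<dots> \<le> ennreal (Y + e)"
      using real e by (intro ennreal_leI) (simp add: field_simps)
    finally show "x \<le> y + ennreal e"
      using real e by simp
  qed
qed simp

lemma (in surface_map) image_curve_in:
  assumes "c \<in> curves_in G D"
  shows "image_curve f c \<in> curves_in H (f ` D)"
proof -
  obtain \<Delta> \<gamma> where c: "c = (\<Delta>, \<gamma>)" "curve_interval \<Delta>"
    "continuous_map (top_of_set \<Delta>) (surf_topology G) \<gamma>" "\<gamma> ` \<Delta> \<subseteq> D"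
    using assms by (auto simp: curves_in_def)
  have "continuous_map (top_of_set \<Delta>) (subtopology (surf_topology G) D) \<gamma>"
    using c(3,4) by (intro continuous_map_into_subtopology) auto
  then have "continuous_map (top_of_set \<Delta>) (subtopology (surf_topology H) Ds) (f \<circ> \<gamma>)"
    using cont by (rule continuous_map_compose)
  then have "continuous_map (top_of_set \<Delta>) (surf_topology H) (f \<circ> \<gamma>)"
    by (rule continuous_map_into_fulltopology)
  then show ?thesis
    using c by (auto simp: curves_in_def image_curve_def)
qed

text \<open>The restriction of \<gamma> to {t..u} is itself a curve in D, so \<open>nc\<close>
  applies to it and yields \<open>no_collapse\<close>. A curve needs an interval of positive length,
  hence the separate case t = u.\<close>

lemma (in surface_map) lifted_curve_of_nonconstant:
  assumes c: "(\<Delta>, \<gamma>) \<in> curves_in G D" and rect: "locally_rectifiable (\<Delta>, \<gamma>)"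
    and rect': "locally_rectifiable (image_curve f (\<Delta>, \<gamma>))"
    and nc: "\<forall>(\<Delta>, \<gamma>) \<in> curves_in G D. f \<circ> \<gamma> constant_on \<Delta> \<longrightarrow> \<gamma> constant_on \<Delta>"
  shows "lifted_curve G H \<Delta> \<gamma> f"
proof -
  have \<gamma>: "curve_interval \<Delta>" "continuous_map (top_of_set \<Delta>) (surf_topology G) \<gamma>" "\<gamma> ` \<Delta> \<subseteq> D"
    using c by (auto simp: curves_in_def)
  have "image_curve f (\<Delta>, \<gamma>) \<in> curves_in H (f ` D)"
    by (rule image_curve_in[OF c])
  then have f\<gamma>: "continuous_map (top_of_set \<Delta>) (surf_topology H) (f \<circ> \<gamma>)"
    by (auto simp: curves_in_def image_curve_def)
  show ?thesis
  proof unfold_locales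
    show "locally_rectifiable (\<Delta>, f \<circ> \<gamma>)"
      using rect' by (simp add: image_curve_def)
    fix t u assume tu: "t \<in> \<Delta>" "u \<in> \<Delta>" "t \<le> u" and const: "\<And>v. v \<in> {t..u} \<Longrightarrow> f (\<gamma> v) = f (\<gamma> t)"
    show "\<forall>v\<in>{t..u}. \<gamma> v = \<gamma> t"
    proof (cases "t = u")
      case False
      with tu have "t < u" by simp
      have sub: "{t..u} \<subseteq> \<Delta>" by (rule curve_interval_convex[OF \<gamma>(1) tu(1,2)])
      have "curve_interval {t..u}" using \<open>t < u\<close> by (auto simp: curve_interval_def)
      moreover have "continuous_map (top_of_set {t..u}) (surf_topology G) \<gamma>"
        by (rule continuous_map_from_subtopology_mono[OF \<gamma>(2) sub])
      ultimately have "({t..u}, \<gamma>) \<in> curves_in G D"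
        using \<gamma>(3) sub by (auto simp: curves_in_def)
      moreover have "f \<circ> \<gamma> constant_on {t..u}"
        unfolding constant_on_def comp_def by (rule exI[of _ "f (\<gamma> t)"]) (rule ballI, rule const)
      ultimately have "\<gamma> constant_on {t..u}"
        using nc by blast
      then obtain y where "\<forall>v\<in>{t..u}. \<gamma> v = y"
        unfolding constant_on_def by blast
      then show ?thesis using tu(3) by simp
    qed simp
  qed (use \<gamma> f\<gamma> rect in auto)
qed

text \<open>The image curves that violate the \<open>ACP_inv\<close> condition have modulus zero, so
  some \<open>\<rho>0\<close> of energy below e is admissible for them. The maximum of \<rho>' and
  \<open>\<rho>0\<close> serves all image curves, and its energy is at most the sum of the
  two.\<close>

lemma (in luzin_map) modulus_image_le:
  assumes ACP: "ACP_inv G H FH D f"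
    and \<Gamma>: "\<Gamma> \<subseteq> {c \<in> curves_in G D. locally_rectifiable c}"
    and adm: "\<rho> \<in> adm G \<Gamma>" and \<tau>: "\<tau> > 1"
  shows "modulus H FH (image_curve f ` \<Gamma>)
    \<le> ennreal (\<tau> ^ 6) * (\<integral>\<^sup>+p\<in>D. dilatation G H f p * (\<rho> p)\<^sup>2 \<partial>surf_measure G F)"
proof (rule ennreal_le_epsilon)
  fix e :: real assume e: "e > 0"
  define P where "P c' \<longleftrightarrow> (locally_rectifiable c' \<longrightarrow>
          (\<forall>c. is_lift G D f c c' \<longrightarrow>
             locally_rectifiable c \<and>
             (\<forall>u v. u \<le> v \<and> {u..v} \<subseteq> length_range c' \<longrightarrow>
                abs_continuous_on_interval (L_inv f c) u v)))" for c'
  define E where "E = {c \<in> curves_in H (f ` D). \<not> P c}"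
  have nc: "\<forall>(\<Delta>, \<gamma>) \<in> curves_in G D. f \<circ> \<gamma> constant_on \<Delta> \<longrightarrow> \<gamma> constant_on \<Delta>"
    and "almost_all_curves_in H FH (f ` D) P"
    using ACP unfolding ACP_inv_def P_def[abs_def] by auto
  then have "modulus H FH E = 0"
    by (simp add: almost_all_curves_in_def E_def)
  then have "(INF \<rho>\<in>adm H E. \<integral>\<^sup>+ p. (\<rho> p)\<^sup>2 \<partial>surf_measure H FH) < ennreal e"
    using e by (simp add: modulus_def)
  then obtain \<rho>0 where \<rho>0: "\<rho>0 \<in> adm H E" "(\<integral>\<^sup>+ p. (\<rho>0 p)\<^sup>2 \<partial>surf_measure H FH) < ennreal e"
    unfolding INF_less_iff by blast
  have \<rho>: "\<rho> \<in> surf_borel G \<rightarrow>\<^sub>M borel" and \<rho>0m: "\<rho>0 \<in> surf_borel H \<rightarrow>\<^sub>M borel"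
    using adm \<rho>0(1) by (auto simp: adm_def)
  from transported_density[OF \<rho> \<tau>]
  obtain \<rho>' :: "complex set \<Rightarrow> ennreal" and C :: "nat \<Rightarrow> complex set set" and r \<delta> :: "nat \<Rightarrow> real" and Z where
    tr: "\<rho>' \<in> surf_borel H \<rightarrow>\<^sub>M borel" "\<And>k. C k \<in> sets (surf_borel G)" "disjoint_family C"
    "\<And>k. 0 < r k" "\<And>k. 0 < \<delta> k"
    "\<And>k p q. p \<in> C k \<Longrightarrow> q \<in> D \<Longrightarrow> surf_dist p q < \<delta> k \<Longrightarrow> r k * surf_dist p q \<le> surf_dist (f p) (f q)"
    "\<And>k p. p \<in> C k \<Longrightarrow> ennreal (1 / r k) * \<rho> p \<le> \<rho>' (f p)"
    "Z \<in> sets (surf_borel H)" "\<And>p. p \<in> D \<Longrightarrow> \<forall>k. p \<notin> C k \<Longrightarrow> f p \<in> Z" "\<And>q. q \<in> Z \<Longrightarrow> \<rho>' q = \<infinity>"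
    "(\<integral>\<^sup>+q. (\<rho>' q)\<^sup>2 \<partial>surf_measure H FH) \<le> ennreal (\<tau> ^ 6) * (\<integral>\<^sup>+p\<in>D. dilatation G H f p * (\<rho> p)\<^sup>2 \<partial>surf_measure G F)"
    by blast
  define \<rho>1 where "\<rho>1 q = max (\<rho>' q) (\<rho>0 q)" for q
  have "\<rho>1 \<in> adm H (image_curve f ` \<Gamma>)"
    unfolding adm_def
  proof (intro CollectI conjI ballI impI)
    show "\<rho>1 \<in> surf_borel H \<rightarrow>\<^sub>M borel"
      unfolding \<rho>1_def[abs_def] using \<rho>0m tr(1) by (rule borel_measurable_max)
    fix c' assume c': "c' \<in> image_curve f ` \<Gamma>" "locally_rectifiable c'"
    then obtain \<Delta> \<gamma> where c: "(\<Delta>, \<gamma>) \<in> \<Gamma>" "c' = image_curve f (\<Delta>, \<gamma>)" by auto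
    have cD: "(\<Delta>, \<gamma>) \<in> curves_in G D" "locally_rectifiable (\<Delta>, \<gamma>)"
      using c(1) \<Gamma> by auto
    show "1 \<le> line_integral c' \<rho>1"
    proof (cases "P c'")
      case False
      then have "c' \<in> E"
        using image_curve_in[OF cD(1)] c(2) by (simp add: E_def)
      then have "1 \<le> line_integral c' \<rho>0"
        using \<rho>0(1) c'(2) by (auto simp: adm_def)
      also have "\<dots> \<le> line_integral c' \<rho>1"
        by (rule line_integral_mono) (simp add: \<rho>1_def)
      finally show ?thesis .
    next
      case True
      interpret lifted_curve G H \<Delta> \<gamma> f
        using lifted_curve_of_nonconstant[OF cD _ nc] c' c(2) by simp
      have \<gamma>D: "\<gamma> t \<in> D" if "t \<in> \<Delta>" for t
        using cD(1) that by (auto simp: curves_in_def)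
      have lift: "is_lift G D f (\<Delta>, \<gamma>) c'"
        using cD(1) by (simp add: is_lift_def c(2) image_curve_def)
      have AC: "abs_continuous_on_interval \<phi> u v" if "u \<le> v" "{u..v} \<subseteq> B.I" for u v
      proof -
        have "{u..v} \<subseteq> length_range c'"
          using that(2) by (simp add: c(2) image_curve_def)
        then show ?thesis
          using True c'(2) lift that(1) unfolding P_def by blast
      qed
      have "1 \<le> line_integral (\<Delta>, \<gamma>) \<rho>"
        using adm c(1) cD(2) by (auto simp: adm_def)
      also have "\<dots> \<le> line_integral c' \<rho>'"
        unfolding c(2)
        by (rule line_integral_le[OF AC \<rho> tr(1,2,3,4,5) tr(6)[OF _ \<gamma>D] tr(7) tr(8) tr(9)[OF \<gamma>D] tr(10)])
      also have "\<dots> \<le> line_integral c' \<rho>1"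
        by (rule line_integral_mono) (simp add: \<rho>1_def)
      finally show ?thesis .
    qed
  qed
  then have "modulus H FH (image_curve f ` \<Gamma>) \<le> (\<integral>\<^sup>+q. (\<rho>1 q)\<^sup>2 \<partial>surf_measure H FH)"
    unfolding modulus_def by (rule INF_lower)
  also have "\<dots> \<le> (\<integral>\<^sup>+q. (\<rho>' q)\<^sup>2 \<partial>surf_measure H FH) + (\<integral>\<^sup>+q. (\<rho>0 q)\<^sup>2 \<partial>surf_measure H FH)"
    unfolding \<rho>1_def by (intro nn_integral_max_square_le T.surf_borel_measurable_imp tr(1) \<rho>0m)
  also have "\<dots> \<le> ennreal (\<tau> ^ 6) * (\<integral>\<^sup>+p\<in>D. dilatation G H f p * (\<rho> p)\<^sup>2 \<partial>surf_measure G F) + ennreal e"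
    using tr(11) \<rho>0(2) by (intro add_mono) auto
  finally show "modulus H FH (image_curve f ` \<Gamma>)
    \<le> ennreal (\<tau> ^ 6) * (\<integral>\<^sup>+p\<in>D. dilatation G H f p * (\<rho> p)\<^sup>2 \<partial>surf_measure G F) + ennreal e" .
qed

theorem mainTheorem1:
  fixes G G\<^sub>s :: "(complex \<Rightarrow> complex) set"
    and F F\<^sub>s :: "complex set"
    and D D\<^sub>s :: "complex set set"
    and f :: "complex set \<Rightarrow> complex set"
    and \<Gamma> :: "curve set"
    and \<rho> :: "complex set \<Rightarrow> ennreal"
  assumes "disc_group G" and "disc_group G\<^sub>s"
    and "fundamental_set G F" and "fundamental_set G\<^sub>s F\<^sub>s"
    and "surf_domain G D" and "surf_domain G\<^sub>s D\<^sub>s"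
    and "compactin (surf_topology G) (surf_topology G closure_of D)"
    and "compactin (surf_topology G\<^sub>s) (surf_topology G\<^sub>s closure_of D\<^sub>s)"
    and "continuous_map (subtopology (surf_topology G) D) (subtopology (surf_topology G\<^sub>s) D\<^sub>s) f"
    and "f ` D = D\<^sub>s"
    and "AE p in surf_measure G F. p \<in> D \<longrightarrow> surf_differentiable G G\<^sub>s f p"
    and "ACP_inv G G\<^sub>s F\<^sub>s D f"
    and "luzin_N (surf_measure G F) (surf_measure G\<^sub>s F\<^sub>s) D f"
    and "luzin_N_inv (surf_measure G F) (surf_measure G\<^sub>s F\<^sub>s) D D\<^sub>s f"
    and "\<Gamma> \<subseteq> {c \<in> curves_in G D. locally_rectifiable c}"
    and "\<rho> \<in> adm G \<Gamma>"
  shows "modulus G\<^sub>s F\<^sub>s (image_curve f ` \<Gamma>)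
           \<le> (\<integral>\<^sup>+ p \<in> D. dilatation G G\<^sub>s f p * (\<rho> p)\<^sup>2 \<partial>surf_measure G F)"
proof -
  obtain D0 where D0: "fundamental_domain G F D0"
    using deck_group.fundamental_domain_exists[OF deck_group.intro] assms(1,3) by blast
  obtain E0 where E0: "fundamental_domain G\<^sub>s F\<^sub>s E0"
    using deck_group.fundamental_domain_exists[OF deck_group.intro] assms(2,4) by blast
  have "surface_map G F D0 G\<^sub>s F\<^sub>s E0 D D\<^sub>s f"
    using D0 E0 assms(5,6,9,10) by (auto simp: surface_map_def surface_map_axioms_def surf_domain_def)
  then interpret luzin_map G F D0 G\<^sub>s F\<^sub>s E0 D D\<^sub>s f
    using assms(11,13,14) by (auto simp: luzin_map_def luzin_map_axioms_def)
  show ?thesis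
    by (rule le_of_le_power_mult) (rule modulus_image_le[OF assms(12,15,16)])
qed

end
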